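(* Let $T$ be a Calderón--Zygmund operator on $\mathbb{R}^n$, let $\Phi=\{\phi_\alpha\}_{\alpha\in\mathcal{I}}$ be a family of real-valued measurable functions indexed by an arbitrary set $\mathcal{I}$, and let $T^\Phi$ be the associated maximally modulated Calderón--Zygmund operator $T^{\Phi}f(x)=\sup_{\alpha\in\mathcal{I}}|T(e^{2\pi i\phi_\alpha}f)(x)|$. Assume that for some $r_0>1$ the operator $T^\Phi$ satisfies the a priori weak-type unweighted inequalities $$\|T^{\Phi}f\|_{L^{s,\infty}(\mathbb{R}^n)}\lesssim\psi(s)\|f\|_{L^s(\mathbb{R}^n)},\qquad 1<s\le r_0,$$ where $\psi(s)$ is a function that captures the dependence of the operator norm on $s$. Let $1<p<\infty$, $\frac1p+\frac1{p'}=1$, and let $A,B$ be doubling Young functions such that $\bar A\in B_{p'}$ and $\bar B\in B_{p/r}$ for some $1<r<\min\{r_0,p\}$. Let $u$ and $v$ be positive weights such that $$\sup_{Q\subset\mathbb{R}^n}\|u^{1/p}\|_{A,Q}\,\|v^{-r/p}\|_{B,Q}^{1/r}<\infty,$$ the supremum being over all cubes $Q$. Then there is a constant $C=C_{n,p,A,B,u,v}<\infty$, independent of $f$, such that $$\int_{\mathbb{R}^n}|T^\Phi f(x)|^p\,u(x)\,dx\le C\int_{\mathbb{R}^n}|f(x)|^p\,v(x)\,dx .$$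
   Context: A weight is a non-negative locally integrable function. $X\lesssim Y$ means $X\le cY$ for a constant $c$ that is, in particular, independent of the function $f$. A Young function is a continuous, convex, increasing function $A:[0,\infty)\to[0,\infty)$ with $A(0)=0$ and $A(t)\to\infty$ as $t\to\infty$; it is doubling if there is a positive constant $C'$ with $A(2t)\le C'A(t)$ for $t>0$. The complementary Young function of $A$ is $\bar A(t)=\sup_{s>0}\{st-A(s)\}$, $t>0$. For a cube $Q\subset\mathbb{R}^n$, $\|g\|_{A,Q}=\inf\{\lambda>0:\frac1{|Q|}\int_QA(|g(y)|/\lambda)\,dy\le1\}$. For $1<\rho<\infty$, a Young function $D$ satisfies the $B_\rho$ condition, written $D\in B_\rho$, if there is $c>0$ with $\int_c^\infty\frac{D(t)}{t^\rho}\frac{dt}{t}<\infty$. A Calderón--Zygmund operator $T$ on $\mathbb{R}^n$ is an $L^2$-bounded linear operator represented as $Tf(x)=\int_{\mathbb{R}^n}K(x,y)f(y)\,dy$ for $x\notin\operatorname{supp}f$, where the kernel $K$ satisfies, for some constant $c_K$: (i) $|K(x,y)|\le c_K|x-y|^{-n}$ for all $x\ne y$; (ii) $|K(x,y)-K(x',y)|+|K(y,x)-K(y,x')|\le c_K\frac{|x-x'|^\delta}{|x-y|^{n+\delta}}$ for some $0<\delta\le1$ when $|x-x'|<|x-y|/2$. *)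

theory Defs
  imports "HOL-Analysis.Analysis"
begin

text \<open>
  Norms and integrals take values in \<^typ>\<open>ennreal\<close>, so that they make sense without
  finiteness assumptions. The ambient space is a type \<open>'a::euclidean_space\<close>, of dimension
  \<open>n = DIM('a)\<close>, with Lebesgue measure.
\<close>

(* Only meant for a > 0. *)
definition epowr :: "ennreal \<Rightarrow> real \<Rightarrow> ennreal" where
  "epowr x a = (if x = \<infinity> then \<infinity> else ennreal (enn2real x powr a))"

definition Lp_norm :: "real \<Rightarrow> ('a::euclidean_space \<Rightarrow> complex) \<Rightarrow> ennreal" where
  "Lp_norm s f = epowr (\<integral>\<^sup>+x. ennreal (norm (f x) powr s) \<partial>lebesgue) (1 / s)"

definition Lp :: "real \<Rightarrow> ('a::euclidean_space \<Rightarrow> complex) set" where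
  "Lp s = {f. f \<in> borel_measurable lebesgue \<and> Lp_norm s f < \<infinity>}"

definition weak_Lp_norm :: "real \<Rightarrow> ('a::euclidean_space \<Rightarrow> ennreal) \<Rightarrow> ennreal" where
  "weak_Lp_norm s g =
     (SUP t\<in>{0<..}. ennreal t * epowr (emeasure lebesgue {x. g x > ennreal t}) (1 / s))"

definition weight :: "('a::euclidean_space \<Rightarrow> real) \<Rightarrow> bool" where
  "weight w \<longleftrightarrow> (\<forall>x. 0 \<le> w x) \<and> (\<forall>S. compact S \<longrightarrow> w absolutely_integrable_on S)"

text \<open>
  Positivity is only required almost everywhere, so that for example a positive power of
  \<open>norm x\<close> is a positive weight.
\<close>
definition positive_weight :: "('a::euclidean_space \<Rightarrow> real) \<Rightarrow> bool" where
  "positive_weight w \<longleftrightarrow> weight w \<and> (AE x in lebesgue. 0 < w x)"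

definition cubes :: "'a::euclidean_space set set" where
  "cubes = {cbox a (a + l *\<^sub>R One) | a l. 0 < l}"

text \<open>Only the values of a Young function on \<open>[0, \<infinity>)\<close> matter.\<close>

definition young :: "(real \<Rightarrow> real) \<Rightarrow> bool" where
  "young A \<longleftrightarrow> continuous_on {0..} A \<and> convex_on {0..} A \<and> mono_on {0..} A \<and>
     A 0 = 0 \<and> filterlim A at_top at_top"

definition doubling :: "(real \<Rightarrow> real) \<Rightarrow> bool" where
  "doubling A \<longleftrightarrow> (\<exists>C>0. \<forall>t>0. A (2 * t) \<le> C * A t)"

text \<open>
  The complementary function may take the value \<open>\<infinity>\<close>. For a Young function \<open>A\<close> the supremum of
  \<open>s * t - A s\<close> over \<open>s > 0\<close> is nonnegative (let \<open>s\<close> tend to \<open>0\<close>), so the truncation of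
  negative values by \<^const>\<open>ennreal\<close> does not change it.
\<close>
definition complementary :: "(real \<Rightarrow> real) \<Rightarrow> real \<Rightarrow> ennreal" where
  "complementary A t = (SUP s\<in>{0<..}. ennreal (s * t - A s))"

definition B_cond :: "real \<Rightarrow> (real \<Rightarrow> ennreal) \<Rightarrow> bool" where
  "B_cond \<rho> D \<longleftrightarrow>
     (\<exists>c>0. (\<integral>\<^sup>+t\<in>{c..}. (D t / ennreal (t powr \<rho>) / ennreal t) \<partial>lebesgue) < \<infinity>)"

definition orlicz_norm ::
  "(real \<Rightarrow> real) \<Rightarrow> 'a::euclidean_space set \<Rightarrow> ('a \<Rightarrow> real) \<Rightarrow> ennreal" where
  "orlicz_norm A Q g = Inf {ennreal l | l. 0 < l \<and>
     (\<integral>\<^sup>+y\<in>Q. ennreal (A (\<bar>g y\<bar> / l)) \<partial>lebesgue) / emeasure lebesgue Q \<le> 1}"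

definition cz_kernel :: "('a::euclidean_space \<Rightarrow> 'a \<Rightarrow> complex) \<Rightarrow> bool" where
  "cz_kernel K \<longleftrightarrow> (\<exists>c.
     (\<forall>x y. x \<noteq> y \<longrightarrow> norm (K x y) \<le> c / norm (x - y) ^ DIM('a)) \<and>
     (\<exists>\<delta>. 0 < \<delta> \<and> \<delta> \<le> 1 \<and>
       (\<forall>x x' y. norm (x - x') < norm (x - y) / 2 \<longrightarrow>
         norm (K x y - K x' y) + norm (K y x - K y x')
           \<le> c * norm (x - x') powr \<delta> / norm (x - y) powr (real DIM('a) + \<delta>))))"

text \<open>
  An operator acts on functions, not on equivalence classes, since the maximal modulation takes a
  pointwise supremum over a possibly uncountable index set. Its domain \<open>\<D>\<close> contains the whole of
  \<open>L\<^sup>2\<close> and may be larger, to allow for extensions of \<open>T\<close> beyond \<open>L\<^sup>2\<close>.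
  Multiplication by bounded measurable functions includes scalar multiples, modulations and
  restrictions to measurable sets.
\<close>
definition cz_domain :: "('a::euclidean_space \<Rightarrow> complex) set \<Rightarrow> bool" where
  "cz_domain \<D> \<longleftrightarrow> \<D> \<subseteq> borel_measurable lebesgue \<and> Lp 2 \<subseteq> \<D> \<and>
     (\<forall>f\<in>\<D>. \<forall>g\<in>\<D>. (\<lambda>x. f x + g x) \<in> \<D>) \<and>
     (\<forall>f\<in>\<D>. \<forall>m. m \<in> borel_measurable lebesgue \<and> bounded (range m) \<longrightarrow> (\<lambda>x. m x * f x) \<in> \<D>)"

definition calderon_zygmund ::
  "('a::euclidean_space \<Rightarrow> complex) set \<Rightarrow> (('a \<Rightarrow> complex) \<Rightarrow> 'a \<Rightarrow> complex) \<Rightarrow> bool" where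
  "calderon_zygmund \<D> T \<longleftrightarrow> cz_domain \<D> \<and>
     (\<forall>f\<in>\<D>. \<forall>g\<in>\<D>. \<forall>x. T (\<lambda>y. f y + g y) x = T f x + T g x) \<and>
     (\<forall>f\<in>\<D>. \<forall>c x. T (\<lambda>y. c * f y) x = c * T f x) \<and>
     (\<exists>C. \<forall>f\<in>Lp 2. T f \<in> borel_measurable lebesgue \<and> Lp_norm 2 (T f) \<le> ennreal C * Lp_norm 2 f) \<and>
     (\<exists>K. cz_kernel K \<and>
       (\<forall>f\<in>\<D>. \<forall>x. x \<notin> closure {y. f y \<noteq> 0} \<longrightarrow>
         integrable lebesgue (\<lambda>y. K x y * f y) \<and> T f x = (LINT y|lebesgue. K x y * f y)))"

definition max_modulated ::
  "'i set \<Rightarrow> ('i \<Rightarrow> 'a \<Rightarrow> real) \<Rightarrow> (('a \<Rightarrow> complex) \<Rightarrow> 'a \<Rightarrow> complex) \<Rightarrow>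
   ('a \<Rightarrow> complex) \<Rightarrow> 'a \<Rightarrow> ennreal" where
  "max_modulated I \<phi> T f x =
     (SUP \<alpha>\<in>I. ennreal (norm (T (\<lambda>y. exp (2 * of_real pi * \<i> * of_real (\<phi> \<alpha> y)) * f y) x)))"

text \<open>
  Measurability of \<open>S f\<close> is part of the statement that \<open>S f\<close> lies in weak \<open>L\<^sup>s\<close>; it is not
  automatic for a supremum over an uncountable index set.
\<close>
definition weak_type_upto ::
  "('a::euclidean_space \<Rightarrow> complex) set \<Rightarrow> (('a \<Rightarrow> complex) \<Rightarrow> 'a \<Rightarrow> ennreal) \<Rightarrow>
   real \<Rightarrow> (real \<Rightarrow> real) \<Rightarrow> bool" where
  "weak_type_upto \<D> S r\<^sub>0 \<psi> \<longleftrightarrow> (\<exists>c. \<forall>s. 1 < s \<and> s \<le> r\<^sub>0 \<longrightarrow>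
     (\<forall>f\<in>\<D> \<inter> Lp s. S f \<in> borel_measurable lebesgue \<and>
       weak_Lp_norm s (S f) \<le> ennreal (c * \<psi> s) * Lp_norm s f))"

end

theory Submission
  imports Defs
begin

text \<open>
  Only the weak type inequality for the single exponent \<open>r\<close> is needed. Fix a large dyadic cube and, for a dyadic
  cube \<open>Q\<close>, let \<open>a Q\<close> be the \<open>L\<^sup>r\<close> average of \<open>f\<close> over a dilate \<open>Q*\<close>. The maximal subcubes \<open>P\<close> of \<open>Q\<close> on
  which the average jumps, or which meet the set where \<open>S (1_Q* f)\<close> exceeds a multiple of \<open>a Q\<close> in a large
  proportion, have small total measure. On \<open>P\<close> the function \<open>S (1_(Q* - P*) f)\<close> is almost constant because of the
  smoothness of the kernel, so it is at most a multiple of \<open>a Q\<close>. Iteration bounds \<open>S f\<close> almost everywhere by a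
  sparse sum \<open>F\<close> of terms \<open>a Q\<close> on \<open>Q\<close>. In the integral of \<open>F\<^sup>p u\<close> one factor \<open>F\<close> is expanded. Young's
  inequality for the two Orlicz norms and the bump condition reduce each term to norms of \<open>f v\<^bsup>1/p\<^esup>\<close> and of
  \<open>g = F\<^bsup>p-1\<^esup> u\<^bsup>1/p'\<^esup>\<close> with respect to the complementary functions, and these sum up by a Carleson
  embedding that follows from the two \<open>B\<close> conditions. Since \<open>g\<close> has the same norm as \<open>F u\<^bsup>1/p\<^esup>\<close>, its
  contribution is absorbed.
\<close>

text \<open>A function \<open>f\<close> of the domain need not lie in the unweighted
  \<open>L^r\<close>, so neither measurability nor a weak type bound is available for
  \<open>S f\<close> itself. Both hold for restrictions of \<open>f\<close> to cubes, because the
  bump condition makes \<open>|f|^r\<close> locally integrable once the weighted norm of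
  \<open>f\<close> is finite. Hence the estimate is proved on a cube, with constants independent of
  its size, and passes to the whole space by Fatou's lemma. Three more obstacles shape the argument.
  The averages are taken over dilates, which overlap even for disjoint cubes, so selecting maximal
  dyadic cubes does not give weak type bounds; a Vitali selection does. Absorption is possible only
  for finite quantities, so the sparse family is cut off at a level \<open>N\<close>: then
  \<open>F\<close> is bounded and the local integrability of \<open>u\<close> makes the integral
  finite. Finally, the Carleson embedding works with heights \<open>2 ^ k * \<tau>\<close> above a
  lowest height \<open>\<tau>\<close>; the error this causes is proportional to the volume of the
  large cube and is removed by sending \<open>\<tau>\<close> to zero while the cube is
  fixed.\<close>

abbreviation vol :: "'a::euclidean_space set \<Rightarrow> ennreal" where
  "vol \<equiv> emeasure lebesgue"

text \<open>Admissibility of \<open>l\<close> in the infimum that defines the Luxemburg norm, with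
  the division by the volume cleared.\<close>

abbreviation lux :: "(real \<Rightarrow> real) \<Rightarrow> 'a::euclidean_space set \<Rightarrow> ('a \<Rightarrow> real) \<Rightarrow> real \<Rightarrow> bool" where
  "lux A Q g l \<equiv> (\<integral>\<^sup>+y\<in>Q. ennreal (A (\<bar>g y\<bar> / l)) \<partial>lebesgue) \<le> vol Q"

text \<open>The infima in the two Luxemburg norms need not be attained, so the bump condition is
  carried along by real admissible constants. They may depend on the cube; only \<open>U\<close> is
  uniform.\<close>

abbreviation bumped ::
  "(real \<Rightarrow> real) \<Rightarrow> (real \<Rightarrow> real) \<Rightarrow> ('a::euclidean_space \<Rightarrow> real) \<Rightarrow> ('a \<Rightarrow> real) \<Rightarrow> real \<Rightarrow> real \<Rightarrow> real \<Rightarrow> 'a set \<Rightarrow> bool" where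
  "bumped A B u v p r U Q \<equiv> \<exists>lA lB. 0 < lA \<and> 0 < lB \<and> lA * lB powr (1 / r) \<le> U
    \<and> lux A Q (\<lambda>y. u y powr (1 / p)) lA \<and> lux B Q (\<lambda>y. v y powr (- r / p)) lB"

abbreviation power_integral :: "real \<Rightarrow> ('a::euclidean_space \<Rightarrow> complex) \<Rightarrow> ennreal" where
  "power_integral r f \<equiv> \<integral>\<^sup>+x. ennreal (norm (f x) powr r) \<partial>lebesgue"

section \<open>Dyadic cubes and a covering lemma\<close>

lemma euclidean_dist_le:
  fixes x y :: "'a::euclidean_space"
  assumes "\<And>i. i \<in> Basis \<Longrightarrow> \<bar>x \<bullet> i - y \<bullet> i\<bar> \<le> s"
  shows "norm (x - y) \<le> real DIM('a) * s"
proof -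
  have "norm (x - y) \<le> (\<Sum>i\<in>Basis. \<bar>(x - y) \<bullet> i\<bar>)" by (rule norm_le_l1)
  also have "\<dots> \<le> (\<Sum>i\<in>(Basis::'a set). s)"
    by (intro sum_mono) (simp add: assms inner_diff_left)
  finally show ?thesis by simp
qed

text \<open>Absorption is legitimate only for finite quantities; taking \<open>a\<close> real and
  leaving \<open>x\<close> in \<open>ennreal\<close> builds this in.\<close>

lemma ennreal_absorb:
  assumes "0 \<le> a" "0 \<le> \<eta>" "\<eta> < 1" and le: "ennreal a \<le> ennreal (\<eta> * a) + x"
  shows "ennreal a \<le> ennreal (1 / (1 - \<eta>)) * x"
proof -
  have "ennreal ((1 - \<eta>) * a) = ennreal a - ennreal (\<eta> * a)"
    using assms by (simp add: ennreal_minus algebra_simps)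
  also have "\<dots> \<le> x" using le by (simp add: ennreal_minus_le_iff)
  finally have "ennreal (1 / (1 - \<eta>)) * ennreal ((1 - \<eta>) * a) \<le> ennreal (1 / (1 - \<eta>)) * x"
    by (intro mult_left_mono) auto
  moreover have "ennreal (1 / (1 - \<eta>)) * ennreal ((1 - \<eta>) * a) = ennreal a"
    using assms by (simp add: ennreal_mult[symmetric])
  ultimately show ?thesis by simp
qed

lemma emeasure_cball_le:
  fixes c :: "'a::euclidean_space"
  assumes "0 \<le> R"
  shows "vol (cball c R) \<le> ennreal ((2 * R) ^ DIM('a))"
proof -
  have "cball c R \<subseteq> cbox (c - R *\<^sub>R One) (c + R *\<^sub>R One)"
  proof
    fix x assume "x \<in> cball c R"
    hence "norm (x - c) \<le> R" by (simp add: dist_norm norm_minus_commute)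
    hence "\<bar>(x - c) \<bullet> i\<bar> \<le> R" if "i \<in> Basis" for i
      using Basis_le_norm[OF that, of "x - c"] by simp
    thus "x \<in> cbox (c - R *\<^sub>R One) (c + R *\<^sub>R One)"
      by (auto simp: mem_box inner_diff_left inner_add_left abs_le_iff) (smt (verit))+
  qed
  hence "vol (cball c R) \<le> vol (cbox (c - R *\<^sub>R One) (c + R *\<^sub>R One))"
    by (intro emeasure_mono) auto
  also have "\<dots> = ennreal ((2 * R) ^ DIM('a))"
    using assms by (simp add: emeasure_lborel_cbox_eq inner_diff_left inner_add_left prod_constant)
  finally show ?thesis .
qed

text \<open>The value makes \<open>kap - 1\<close> equal to \<open>4 * DIM('a)\<close>: a point
  outside the dilate is at distance at least \<open>4 * DIM('a) * side k\<close> from any point of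
  the cube, four times the bound on the diameter, even after one side length is lost to the position
  inside the cube.\<close>

definition kap :: "'a::euclidean_space itself \<Rightarrow> real" where
  "kap _ = 4 * real DIM('a) + 1"

lemma kap_ge: "5 \<le> kap TYPE('a::euclidean_space)"
proof -
  have "1 \<le> real DIM('a)"
    using DIM_positive[where 'a='a] by linarith
  thus ?thesis by (simp add: kap_def)
qed

text \<open>The constant of the Vitali selection: a dilate lies in a ball of radius
  \<open>DIM('a) * (kap + 1) * side k\<close> about any point of its cube, and the ball enlarged
  five times fits into a box of ten times this side length.\<close>

definition cov :: "'a::euclidean_space itself \<Rightarrow> real" where
  "cov _ = (10 * (real DIM('a) * (kap TYPE('a) + 1))) ^ DIM('a)"

lemma cov_pos: "0 < cov TYPE('a::euclidean_space)"
  using kap_ge[where 'a='a] by (simp add: cov_def)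

lemma emeasure_UN_countable_le:
  assumes [measurable]: "\<And>i. i \<in> I \<Longrightarrow> X i \<in> sets M" and I: "countable I"
  shows "emeasure M (\<Union>i\<in>I. X i) \<le> (\<integral>\<^sup>+i. emeasure M (X i) \<partial>count_space I)"
proof -
  have [measurable]: "(\<Union>i\<in>I. X i) \<in> sets M" using I by (intro sets.countable_UN'') auto
  have "emeasure M (\<Union>i\<in>I. X i) = (\<integral>\<^sup>+x. indicator (\<Union>i\<in>I. X i) x \<partial>M)" by simp
  also have "\<dots> \<le> (\<integral>\<^sup>+x. (\<integral>\<^sup>+i. indicator (X i) x \<partial>count_space I) \<partial>M)"
  proof (intro nn_integral_mono)
    fix x
    show "indicator (\<Union>i\<in>I. X i) x \<le> (\<integral>\<^sup>+i. indicator (X i) x \<partial>count_space I :: ennreal)"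
    proof (cases "x \<in> (\<Union>i\<in>I. X i)")
      case True
      then obtain i where "i \<in> I" "x \<in> X i" by blast
      thus ?thesis using nn_integral_ge_point[of i I "\<lambda>i. indicator (X i) x"] True by simp
    qed simp
  qed
  also have "\<dots> = (\<integral>\<^sup>+i. (\<integral>\<^sup>+x. indicator (X i) x \<partial>M) \<partial>count_space I)"
    using I by (intro nn_integral_count_space_nn_integral) auto
  also have "\<dots> = (\<integral>\<^sup>+i. emeasure M (X i) \<partial>count_space I)"
    by (intro nn_integral_cong) simp
  finally show ?thesis .
qed

lemma nn_integral_disjoint_le:
  assumes [measurable]: "\<And>i. i \<in> I \<Longrightarrow> X i \<in> sets M" and I: "countable I"
    and dj: "disjoint_family_on X I" and [measurable]: "g \<in> borel_measurable M"
  shows "(\<integral>\<^sup>+i. (\<integral>\<^sup>+x\<in>X i. g x \<partial>M) \<partial>count_space I) \<le> (\<integral>\<^sup>+x. g x \<partial>M)"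
proof -
  have [measurable]: "(\<Union>i\<in>I. X i) \<in> sets M" using I by (intro sets.countable_UN'') auto
  have "(\<integral>\<^sup>+i. (\<integral>\<^sup>+x\<in>X i. g x \<partial>M) \<partial>count_space I)
      = (\<integral>\<^sup>+i. emeasure (density M g) (X i) \<partial>count_space I)"
    by (intro nn_integral_cong) (simp add: emeasure_density)
  also have "\<dots> = emeasure (density M g) (\<Union>i\<in>I. X i)"
    using I dj by (intro emeasure_UN_countable[symmetric]) auto
  also have "\<dots> = (\<integral>\<^sup>+x\<in>(\<Union>i\<in>I. X i). g x \<partial>M)" by (simp add: emeasure_density)
  also have "\<dots> \<le> (\<integral>\<^sup>+x. g x \<partial>M)"
    by (intro nn_integral_mono) (auto simp: indicator_def)
  finally show ?thesis .
qed

text \<open>The set \<open>Z\<close> is not assumed to be measurable: it lies in a countable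
  intersection of measurable sets that is null, and Lebesgue measure is complete.\<close>

lemma null_sets_lebesgueI:
  fixes Z :: "'a::euclidean_space set"
  assumes small: "\<And>e. 0 < e \<Longrightarrow> \<exists>V\<in>sets lebesgue. Z \<subseteq> V \<and> vol V \<le> ennreal e"
  shows "Z \<in> null_sets lebesgue"
proof -
  have "\<forall>n. \<exists>V. V \<in> sets lebesgue \<and> Z \<subseteq> V \<and> vol V \<le> ennreal (1 / real (Suc n))"
    using small by (meson of_nat_0_less_iff zero_less_Suc zero_less_divide_1_iff)
  then obtain V where V: "\<And>n. V n \<in> sets lebesgue" "\<And>n. Z \<subseteq> V n"
      "\<And>n. vol (V n) \<le> ennreal (1 / real (Suc n))" by metis
  have le: "vol (\<Inter>n. V n) \<le> ennreal (1 / real (Suc n))" for n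
    using V by (intro order.trans[OF emeasure_mono V(3)[of n]]) auto
  have "(\<lambda>n. ennreal (1 / real (Suc n))) \<longlonglongrightarrow> ennreal 0"
    by (intro tendsto_ennrealI LIMSEQ_Suc[OF lim_1_over_n])
  hence "vol (\<Inter>n. V n) \<le> ennreal 0"
    by (rule LIMSEQ_le_const) (use le in auto)
  moreover have "(\<Inter>n. V n) \<in> sets lebesgue" using V(1) by auto
  ultimately have "(\<Inter>n. V n) \<in> null_sets lebesgue" by (auto simp: null_sets_def)
  thus ?thesis by (rule null_sets_completion_subset[rotated]) (use V(2) in blast)
qed

section \<open>Half-open dyadic cubes and their dilates\<close>

locale grid =
  fixes L :: real
  assumes L_pos: "0 < L"
begin

text \<open>\<open>L\<close> is half the side of the base cube, so letting \<open>L\<close> grow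
  exhausts the space.\<close>

definition side :: "nat \<Rightarrow> real" where
  "side k = 2 * L / 2 ^ k"

text \<open>A cube is indexed by its level and any of its points. The floor makes the cubes of one
  level a half-open partition, and the lower corner serves as canonical index.\<close>

definition corner :: "nat \<Rightarrow> 'a::euclidean_space \<Rightarrow> 'a" where
  "corner k x = (\<Sum>i\<in>Basis. (side k * of_int \<lfloor>(x \<bullet> i + L) / side k\<rfloor> - L) *\<^sub>R i)"

definition dcube :: "nat \<Rightarrow> 'a::euclidean_space \<Rightarrow> 'a set" where
  "dcube k x = {y. corner k y = corner k x}"

text \<open>The dilation factor is large enough for points of a dyadic cube to be much closer to each
  other than to the complement of the dilated cube.\<close>
definition dstar :: "nat \<Rightarrow> 'a::euclidean_space \<Rightarrow> 'a set" where
  "dstar k x = cbox (corner k x - (kap TYPE('a) * side k) *\<^sub>R One)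
                    (corner k x + (kap TYPE('a) * side k) *\<^sub>R One)"

abbreviation cover :: "(nat \<times> 'a::euclidean_space) set \<Rightarrow> 'a set" where
  "cover W \<equiv> \<Union>(j, y)\<in>W. dcube j y"

abbreviation Q1 :: "nat \<times> 'a::euclidean_space \<Rightarrow> 'a set" where
  "Q1 q \<equiv> dcube (fst q) (snd q)"

abbreviation Q2 :: "nat \<times> 'a::euclidean_space \<Rightarrow> 'a set" where
  "Q2 q \<equiv> dstar (fst q) (snd q)"

lemma side_pos [simp]: "0 < side k"
  using L_pos by (simp add: side_def)

lemma side_nonneg [simp]: "0 \<le> side k"
  using side_pos[of k] by linarith

lemma side_neq_0 [simp]: "side k \<noteq> 0"
  using side_pos[of k] by linarith

lemma side_Suc: "side (Suc k) = side k / 2"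
  by (simp add: side_def)

lemma side_add: "side k = 2 ^ j * side (k + j)"
  by (simp add: side_def power_add)

lemma side_le: "j \<le> k \<Longrightarrow> side k \<le> side j"
  using L_pos by (simp add: side_def field_simps)

lemma corner_inner: "i \<in> Basis \<Longrightarrow> corner k x \<bullet> i = side k * of_int \<lfloor>(x \<bullet> i + L) / side k\<rfloor> - L"
  by (simp add: corner_def)

lemma corner_le: "i \<in> Basis \<Longrightarrow> corner k x \<bullet> i \<le> x \<bullet> i"
proof -
  assume i: "i \<in> Basis"
  have "of_int \<lfloor>(x \<bullet> i + L) / side k\<rfloor> \<le> (x \<bullet> i + L) / side k" by linarith
  hence "side k * of_int \<lfloor>(x \<bullet> i + L) / side k\<rfloor> \<le> side k * ((x \<bullet> i + L) / side k)"
    using side_nonneg mult_left_mono by blast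
  thus ?thesis using i by (simp add: corner_inner)
qed

lemma less_corner: "i \<in> Basis \<Longrightarrow> x \<bullet> i < corner k x \<bullet> i + side k"
proof -
  assume i: "i \<in> Basis"
  have "(x \<bullet> i + L) / side k < of_int \<lfloor>(x \<bullet> i + L) / side k\<rfloor> + 1" by linarith
  hence "side k * ((x \<bullet> i + L) / side k) < side k * (of_int \<lfloor>(x \<bullet> i + L) / side k\<rfloor> + 1)"
    using side_pos mult_strict_left_mono by blast
  hence "x \<bullet> i + L < side k * (of_int \<lfloor>(x \<bullet> i + L) / side k\<rfloor> + 1)" by simp
  thus ?thesis using i by (simp add: corner_inner algebra_simps del: add.commute)
qed

lemma corner_eqI:
  assumes "\<And>i. i \<in> Basis \<Longrightarrow> corner k x \<bullet> i \<le> y \<bullet> i \<and> y \<bullet> i < corner k x \<bullet> i + side k"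
  shows "corner k y = corner k x"
proof (rule euclidean_eqI)
  fix i :: 'a assume i: "i \<in> Basis"
  let ?m = "\<lfloor>(x \<bullet> i + L) / side k\<rfloor>"
  have "side k * of_int ?m \<le> y \<bullet> i + L" "y \<bullet> i + L < side k * of_int ?m + side k"
    using assms[OF i] i by (auto simp: corner_inner)
  hence "of_int ?m \<le> (y \<bullet> i + L) / side k" "(y \<bullet> i + L) / side k < of_int ?m + 1"
    by (auto simp: field_simps)
  hence "\<lfloor>(y \<bullet> i + L) / side k\<rfloor> = ?m" by linarith
  thus "corner k y \<bullet> i = corner k x \<bullet> i" using i by (simp add: corner_inner)
qed

lemma dcube_eq: "dcube k x = {y. \<forall>i\<in>Basis. corner k x \<bullet> i \<le> y \<bullet> i \<and> y \<bullet> i < corner k x \<bullet> i + side k}"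
proof (intro set_eqI iffI)
  fix y assume "y \<in> dcube k x"
  hence "corner k x = corner k y" by (simp add: dcube_def)
  thus "y \<in> {y. \<forall>i\<in>Basis. corner k x \<bullet> i \<le> y \<bullet> i \<and> y \<bullet> i < corner k x \<bullet> i + side k}"
    by (simp add: corner_le less_corner)
next
  fix y assume "y \<in> {y. \<forall>i\<in>Basis. corner k x \<bullet> i \<le> y \<bullet> i \<and> y \<bullet> i < corner k x \<bullet> i + side k}"
  hence "corner k y = corner k x" by (intro corner_eqI) auto
  thus "y \<in> dcube k x" by (simp add: dcube_def)
qed

lemma dcube_self [simp]: "x \<in> dcube k x"
  by (simp add: dcube_def)

lemma corner_corner [simp]: "corner k (corner k x) = corner k x"
  by (rule corner_eqI) auto

text \<open>Dyadic nesting rests on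
  \<open>\<lfloor>2 * a\<rfloor> div 2 = \<lfloor>a\<rfloor>\<close>: the integer coordinates of a
  cube determine those of its parent.\<close>

lemma corner_Suc_cong: "corner (Suc k) x = corner (Suc k) y \<Longrightarrow> corner k x = corner k y"
proof (rule euclidean_eqI)
  fix i :: 'a assume eq: "corner (Suc k) x = corner (Suc k) y" and i: "i \<in> Basis"
  have "\<lfloor>(x \<bullet> i + L) / side (Suc k)\<rfloor> = \<lfloor>(y \<bullet> i + L) / side (Suc k)\<rfloor>"
    using arg_cong[OF eq, of "\<lambda>z. z \<bullet> i"] i by (simp add: corner_inner)
  hence "\<lfloor>2 * ((x \<bullet> i + L) / side k)\<rfloor> = \<lfloor>2 * ((y \<bullet> i + L) / side k)\<rfloor>"
    by (simp add: side_Suc algebra_simps)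
  moreover have "\<lfloor>2 * a\<rfloor> div 2 = \<lfloor>a\<rfloor>" for a :: real
    using floor_divide_real_eq_div[of 2 "2 * a"] by simp
  ultimately have "\<lfloor>(x \<bullet> i + L) / side k\<rfloor> = \<lfloor>(y \<bullet> i + L) / side k\<rfloor>" by metis
  thus "corner k x \<bullet> i = corner k y \<bullet> i" using i by (simp add: corner_inner)
qed

lemma corner_cong: "j \<le> k \<Longrightarrow> corner k x = corner k y \<Longrightarrow> corner j x = corner j y"
  by (induction k rule: dec_induct) (auto dest: corner_Suc_cong)

lemma corner_corner_le [simp]: "j \<le> k \<Longrightarrow> corner j (corner k x) = corner j x"
  by (rule corner_cong[of _ k]) auto

lemma dcube_cong: "corner k x = corner k y \<Longrightarrow> dcube k x = dcube k y"
  by (simp add: dcube_def)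

lemma dstar_cong: "corner k x = corner k y \<Longrightarrow> dstar k x = dstar k y"
  by (simp add: dstar_def)

lemma dcube_mono: "j \<le> k \<Longrightarrow> dcube k x \<subseteq> dcube j x"
  using corner_cong by (auto simp: dcube_def)

lemma dcube_eq_Inter: "dcube k x = (\<Inter>i\<in>Basis. {y. corner k x \<bullet> i \<le> y \<bullet> i} \<inter> {y. y \<bullet> i < corner k x \<bullet> i + side k})"
  by (auto simp: dcube_eq)

lemma dcube_borel [measurable]: "dcube k x \<in> sets borel"
  unfolding dcube_eq_Inter
  by (intro sets.finite_INT sets.Int borel_closed borel_open)
     (auto intro!: closed_Collect_le open_Collect_less continuous_intros)

lemma dcube_lebesgue [measurable]: "dcube k x \<in> sets lebesgue"
  using dcube_borel by simp

lemma dstar_lebesgue [measurable]: "dstar k x \<in> sets lebesgue"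
  by (simp add: dstar_def)

lemma emeasure_dcube: "vol (dcube k (x::'a::euclidean_space)) = ennreal (side k ^ DIM('a))"
proof (rule antisym)
  let ?a = "corner k x" and ?b = "corner k x + side k *\<^sub>R One"
  have e: "vol (cbox ?a ?b) = ennreal (side k ^ DIM('a))"
    by (simp add: emeasure_lborel_cbox_eq inner_add_left)
  have e': "vol (box ?a ?b) = ennreal (side k ^ DIM('a))"
    by (simp add: emeasure_lborel_box_eq inner_add_left)
  have "dcube k x \<subseteq> cbox ?a ?b" "box ?a ?b \<subseteq> dcube k x"
    by (auto simp: dcube_eq mem_box inner_add_left less_imp_le)
  hence "vol (dcube k x) \<le> vol (cbox ?a ?b)"
    "vol (box ?a ?b) \<le> vol (dcube k x)"
    by (auto intro!: emeasure_mono)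
  thus "vol (dcube k x) \<le> ennreal (side k ^ DIM('a))"
    "ennreal (side k ^ DIM('a)) \<le> vol (dcube k x)"
    using e e' by simp_all
qed

lemma dstar_cubes: "dstar k (x::'a::euclidean_space) \<in> cubes"
proof -
  have "dstar k x = cbox (corner k x - (kap TYPE('a) * side k) *\<^sub>R One)
     ((corner k x - (kap TYPE('a) * side k) *\<^sub>R One) + (2 * kap TYPE('a) * side k) *\<^sub>R One)"
    unfolding dstar_def
    by (rule arg_cong[where f="cbox _"], rule euclidean_eqI) (simp add: inner_add_left inner_diff_left)
  thus ?thesis using kap_ge[where 'a='a] unfolding cubes_def
    by (intro CollectI exI conjI) (assumption, simp)
qed

lemma emeasure_dstar:
  "vol (dstar k (x::'a::euclidean_space)) = ennreal ((2 * kap TYPE('a)) ^ DIM('a) * side k ^ DIM('a))"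
  using kap_ge[where 'a='a]
  by (simp add: dstar_def emeasure_lborel_cbox_eq inner_diff_left inner_add_left prod_constant
      power_mult_distrib algebra_simps)

lemma dstar_iff: "y \<in> dstar k (x::'a::euclidean_space) \<longleftrightarrow>
    (\<forall>i\<in>Basis. \<bar>y \<bullet> i - corner k x \<bullet> i\<bar> \<le> kap TYPE('a) * side k)"
  by (auto simp: dstar_def mem_box inner_diff_left inner_add_left abs_le_iff)

lemma kap_side: "5 * side k \<le> kap TYPE('a::euclidean_space) * side k"
  using kap_ge[where 'a='a] by (intro mult_right_mono) auto

lemma dcube_subset_dstar: "dcube k (x::'a::euclidean_space) \<subseteq> dstar k x"
proof
  fix y assume y: "y \<in> dcube k x"
  have "\<bar>y \<bullet> i - corner k x \<bullet> i\<bar> \<le> kap TYPE('a) * side k" if "i \<in> Basis" for i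
  proof -
    have "corner k x \<bullet> i \<le> y \<bullet> i \<and> y \<bullet> i < corner k x \<bullet> i + side k"
      using y that by (simp add: dcube_eq)
    thus ?thesis using kap_side[of k, where 'a='a] side_pos[of k] by linarith
  qed
  thus "y \<in> dstar k x" by (simp add: dstar_iff)
qed

text \<open>The corner of a child moves by less than \<open>side k\<close>, while the radius of the
  dilate shrinks by \<open>kap * side k / 2\<close>, which is larger because \<open>kap\<close> is
  at least 5.\<close>

lemma dstar_Suc: "dstar (Suc k) (x::'a::euclidean_space) \<subseteq> dstar k x"
proof
  fix y assume y: "y \<in> dstar (Suc k) x"
  have "\<bar>y \<bullet> i - corner k x \<bullet> i\<bar> \<le> kap TYPE('a) * side k" if i: "i \<in> Basis" for i
  proof -
    have "corner (Suc k) x \<in> dcube k x" by (simp add: dcube_def)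
    hence 1: "corner k x \<bullet> i \<le> corner (Suc k) x \<bullet> i" "corner (Suc k) x \<bullet> i < corner k x \<bullet> i + side k"
      using i by (auto simp: dcube_eq)
    have 2: "\<bar>y \<bullet> i - corner (Suc k) x \<bullet> i\<bar> \<le> kap TYPE('a) * side k / 2"
      using y i by (auto simp: dstar_iff side_Suc)
    show ?thesis using 1 2 kap_side[of k, where 'a='a] side_pos[of k] by linarith
  qed
  thus "y \<in> dstar k x" by (simp add: dstar_iff)
qed

lemma dstar_mono: "j \<le> k \<Longrightarrow> dstar k (x::'a::euclidean_space) \<subseteq> dstar j x"
  by (induction k rule: dec_induct) (use dstar_Suc in blast)+

lemma dist_dcube:
  assumes "x \<in> dcube k z" "y \<in> dcube k (z::'a::euclidean_space)"
  shows "norm (x - y) \<le> real DIM('a) * side k"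
proof (rule euclidean_dist_le)
  fix i :: 'a assume i: "i \<in> Basis"
  show "\<bar>x \<bullet> i - y \<bullet> i\<bar> \<le> side k" using assms i by (force simp: dcube_eq)
qed

lemma dist_not_dstar:
  assumes x: "x \<in> dcube k z" and y: "y \<notin> dstar k (z::'a::euclidean_space)"
  shows "4 * real DIM('a) * side k \<le> norm (x - y)"
proof -
  obtain i where i: "i \<in> Basis" and 1: "kap TYPE('a) * side k < \<bar>y \<bullet> i - corner k z \<bullet> i\<bar>"
    using y by (auto simp: dstar_iff not_le)
  have 2: "corner k z \<bullet> i \<le> x \<bullet> i" "x \<bullet> i < corner k z \<bullet> i + side k"
    using x i by (auto simp: dcube_eq)
  have "kap TYPE('a) * side k - side k \<le> \<bar>(x - y) \<bullet> i\<bar>"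
    using 1 2 side_pos[of k] unfolding inner_diff_left by linarith
  also have "\<dots> \<le> norm (x - y)" by (rule Basis_le_norm[OF i])
  finally show ?thesis by (simp add: kap_def algebra_simps)
qed

lemma dstar_subset_cball:
  assumes x: "x \<in> dcube k (z::'a::euclidean_space)"
  shows "dstar k z \<subseteq> cball x (real DIM('a) * ((kap TYPE('a) + 1) * side k))"
proof
  fix y assume y: "y \<in> dstar k z"
  have "norm (x - y) \<le> real DIM('a) * ((kap TYPE('a) + 1) * side k)"
  proof (rule euclidean_dist_le)
    fix i :: 'a assume i: "i \<in> Basis"
    have "corner k z \<bullet> i \<le> x \<bullet> i" "x \<bullet> i < corner k z \<bullet> i + side k"
      using x i by (auto simp: dcube_eq)
    moreover have "\<bar>y \<bullet> i - corner k z \<bullet> i\<bar> \<le> kap TYPE('a) * side k"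
      using y i by (auto simp: dstar_iff)
    ultimately have "\<bar>x \<bullet> i - y \<bullet> i\<bar> \<le> kap TYPE('a) * side k + side k" by linarith
    thus "\<bar>x \<bullet> i - y \<bullet> i\<bar> \<le> (kap TYPE('a) + 1) * side k" by (simp add: algebra_simps)
  qed
  thus "y \<in> cball x (real DIM('a) * ((kap TYPE('a) + 1) * side k))" by (simp add: dist_norm)
qed

lemma corner_image_subset:
  assumes "\<And>x i. x \<in> X \<Longrightarrow> i \<in> Basis \<Longrightarrow> \<lfloor>(x \<bullet> i + L) / side k\<rfloor> \<in> J"
  shows "corner k ` (X::'a::euclidean_space set)
    \<subseteq> (\<lambda>h::'a \<Rightarrow> int. \<Sum>i\<in>Basis. (side k * of_int (h i) - L) *\<^sub>R i) ` (Pi\<^sub>E Basis (\<lambda>_. J))" (is "_ \<subseteq> ?g ` _")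
proof
  fix z assume "z \<in> corner k ` X"
  then obtain x where x: "x \<in> X" "z = corner k x" by blast
  let ?h = "restrict (\<lambda>i. \<lfloor>(x \<bullet> i + L) / side k\<rfloor>) Basis"
  have "z = ?g ?h" "?h \<in> Pi\<^sub>E Basis (\<lambda>_. J)" using x assms by (auto simp: corner_def)
  thus "z \<in> ?g ` (Pi\<^sub>E Basis (\<lambda>_. J))" by (intro image_eqI[of z ?g ?h])
qed

lemma countable_corners: "countable (corner k ` (X::'a::euclidean_space set))"
  by (rule countable_subset[OF corner_image_subset[where J = UNIV]])
     (auto intro!: countable_image countable_PiE)

definition base :: "'a::euclidean_space set" where "base = dcube 0 0"

lemma dcube_subset_base: "x \<in> base \<Longrightarrow> dcube k x \<subseteq> base"
  unfolding base_def using dcube_mono[of 0 k x] dcube_cong[of 0 x 0] by (auto simp: dcube_def)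

lemma base_eq: "base = {y::'a::euclidean_space. \<forall>i\<in>Basis. -L \<le> y \<bullet> i \<and> y \<bullet> i < L}"
proof -
  have "corner 0 (0::'a) \<bullet> i = - L" if "i \<in> Basis" for i
    using that L_pos by (simp add: corner_inner side_def)
  thus ?thesis by (auto simp: base_def dcube_eq side_def)
qed

lemma finite_corners: "finite (corner k ` (base::'a::euclidean_space set))"
proof (rule finite_subset[OF corner_image_subset[where J = "{0..2 ^ k}"]])
  fix x i :: 'a assume x: "x \<in> base" and i: "i \<in> Basis"
  have b: "- L \<le> x \<bullet> i" "x \<bullet> i < L" using x i by (auto simp: base_eq)
  have "0 \<le> (x \<bullet> i + L) / side k" using b by simp
  moreover have "(x \<bullet> i + L) / side k \<le> 2 ^ k"
    using b L_pos by (simp add: side_def field_simps)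
  ultimately have "0 \<le> \<lfloor>(x \<bullet> i + L) / side k\<rfloor>" "\<lfloor>(x \<bullet> i + L) / side k\<rfloor> \<le> \<lfloor>(2::real) ^ k\<rfloor>"
    by (simp, intro floor_mono)
  thus "\<lfloor>(x \<bullet> i + L) / side k\<rfloor> \<in> {0..2 ^ k}" by simp
qed (intro finite_imageI finite_PiE; simp)

text \<open>The weak type (1,1) inequality of the maximal function over dilates, in a form without
  the maximal function. The dilates of disjoint cubes may overlap, so the Vitali lemma is applied to
  balls that contain the dilates.\<close>

lemma dyadic_covering:
  fixes W :: "(nat \<times> 'a::euclidean_space) set"
  assumes g [measurable]: "g \<in> borel_measurable lebesgue"
    and W: "\<And>j y. (j, y) \<in> W \<Longrightarrow> vol (dcube j y) \<le> (\<integral>\<^sup>+x\<in>dstar j y. g x \<partial>lebesgue)"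
  shows "vol (cover W) \<le> ennreal (cov TYPE('a)) * (\<integral>\<^sup>+x. g x \<partial>lebesgue)"
proof -
  define \<rho> where "\<rho> = real DIM('a) * (kap TYPE('a) + 1)"
  have \<rho>: "0 < \<rho>" using kap_ge[where 'a='a] by (simp add: \<rho>_def)
  define c where "c = (\<lambda>i::nat \<times> 'a. snd i)"
  define R where "R = (\<lambda>i::nat \<times> 'a. \<rho> * side (fst i))"
  have sub: "dstar (fst i) (snd i) \<subseteq> cball (c i) (R i)" for i :: "nat \<times> 'a"
    using dstar_subset_cball[OF dcube_self, of "fst i" "snd i"] by (simp add: c_def R_def \<rho>_def mult.assoc)
  have "cover W \<subseteq> (\<Union>i\<in>W. cball (c i) (R i))"
  proof
    fix x assume "x \<in> cover W"
    then obtain j y where jy: "(j, y) \<in> W" "x \<in> dcube j y" by blast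
    hence "x \<in> cball (c (j, y)) (R (j, y))" using sub[of "(j, y)"] dcube_subset_dstar[of j y] by auto
    thus "x \<in> (\<Union>i\<in>W. cball (c i) (R i))" using jy by blast
  qed
  moreover have "0 < R i \<and> R i \<le> \<rho> * side 0" if "i \<in> W" for i
    using \<rho> side_le[of 0 "fst i"] by (simp add: R_def)
  ultimately obtain C where C: "countable C" "C \<subseteq> W"
      "pairwise (\<lambda>i j. disjnt (cball (c i) (R i)) (cball (c j) (R j))) C"
      and cover: "cover W \<subseteq> (\<Union>i\<in>C. cball (c i) (5 * R i))"
    by (rule Vitali_covering_lemma_cballs)
  \<comment> \<open>Disjointness of the enclosing balls passes to the dilates, so that the integrals
    of \<open>g\<close> over them add up.\<close>
  have dj: "disjoint_family_on (\<lambda>i. dstar (fst i) (snd i)) C"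
    unfolding disjoint_family_on_def
  proof (intro ballI impI)
    fix i j assume "i \<in> C" "j \<in> C" "i \<noteq> j"
    hence "cball (c i) (R i) \<inter> cball (c j) (R j) = {}"
      using C(3) by (auto simp: pairwise_def disjnt_def)
    thus "dstar (fst i) (snd i) \<inter> dstar (fst j) (snd j) = {}" using sub[of i] sub[of j] by blast
  qed
  have "vol (cover W) \<le> vol (\<Union>i\<in>C. cball (c i) (5 * R i))"
    using cover C(1) by (intro emeasure_mono) (auto intro!: sets.countable_UN'')
  also have "\<dots> \<le> (\<integral>\<^sup>+i. vol (cball (c i) (5 * R i)) \<partial>count_space C)"
    using C(1) by (intro emeasure_UN_countable_le) auto
  also have "\<dots> \<le> (\<integral>\<^sup>+i. ennreal (cov TYPE('a)) * (\<integral>\<^sup>+x\<in>dstar (fst i) (snd i). g x \<partial>lebesgue) \<partial>count_space C)"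
  proof (intro nn_integral_mono)
    fix i assume "i \<in> space (count_space C)"
    hence i: "(fst i, snd i) \<in> W" using C(2) by auto
    have "vol (cball (c i) (5 * R i)) \<le> ennreal ((2 * (5 * R i)) ^ DIM('a))"
      using \<rho> by (intro emeasure_cball_le) (simp add: R_def)
    also have "(2 * (5 * R i)) ^ DIM('a) = cov TYPE('a) * side (fst i) ^ DIM('a)"
      by (simp add: R_def \<rho>_def cov_def power_mult_distrib[symmetric] algebra_simps)
    also have "ennreal \<dots> = ennreal (cov TYPE('a)) * vol (dcube (fst i) (snd i))"
      using cov_pos[where 'a='a] by (simp add: emeasure_dcube ennreal_mult)
    also have "\<dots> \<le> ennreal (cov TYPE('a)) * (\<integral>\<^sup>+x\<in>dstar (fst i) (snd i). g x \<partial>lebesgue)"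
      using W[OF i] by (intro mult_left_mono) auto
    finally show "vol (cball (c i) (5 * R i)) \<le> \<dots>" .
  qed
  also have "\<dots> = ennreal (cov TYPE('a)) * (\<integral>\<^sup>+i. (\<integral>\<^sup>+x\<in>dstar (fst i) (snd i). g x \<partial>lebesgue) \<partial>count_space C)"
    by (intro nn_integral_cmult) simp
  also have "\<dots> \<le> ennreal (cov TYPE('a)) * (\<integral>\<^sup>+x. g x \<partial>lebesgue)"
    by (intro mult_left_mono nn_integral_disjoint_le dj C(1)) auto
  finally show ?thesis .
qed

text \<open>\<open>W\<close> may be uncountable, as every point of a cube is an index of it;
  replacing points by corners leaves countably many cubes.\<close>

lemma sets_UN_dcube:
  fixes W :: "(nat \<times> 'a::euclidean_space) set"
  shows "cover W \<in> sets lebesgue"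
proof -
  let ?C = "(SIGMA j:UNIV. corner j ` {y. (j, y) \<in> W})"
  have "cover W = (\<Union>(j, z)\<in>?C. dcube j z)"
    using dcube_cong[OF corner_corner] by (force simp: image_iff)
  moreover have "countable ?C" by (intro countable_SIGMA countable_corners) auto
  ultimately show ?thesis by (auto intro!: sets.countable_UN'')
qed

text \<open>A substitute for the Lebesgue density theorem: on an exceptional set the part of a slightly
  larger open set outside \<open>E\<close> would have large density at arbitrarily small scales.\<close>
lemma dyadic_density:
  fixes E :: "'a::euclidean_space set"
  assumes E: "E \<in> sets lebesgue" and \<eta>: "0 < \<eta>" "\<eta> < 1"
  shows "AE x in lebesgue. x \<in> E \<longrightarrow>
    (\<exists>j>k. ennreal \<eta> * vol (dcube j x) < vol (dcube j x \<inter> E))"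
proof -
  let ?Z = "{x\<in>E. \<forall>j>k. vol (dcube j x \<inter> E) \<le> ennreal \<eta> * vol (dcube j x)}"
  have small: "\<exists>V\<in>sets lebesgue. ?Z \<subseteq> V \<and> vol V \<le> ennreal e" if e: "e > 0" for e
  proof -
    \<comment> \<open>Balances the covering constant and the factor \<open>1 / (1 - \<eta>)\<close>
      that \<open>ennreal_absorb\<close> produces.\<close>
    define e' where "e' = e * (1 - \<eta>) / cov TYPE('a)"
    have e': "0 < e'" using e \<eta> cov_pos[where 'a='a] by (simp add: e'_def)
    obtain U where U: "open U" "E \<subseteq> U" "U - E \<in> lmeasurable" "vol (U - E) < ennreal e'"
      using sets_lebesgue_outer_open[OF E e'] by blast
    \<comment> \<open>The condition \<open>dcube j y \<subseteq> U\<close> forces the part of the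
      cube outside \<open>E\<close> into the small set \<open>U - E\<close>.\<close>
    define W where "W = {(j, y). dcube j y \<subseteq> U \<and> y \<in> ?Z \<and> j > k}"
    define g where "g = (\<lambda>x::'a. ennreal (1 / (1 - \<eta>)) * indicator (U - E) x)"
    have UE [measurable]: "U - E \<in> sets lebesgue" using U by auto
    have "vol (cover W) \<le> ennreal (cov TYPE('a)) * (\<integral>\<^sup>+x. g x \<partial>lebesgue)"
    proof (rule dyadic_covering)
      show "g \<in> borel_measurable lebesgue" unfolding g_def by measurable
      fix j y assume "(j, y) \<in> W"
      hence sub: "dcube j y \<subseteq> U" and y: "vol (dcube j y \<inter> E) \<le> ennreal \<eta> * vol (dcube j y)"
        by (auto simp: W_def)
      define s where "s = side j ^ DIM('a)"
      have s: "0 < s" by (simp add: s_def)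
      have m: "vol (dcube j y) = ennreal s" by (simp add: emeasure_dcube s_def)
      have "vol (dcube j y) = vol (dcube j y \<inter> E) + vol (dcube j y \<inter> (U - E))"
      proof (subst plus_emeasure)
        have "dcube j y = dcube j y \<inter> E \<union> dcube j y \<inter> (U - E)" using sub by blast
        thus "vol (dcube j y) = vol (dcube j y \<inter> E \<union> dcube j y \<inter> (U - E))" by simp
      qed (use E in auto)
      hence "ennreal s \<le> ennreal (\<eta> * s) + vol (dcube j y \<inter> (U - E))"
        using y \<eta> s m by (metis add_right_mono ennreal_mult less_imp_le)
      hence "ennreal s \<le> ennreal (1 / (1 - \<eta>)) * vol (dcube j y \<inter> (U - E))"
        using \<eta> s by (intro ennreal_absorb) auto
      also have "\<dots> \<le> ennreal (1 / (1 - \<eta>)) * vol (dstar j y \<inter> (U - E))"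
        using dcube_subset_dstar by (intro mult_left_mono emeasure_mono) auto
      also have "\<dots> = (\<integral>\<^sup>+x. ennreal (1 / (1 - \<eta>)) * indicator (dstar j y \<inter> (U - E)) x \<partial>lebesgue)"
        by (subst nn_integral_cmult) auto
      also have "\<dots> = (\<integral>\<^sup>+x\<in>dstar j y. g x \<partial>lebesgue)"
        by (intro nn_integral_cong) (auto simp: g_def indicator_def)
      finally show "vol (dcube j y) \<le> (\<integral>\<^sup>+x\<in>dstar j y. g x \<partial>lebesgue)" using m by simp
    qed
    also have "(\<integral>\<^sup>+x. g x \<partial>lebesgue) = ennreal (1 / (1 - \<eta>)) * vol (U - E)"
      unfolding g_def by (subst nn_integral_cmult) auto
    also have "ennreal (cov TYPE('a)) * (ennreal (1 / (1 - \<eta>)) * vol (U - E))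
        \<le> ennreal (cov TYPE('a)) * (ennreal (1 / (1 - \<eta>)) * ennreal e')"
      using U(4) by (intro mult_left_mono) auto
    also have "\<dots> = ennreal e"
      using e e' \<eta> cov_pos[where 'a='a] by (simp add: ennreal_mult[symmetric] e'_def)
    finally have le: "vol (cover W) \<le> ennreal e" .
    have "?Z \<subseteq> cover W"
    proof
      fix x assume x: "x \<in> ?Z"
      hence "x \<in> U" using U by auto
      then obtain d where d: "0 < d" "ball x d \<subseteq> U" using U(1) open_contains_ball by blast
      have "(\<lambda>j. real DIM('a) * (2 * L) * (1 / 2) ^ j) \<longlonglongrightarrow> real DIM('a) * (2 * L) * 0"
        by (intro tendsto_mult tendsto_const LIMSEQ_power_zero) simp
      hence "eventually (\<lambda>j. real DIM('a) * (2 * L) * (1 / 2) ^ j < d) sequentially"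
        using d by (intro order_tendstoD) auto
      hence "eventually (\<lambda>j. real DIM('a) * side j < d) sequentially"
        by (simp add: side_def power_one_over field_simps)
      hence "eventually (\<lambda>j. real DIM('a) * side j < d \<and> k < j) sequentially"
        using eventually_gt_at_top by (rule eventually_conj)
      then obtain j where j: "real DIM('a) * side j < d" "k < j"
        using eventually_sequentially by auto
      have "dcube j x \<subseteq> ball x d"
        using dist_dcube[OF dcube_self, of _ j x] j by (force simp: dist_norm)
      hence "(j, x) \<in> W" using d j x by (auto simp: W_def)
      thus "x \<in> cover W" using dcube_self by blast
    qed
    thus ?thesis using le sets_UN_dcube by blast
  qed
  have "?Z \<in> null_sets lebesgue" by (rule null_sets_lebesgueI) (rule small)
  hence "AE x in lebesgue. x \<notin> ?Z" by (rule AE_not_in)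
  thus ?thesis by eventually_elim (auto simp: not_le)
qed

end

section \<open>Young functions and a Carleson embedding\<close>

lemma young_nonneg: "young A \<Longrightarrow> 0 \<le> s \<Longrightarrow> 0 \<le> A s"
  unfolding young_def by (metis atLeast_iff mono_onD order_refl)

section \<open>Complementary functions\<close>

lemma mono_complementary: "mono (complementary A)"
proof (rule monoI)
  fix t t' :: real assume "t \<le> t'"
  thus "complementary A t \<le> complementary A t'"
    unfolding complementary_def
    by (intro SUP_mono) (auto intro!: ennreal_leI mult_left_mono bexI)
qed

lemma young_ineq:
  assumes "young A" "0 \<le> s" "0 \<le> t"
  shows "ennreal (s * t) \<le> ennreal (A s) + complementary A t"
proof (cases "s = 0")
  case False
  have "ennreal (s * t) \<le> ennreal (A s + max 0 (s * t - A s))" by (intro ennreal_leI) auto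
  also have "\<dots> = ennreal (A s) + ennreal (s * t - A s)"
    using young_nonneg[OF assms(1,2)] by (subst ennreal_plus) (auto simp: max_def ennreal_neg)
  also have "ennreal (s * t - A s) \<le> complementary A t"
    unfolding complementary_def using False assms by (intro SUP_upper) auto
  finally show ?thesis by (simp add: add_left_mono)
qed simp

text \<open>Convexity of the complementary function along rays from the origin, where it vanishes.
  It turns finiteness into smallness near 0.\<close>

lemma complementary_scale:
  assumes "young A" "0 \<le> \<epsilon>" "\<epsilon> \<le> 1"
  shows "complementary A (\<epsilon> * t) \<le> ennreal \<epsilon> * complementary A t"
  unfolding complementary_def
proof (rule SUP_least)
  fix s :: real assume s: "s \<in> {0<..}"
  have A: "0 \<le> A s" using young_nonneg[OF assms(1)] s by simp
  have "\<epsilon> * A s \<le> A s" using A assms mult_right_mono[of \<epsilon> 1 "A s"] by simp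
  hence "ennreal (s * (\<epsilon> * t) - A s) \<le> ennreal (\<epsilon> * (s * t - A s))"
    by (intro ennreal_leI) (simp add: algebra_simps)
  also have "\<dots> = ennreal \<epsilon> * ennreal (s * t - A s)" using assms by (simp add: ennreal_mult')
  also have "\<dots> \<le> ennreal \<epsilon> * (SUP s\<in>{0<..}. ennreal (s * t - A s))"
    using s by (intro mult_left_mono SUP_upper) auto
  finally show "ennreal (s * (\<epsilon> * t) - A s) \<le> ennreal \<epsilon> * (SUP s\<in>{0<..}. ennreal (s * t - A s))" .
qed

section \<open>Integrals in the B condition\<close>

lemma mono_borel_measurable_ennreal:
  fixes D :: "real \<Rightarrow> ennreal"
  assumes "mono D"
  shows "D \<in> borel_measurable borel"
proof (rule borel_measurableI_greater)
  fix y
  have "is_interval {x. y < D x}"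
    unfolding is_interval_1 using monoD[OF assms] by (blast intro: less_le_trans)
  hence "{x. y < D x} \<in> sets borel" by (rule real_interval_borel_measurable)
  thus "{x \<in> space borel. y < D x} \<in> sets borel" by simp
qed

text \<open>The lower limit is a parameter because it will be the height at which \<open>D\<close>
  is at most 1/2, not the one that the \<open>B\<close> condition provides.\<close>

definition Bint :: "real \<Rightarrow> (real \<Rightarrow> ennreal) \<Rightarrow> real \<Rightarrow> ennreal" where
  "Bint \<rho> D \<epsilon> = (\<integral>\<^sup>+t\<in>{\<epsilon>..}. D t * ennreal (t powr (- \<rho> - 1)) \<partial>lborel)"

lemma B_cond_integrand:
  assumes "0 < t"
  shows "(x::ennreal) / ennreal (t powr \<rho>) / ennreal t = x * ennreal (t powr (- \<rho> - 1))"
proof -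
  have "x / ennreal (t powr \<rho>) / ennreal t = x * (ennreal (inverse (t powr \<rho>)) * ennreal (inverse t))"
    using assms by (simp add: divide_ennreal_def inverse_ennreal mult.assoc)
  also have "ennreal (inverse (t powr \<rho>)) * ennreal (inverse t) = ennreal (t powr (- \<rho> - 1))"
    using assms by (simp add: ennreal_mult[symmetric] powr_minus[symmetric] powr_diff divide_inverse)
  finally show ?thesis .
qed

text \<open>A monotone \<open>D\<close> that is infinite at one point is infinite on a half-line,
  where the weight is positive, so the integral would diverge.\<close>

lemma B_cond_finite:
  assumes D: "mono D" and B: "B_cond \<rho> D"
  shows "D t < \<infinity>" "\<exists>c>0. Bint \<rho> D c < \<infinity>"
proof -
  note [measurable] = mono_borel_measurable_ennreal[OF D]
  obtain c where c: "0 < c" "(\<integral>\<^sup>+t\<in>{c..}. (D t / ennreal (t powr \<rho>) / ennreal t) \<partial>lborel) < \<infinity>"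
    using B by (auto simp: B_cond_def nn_integral_completion)
  have "(\<integral>\<^sup>+t\<in>{c..}. (D t / ennreal (t powr \<rho>) / ennreal t) \<partial>lborel) = Bint \<rho> D c"
    unfolding Bint_def using c(1) by (intro nn_integral_cong) (auto simp: indicator_def B_cond_integrand)
  hence Bc: "Bint \<rho> D c < \<infinity>" using c(2) by simp
  show "\<exists>c>0. Bint \<rho> D c < \<infinity>" using Bc c(1) by blast
  show "D t < \<infinity>"
  proof (rule ccontr)
    assume "\<not> D t < \<infinity>"
    hence Dt: "D t = \<infinity>" by (simp add: not_less top_unique)
    define d where "d = max c t"
    have "(\<integral>\<^sup>+x. \<infinity> * indicator {d..d+1} x \<partial>lborel) \<le> Bint \<rho> D c"
      unfolding Bint_def
    proof (intro nn_integral_mono)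
      fix x :: real
      show "\<infinity> * indicator {d..d+1} x \<le> D x * ennreal (x powr (- \<rho> - 1)) * indicator {c..} x"
      proof (cases "x \<in> {d..d+1}")
        case True
        hence "D x = \<infinity>" "0 < x" "c \<le> x" using monoD[OF D, of t x] Dt c(1) by (auto simp: d_def top_unique)
        thus ?thesis by (simp add: ennreal_top_mult)
      qed simp
    qed
    moreover have "(\<integral>\<^sup>+x. \<infinity> * indicator {d..d+1} x \<partial>(lborel::real measure)) = \<infinity>"
      by (subst nn_integral_cmult) (auto simp: ennreal_top_mult)
    ultimately show False using Bc by simp
  qed
qed

text \<open>Lowering the limit from \<open>c\<close> to \<open>\<epsilon>\<close> adds a bounded
  integrand on a bounded interval, since \<open>D\<close> is at most \<open>D c\<close>, a finite
  value, there.\<close>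

lemma B_cond_Bint:
  assumes D: "mono D" and B: "B_cond \<rho> D" and \<epsilon>: "0 < \<epsilon>"
  shows "Bint \<rho> D \<epsilon> < \<infinity>"
proof -
  note [measurable] = mono_borel_measurable_ennreal[OF D]
  obtain c where c: "0 < c" and Bc: "Bint \<rho> D c < \<infinity>" using B_cond_finite(2)[OF D B] by blast
    \<comment> \<open>The exponent may have either sign, so the maximum over both end points is
      taken.\<close>
    define M where "M = max (\<epsilon> powr (- \<rho> - 1)) (c powr (- \<rho> - 1))"
    have M: "t powr (- \<rho> - 1) \<le> M" if t: "\<epsilon> \<le> t" "t \<le> c" for t
    proof (cases "- \<rho> - 1 \<le> 0")
      case True
      have "t powr (- \<rho> - 1) \<le> \<epsilon> powr (- \<rho> - 1)" using True t \<epsilon> by (intro powr_mono2') auto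
      thus ?thesis by (simp add: M_def)
    next
      case False
      have "t powr (- \<rho> - 1) \<le> c powr (- \<rho> - 1)" using False t \<epsilon> by (intro powr_mono2) auto
      thus ?thesis by (simp add: M_def)
    qed
    have "Bint \<rho> D \<epsilon> \<le> (\<integral>\<^sup>+t. D c * ennreal M * indicator {\<epsilon>..c} t
              + D t * ennreal (t powr (- \<rho> - 1)) * indicator {c..} t \<partial>lborel)"
      unfolding Bint_def
    proof (intro nn_integral_mono)
      fix t :: real
      show "D t * ennreal (t powr (- \<rho> - 1)) * indicator {\<epsilon>..} t
        \<le> D c * ennreal M * indicator {\<epsilon>..c} t + D t * ennreal (t powr (- \<rho> - 1)) * indicator {c..} t"
      proof (cases "\<epsilon> \<le> t \<and> t \<le> c")
        case True
        have "D t * ennreal (t powr (- \<rho> - 1)) \<le> D c * ennreal M"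
          using M True monoD[OF D] by (intro mult_mono ennreal_leI) auto
        thus ?thesis using True by (simp add: add_increasing2)
      qed (auto simp: indicator_def)
    qed
    also have "\<dots> = (\<integral>\<^sup>+t. D c * ennreal M * indicator {\<epsilon>..c} t \<partial>lborel) + Bint \<rho> D c"
      unfolding Bint_def by (subst nn_integral_add) auto
    also have "\<dots> < \<infinity>"
      using B_cond_finite(1)[OF D B, of c] Bc
      by (subst nn_integral_cmult) (auto simp: ennreal_mult_less_top ennreal_add_less_top emeasure_lborel_Icc_eq less_top)
    finally show ?thesis .
qed

text \<open>The value at 1 is scaled down by \<open>complementary_scale\<close>. The bound 1/2
  leaves the other half of the Luxemburg condition to the large values in
  \<open>carleson\<close>.\<close>

lemma complementary_small:
  assumes "young A" "\<And>t. complementary A t < \<infinity>"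
  obtains \<epsilon> where "0 < \<epsilon>" "complementary A \<epsilon> \<le> ennreal (1 / 2)"
proof -
  obtain d where d: "0 \<le> d" "complementary A 1 = ennreal d"
    using assms(2)[of 1] by (metis ennreal_cases less_irrefl infinity_ennreal_def)
  define \<epsilon> where "\<epsilon> = 1 / (2 * (d + 1))"
  have e: "0 < \<epsilon>" "\<epsilon> \<le> 1" "\<epsilon> * d \<le> 1 / 2" using d by (auto simp: \<epsilon>_def field_simps)
  have "complementary A (\<epsilon> * 1) \<le> ennreal \<epsilon> * complementary A 1"
    using e assms by (intro complementary_scale) auto
  also have "\<dots> \<le> ennreal (1 / 2)" using e d by (metis ennreal_leI ennreal_mult less_imp_le)
  finally show ?thesis using that e by simp
qed

text \<open>On \<open>{s..<2 * s}\<close> a monotone \<open>D\<close> is at least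
  \<open>D s\<close>, and the power weight is comparable to its value at \<open>s\<close>; so the
  term at \<open>s = a / 2 ^ k\<close> is controlled by a piece of the integral. The pieces are
  disjoint, and \<open>\<epsilon> < s\<close> keeps them in the range of
  \<open>Bint\<close>.\<close>

lemma geometric_sum_le_Bint:
  fixes D :: "real \<Rightarrow> ennreal"
  assumes D: "mono D" and \<epsilon>: "0 < \<epsilon>" and a: "0 < a"
  shows "(\<Sum>k. if \<epsilon> < a / 2 ^ k then ennreal ((2 ^ k) powr \<rho>) * D (a / 2 ^ k) else 0)
     \<le> ennreal (2 powr (\<bar>\<rho> + 1\<bar>) * a powr \<rho>) * Bint \<rho> D \<epsilon>"
proof -
  note [measurable] = mono_borel_measurable_ennreal[OF D]
  define s where "s k = a / 2 ^ k" for k :: nat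
  have s: "0 < s k" for k using a by (simp add: s_def)
  define c where "c = ennreal (2 powr (\<bar>\<rho> + 1\<bar>) * a powr \<rho>)"
  let ?w = "\<lambda>t. D t * ennreal (t powr (- \<rho> - 1))"
  have "(\<Sum>k. if \<epsilon> < s k then ennreal ((2 ^ k) powr \<rho>) * D (s k) else 0)
    \<le> (\<Sum>k. c * (\<integral>\<^sup>+t. (if \<epsilon> < s k then ?w t else 0) * indicator {s k..<2 * s k} t \<partial>lborel))"
  proof (intro suminf_le summableI)
    fix k
    show "(if \<epsilon> < s k then ennreal ((2 ^ k) powr \<rho>) * D (s k) else 0)
      \<le> c * (\<integral>\<^sup>+t. (if \<epsilon> < s k then ?w t else 0) * indicator {s k..<2 * s k} t \<partial>lborel)"
    proof (cases "\<epsilon> < s k")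
      case True
      \<comment> \<open>A lower bound for the power weight on \<open>{s k..<2 * s k}\<close>, valid
        for either sign of the exponent.\<close>
      define m where "m = s k powr (- \<rho> - 1) / 2 powr \<bar>\<rho> + 1\<bar>"
      have m: "m \<le> t powr (- \<rho> - 1)" if t: "s k \<le> t" "t < 2 * s k" for t
      proof (cases "- \<rho> - 1 \<le> 0")
        case neg: True
        have "(2 * s k) powr (- \<rho> - 1) \<le> t powr (- \<rho> - 1)"
          using neg t s[of k] by (intro powr_mono2') auto
        moreover have "(2 * s k) powr (- \<rho> - 1) = m"
          using neg s[of k] by (simp add: m_def powr_mult abs_if powr_minus_divide[symmetric] powr_minus divide_inverse flip: powr_minus)
        ultimately show ?thesis by simp
      next
        case pos: False
        have "m \<le> s k powr (- \<rho> - 1)"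
          unfolding m_def using ge_one_powr_ge_zero[of 2 "\<bar>\<rho> + 1\<bar>"]
            mult_left_mono[of 1 "2 powr \<bar>\<rho> + 1\<bar>" "s k powr (- \<rho> - 1)"]
          by (simp add: divide_le_eq)
        also have "\<dots> \<le> t powr (- \<rho> - 1)" using pos t s[of k] by (intro powr_mono2) auto
        finally show ?thesis .
      qed
      have m0: "0 \<le> m" by (simp add: m_def)
      have "(2 ^ k) powr \<rho> = 2 powr (\<bar>\<rho> + 1\<bar>) * a powr \<rho> * (m * s k)"
      proof -
        have "m * s k = s k powr (- \<rho>) / 2 powr \<bar>\<rho> + 1\<bar>"
          using s[of k] powr_add[of "s k" "- \<rho> - 1" 1] by (simp add: m_def)
        moreover have "a powr \<rho> * s k powr (- \<rho>) = (2 ^ k) powr \<rho>"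
          using a by (simp add: s_def powr_minus powr_divide field_simps)
        ultimately show ?thesis by simp
      qed
      hence "ennreal ((2 ^ k) powr \<rho>) * D (s k) = c * (D (s k) * ennreal m * ennreal (s k))"
        using m0 s[of k] by (simp add: c_def ennreal_mult mult_ac)
      also have "D (s k) * ennreal m * ennreal (s k) = (\<integral>\<^sup>+t. D (s k) * ennreal m * indicator {s k..<2 * s k} t \<partial>lborel)"
        using s[of k] by (subst nn_integral_cmult_indicator) auto
      also have "\<dots> \<le> (\<integral>\<^sup>+t. ?w t * indicator {s k..<2 * s k} t \<partial>lborel)"
      proof (intro nn_integral_mono)
        fix t
        show "D (s k) * ennreal m * indicator {s k..<2 * s k} t \<le> ?w t * indicator {s k..<2 * s k} t"
          using m monoD[OF D] by (cases "t \<in> {s k..<2 * s k}") (auto intro!: mult_mono ennreal_leI)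
      qed
      finally show ?thesis using True by (simp add: mult_left_mono)
    qed simp
  qed
  also have "\<dots> = c * (\<integral>\<^sup>+t. (\<Sum>k. (if \<epsilon> < s k then ?w t else 0) * indicator {s k..<2 * s k} t) \<partial>lborel)"
    by (subst nn_integral_suminf) simp_all
  also have "\<dots> \<le> c * Bint \<rho> D \<epsilon>"
    unfolding Bint_def
  proof (intro mult_left_mono nn_integral_mono)
    fix t :: real
    show "(\<Sum>k. (if \<epsilon> < s k then ?w t else 0) * indicator {s k..<2 * s k} t) \<le> ?w t * indicator {\<epsilon>..} t"
    proof (cases "\<exists>k. t \<in> {s k..<2 * s k} \<and> \<epsilon> < s k")
      case True
      then obtain k where k: "t \<in> {s k..<2 * s k}" "\<epsilon> < s k" by blast
      have uniq: "t \<notin> {s j..<2 * s j}" if "j \<noteq> k" for j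
      proof -
        have lt: "2 * s j' \<le> s i" if "i < j'" for i j'
        proof -
          have "(2::real) ^ Suc i \<le> 2 ^ j'" using that by (intro power_increasing) auto
          thus ?thesis using a by (simp add: s_def field_simps)
        qed
        show ?thesis using lt[of j k] lt[of k j] that k(1) by (cases j k rule: linorder_cases) auto
      qed
      have "(\<Sum>j. (if \<epsilon> < s j then ?w t else 0) * indicator {s j..<2 * s j} t)
          = (\<Sum>j\<in>{k}. (if \<epsilon> < s j then ?w t else 0) * indicator {s j..<2 * s j} t)"
        by (rule suminf_finite) (use uniq in \<open>auto simp: indicator_def\<close>)
      also have "\<dots> \<le> ?w t * indicator {\<epsilon>..} t" using k by (auto simp: indicator_def)
      finally show ?thesis .
    next
      case False
      hence "(\<lambda>k. (if \<epsilon> < s k then ?w t else 0) * indicator {s k..<2 * s k} t) = (\<lambda>_. 0)"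
        by (auto simp: fun_eq_iff indicator_def)
      thus ?thesis by simp
    qed
  qed simp
  finally show ?thesis unfolding s_def c_def .
qed

section \<open>The Carleson embedding\<close>

context grid
begin

text \<open>Each \<open>m q\<close> stands in for a Luxemburg norm of \<open>h\<close> over the
  dilate, rounded up to a height \<open>2 ^ k * \<tau>\<close>; the lowest height
  \<open>\<tau>\<close> ensures that a least admissible level exists. As in deducing a strong
  maximal inequality from the weak one, the levels are summed after applying
  \<open>dyadic_covering\<close> to each. The volume of \<open>base\<close> enters only through
  cubes that stop at the lowest height.\<close>

lemma carleson:
  fixes h :: "'a::euclidean_space \<Rightarrow> real" and D :: "real \<Rightarrow> ennreal"
    and S :: "(nat \<times> 'a) set" and E :: "nat \<times> 'a \<Rightarrow> 'a set"
  assumes D: "mono D" and \<epsilon>: "0 < \<epsilon>" "D \<epsilon> \<le> ennreal (1 / 2)" and J: "Bint \<rho> D \<epsilon> < \<infinity>"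
    and h [measurable]: "h \<in> borel_measurable lebesgue" and h0: "\<And>x. 0 \<le> h x"
    and H: "(\<integral>\<^sup>+x. ennreal (h x powr \<rho>) \<partial>lebesgue) < \<infinity>"
    and S: "finite S" and E [measurable]: "\<And>q. q \<in> S \<Longrightarrow> E q \<in> sets lebesgue"
    and Esub: "\<And>q. q \<in> S \<Longrightarrow> E q \<subseteq> Q1 q" "\<And>q. q \<in> S \<Longrightarrow> E q \<subseteq> base"
    and dj: "disjoint_family_on E S" and \<tau>: "0 < \<tau>" and \<rho>: "0 < \<rho>"
  obtains m where "\<And>q. q \<in> S \<Longrightarrow> 0 < m q"
    "\<And>q. q \<in> S \<Longrightarrow> (\<integral>\<^sup>+x\<in>Q2 q. D (h x / m q) \<partial>lebesgue)
        \<le> vol (Q2 q)"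
    "(\<Sum>q\<in>S. ennreal (m q powr \<rho>) * vol (E q))
      \<le> ennreal (\<tau> powr \<rho>) * vol (base :: 'a set)
        + ennreal (2 powr \<rho> * (cov TYPE('a) * 2) * 2 powr \<bar>\<rho> + 1\<bar>) * Bint \<rho> D \<epsilon>
            * (\<integral>\<^sup>+x. ennreal (h x powr \<rho>) \<partial>lebesgue)"
proof -
  have Dm: "D \<in> borel_measurable borel" by (rule mono_borel_measurable_ennreal[OF D])
  define t where "t k = 2 ^ k * \<tau>" for k :: nat
  have t: "0 < t k" for k using \<tau> by (simp add: t_def)
  \<comment> \<open>Only values above \<open>\<epsilon> * t k\<close> are kept: the others
    contribute at most 1/2 to the Luxemburg condition, and without them the sum over
    \<open>k\<close> is controlled by \<open>Bint\<close>.\<close>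
  define G where "G k x = (if \<epsilon> * t k < h x then D (h x / t k) else 0)" for k x
  have Dh [measurable]: "(\<lambda>x. D (h x / c)) \<in> borel_measurable lebesgue" for c
    by (rule measurable_compose[OF _ Dm]) simp
  have Gm [measurable]: "G k \<in> borel_measurable lebesgue" for k
    unfolding G_def by measurable
  define H where "H = (\<integral>\<^sup>+x. ennreal (h x powr \<rho>) \<partial>lebesgue)"
  define \<Theta> where "\<Theta> k = (\<integral>\<^sup>+x. G k x \<partial>lebesgue)" for k
  define K where "K = ennreal (2 powr \<bar>\<rho> + 1\<bar>) * Bint \<rho> D \<epsilon>"
  \<comment> \<open>For fixed \<open>x\<close> the numbers \<open>h x / t k\<close> form a geometric
    progression, which \<open>geometric_sum_le_Bint\<close> sums.\<close>
  have pt: "(\<Sum>k. ennreal (t k powr \<rho>) * G k x) \<le> K * ennreal (h x powr \<rho>)" for x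
  proof (cases "h x = 0")
    case True
    hence "\<not> \<epsilon> * t k < h x" for k using t[of k] \<epsilon> by (simp add: not_less)
    hence "G k x = 0" for k by (simp add: G_def)
    thus ?thesis by simp
  next
    case False
    hence hx: "0 < h x" using h0[of x] by simp
    let ?a = "h x / \<tau>"
    have e: "h x / t k = ?a / 2 ^ k" "(\<epsilon> * t k < h x) = (\<epsilon> < ?a / 2 ^ k)" for k
      using t[of k] \<tau> by (auto simp: t_def field_simps)
    have "ennreal (t k powr \<rho>) * G k x = ennreal (\<tau> powr \<rho>) *
        (if \<epsilon> < ?a / 2 ^ k then ennreal ((2 ^ k) powr \<rho>) * D (?a / 2 ^ k) else 0)" for k
      unfolding G_def e using \<tau> by (simp add: t_def powr_mult ennreal_mult mult_ac)
    hence "(\<Sum>k. ennreal (t k powr \<rho>) * G k x) = ennreal (\<tau> powr \<rho>) *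
        (\<Sum>k. if \<epsilon> < ?a / 2 ^ k then ennreal ((2 ^ k) powr \<rho>) * D (?a / 2 ^ k) else 0)"
      by simp
    also have "\<dots> \<le> ennreal (\<tau> powr \<rho>) * (ennreal (2 powr \<bar>\<rho> + 1\<bar> * ?a powr \<rho>) * Bint \<rho> D \<epsilon>)"
      using hx \<tau> by (intro mult_left_mono geometric_sum_le_Bint D \<epsilon>) auto
    also have "\<dots> = ennreal (\<tau> powr \<rho> * (2 powr \<bar>\<rho> + 1\<bar> * ?a powr \<rho>)) * Bint \<rho> D \<epsilon>"
      by (simp add: ennreal_mult mult.assoc)
    also have "\<tau> powr \<rho> * (2 powr \<bar>\<rho> + 1\<bar> * ?a powr \<rho>) = 2 powr \<bar>\<rho> + 1\<bar> * h x powr \<rho>"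
      using hx \<tau> by (simp add: powr_divide)
    finally show ?thesis by (simp add: K_def ennreal_mult mult_ac)
  qed
  have sum\<Theta>: "(\<Sum>k. ennreal (t k powr \<rho>) * \<Theta> k) \<le> K * H"
  proof -
    have "(\<Sum>k. ennreal (t k powr \<rho>) * \<Theta> k) = (\<integral>\<^sup>+x. (\<Sum>k. ennreal (t k powr \<rho>) * G k x) \<partial>lebesgue)"
      unfolding \<Theta>_def by (subst nn_integral_suminf) (auto simp: nn_integral_cmult)
    also have "\<dots> \<le> (\<integral>\<^sup>+x. K * ennreal (h x powr \<rho>) \<partial>lebesgue)"
      by (intro nn_integral_mono pt)
    also have "\<dots> = K * H" unfolding H_def by (subst nn_integral_cmult) auto
    finally show ?thesis .
  qed
  have KH: "K * H < \<infinity>" using J assms(7) by (simp add: K_def H_def ennreal_mult_less_top)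
  define P where "P q k \<longleftrightarrow> (\<integral>\<^sup>+x\<in>Q2 q. G k x \<partial>lebesgue)
      \<le> ennreal (1 / 2) * vol (Q2 q)" for q :: "nat \<times> 'a" and k
  \<comment> \<open>If every level failed, all \<open>\<Theta> k\<close> would be at least a fixed
    positive number, against the convergence of the series in \<open>sum\<Theta>\<close>.\<close>
  have ex: "\<exists>k. P q k" for q
  proof (rule ccontr)
    assume "\<nexists>k. P q k"
    define b where "b = ennreal (1 / 2) * vol (Q2 q)"
    have b0: "b \<noteq> 0" "b \<noteq> \<infinity>"
      using kap_ge[where 'a='a] side_pos[of "fst q"] by (auto simp: b_def emeasure_dstar ennreal_mult_eq_top_iff)
    have "b \<le> \<Theta> k" for k
    proof -
      have "b \<le> (\<integral>\<^sup>+x\<in>Q2 q. G k x \<partial>lebesgue)"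
        using \<open>\<nexists>k. P q k\<close> by (simp add: P_def b_def not_le less_imp_le)
      also have "\<dots> \<le> \<Theta> k" unfolding \<Theta>_def by (intro nn_integral_mono) (auto simp: indicator_def)
      finally show ?thesis .
    qed
    moreover have "\<tau> powr \<rho> \<le> t k powr \<rho>" for k
      using \<tau> \<rho> by (intro powr_mono2) (auto simp: t_def)
    ultimately have "(\<Sum>k::nat. ennreal (\<tau> powr \<rho>) * b) \<le> (\<Sum>k. ennreal (t k powr \<rho>) * \<Theta> k)"
      by (intro suminf_le mult_mono ennreal_leI summableI) auto
    also have "\<dots> < \<infinity>" using sum\<Theta> KH by (rule le_less_trans)
    finally have fin: "(\<Sum>k::nat. ennreal (\<tau> powr \<rho>) * b) < \<infinity>" .
    obtain c where c: "0 \<le> c" "b = ennreal c" using b0 by (metis ennreal_cases infinity_ennreal_def)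
    have "(\<Sum>k::nat. ennreal (\<tau> powr \<rho> * c)) \<noteq> top" using fin c by (simp add: ennreal_mult)
    hence "summable (\<lambda>k::nat. \<tau> powr \<rho> * c)" using c by (intro summable_suminf_not_top) auto
    thus False using b0 \<tau> c by (simp add: summable_const_iff)
  qed
  define k where "k q = (LEAST k. P q k)" for q
  have Pk: "P q (k q)" for q unfolding k_def using ex by (rule LeastI_ex)
  have nPk: "\<not> P q j" if "k q = Suc j" for q j
    using that not_less_Least[of j "P q"] by (simp add: k_def)
  define m where "m q = t (k q)" for q
  \<comment> \<open>Values up to \<open>\<epsilon> * m q\<close> contribute at most one half by the
    choice of \<open>\<epsilon>\<close>, larger ones at most one half by the choice of the
    level.\<close>
  have star: "(\<integral>\<^sup>+x\<in>Q2 q. D (h x / m q) \<partial>lebesgue)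
        \<le> vol (Q2 q)" for q
  proof -
    have "(\<integral>\<^sup>+x\<in>Q2 q. D (h x / m q) \<partial>lebesgue)
      \<le> (\<integral>\<^sup>+x. G (k q) x * indicator (Q2 q) x
            + ennreal (1 / 2) * indicator (Q2 q) x \<partial>lebesgue)"
    proof (intro nn_integral_mono)
      fix x
      have "D (h x / m q) \<le> ennreal (1 / 2)" if "h x \<le> \<epsilon> * t (k q)"
        using that t[of "k q"] \<epsilon> monoD[OF D, of "h x / m q" \<epsilon>] by (auto simp: m_def divide_le_eq)
      thus "D (h x / m q) * indicator (Q2 q) x
        \<le> G (k q) x * indicator (Q2 q) x
            + ennreal (1 / 2) * indicator (Q2 q) x"
        by (auto simp: indicator_def G_def m_def not_less)
    qed
    also have "\<dots> = (\<integral>\<^sup>+x\<in>Q2 q. G (k q) x \<partial>lebesgue)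
        + ennreal (1 / 2) * vol (Q2 q)"
      by (subst nn_integral_add) (auto simp: nn_integral_cmult)
    also have "\<dots> \<le> ennreal (1 / 2) * vol (Q2 q)
        + ennreal (1 / 2) * vol (Q2 q)"
      using Pk[of q] unfolding P_def by (rule add_right_mono)
    also have "\<dots> = (ennreal (1 / 2) + ennreal (1 / 2)) * vol (Q2 q)"
      by (simp add: distrib_right)
    also have "ennreal (1 / 2) + ennreal (1 / 2) = 1" by (subst ennreal_plus[symmetric]) auto
    finally show ?thesis by simp
  qed
  define Sj where "Sj j = {q\<in>S. k q = Suc j}" for j
  \<comment> \<open>A cube that stops at level \<open>Suc j\<close> failed the test at level
    \<open>j\<close>, so \<open>2 * G j\<close> integrates over its dilate to at least the volume of
    the cube. Disjointness of the sets \<open>E q\<close> turns the measure of the union into a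
    sum.\<close>
  have lev: "(\<Sum>q\<in>Sj j. vol (E q)) \<le> ennreal (cov TYPE('a) * 2) * \<Theta> j" for j
  proof -
    have fin: "finite (Sj j)" using S by (simp add: Sj_def)
    have "(\<Sum>q\<in>Sj j. vol (E q)) = vol (\<Union>q\<in>Sj j. E q)"
      using fin dj by (intro sum_emeasure) (auto simp: Sj_def intro: disjoint_family_on_mono)
    also have "\<dots> \<le> vol (cover (Sj j))"
      using Esub(1) by (intro emeasure_mono sets_UN_dcube) (force simp: Sj_def)
    also have "\<dots> \<le> ennreal (cov TYPE('a)) * (\<integral>\<^sup>+x. 2 * G j x \<partial>lebesgue)"
    proof (rule dyadic_covering)
      show "(\<lambda>x. 2 * G j x) \<in> borel_measurable lebesgue" by measurable
      fix i y assume "(i, y) \<in> Sj j"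
      hence "\<not> P (i, y) j" using nPk by (simp add: Sj_def)
      hence less: "ennreal (1 / 2) * vol (dstar i y) \<le> (\<integral>\<^sup>+x\<in>dstar i y. G j x \<partial>lebesgue)"
        by (simp add: P_def not_le less_imp_le)
      have "vol (dcube i y) \<le> vol (dstar i y)"
        using dcube_subset_dstar by (intro emeasure_mono) auto
      also have "\<dots> = 2 * (ennreal (1 / 2) * vol (dstar i y))"
      proof -
        have "ennreal 2 * ennreal (1 / 2) = 1" by (subst ennreal_mult[symmetric]) auto
        hence "2 * ennreal (1 / 2) = 1" by (simp only: ennreal_numeral)
        thus ?thesis by (simp only: mult.assoc[symmetric]) simp
      qed
      also have "\<dots> \<le> 2 * (\<integral>\<^sup>+x\<in>dstar i y. G j x \<partial>lebesgue)"
        using less by (intro mult_left_mono) auto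
      also have "\<dots> = (\<integral>\<^sup>+x\<in>dstar i y. 2 * G j x \<partial>lebesgue)"
        by (simp add: nn_integral_cmult mult.assoc)
      finally show "vol (dcube i y) \<le> (\<integral>\<^sup>+x\<in>dstar i y. 2 * G j x \<partial>lebesgue)" .
    qed
    also have "(\<integral>\<^sup>+x. 2 * G j x \<partial>lebesgue) = 2 * \<Theta> j" unfolding \<Theta>_def by (simp add: nn_integral_cmult)
    also have "ennreal (cov TYPE('a)) * (2 * \<Theta> j) = ennreal (cov TYPE('a) * 2) * \<Theta> j"
      using cov_pos[where 'a='a] by (simp add: ennreal_mult mult.assoc)
    finally show ?thesis .
  qed
  \<comment> \<open>Since \<open>t (Suc j) = 2 * t j\<close>, a cube of level \<open>Suc j\<close>
    is charged to the failed height \<open>t j\<close> at the cost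
    \<open>2 powr \<rho>\<close>.\<close>
  define W where "W q j = (if k q = Suc j then ennreal (2 powr \<rho> * t j powr \<rho>) * vol (E q) else 0)" for q j
  have "(\<Sum>q\<in>S. ennreal (m q powr \<rho>) * vol (E q))
    \<le> (\<Sum>q\<in>S. ennreal (\<tau> powr \<rho>) * vol (E q)
        + (\<Sum>j. W q j))"
  proof (intro sum_mono)
    fix q
    show "ennreal (m q powr \<rho>) * vol (E q) \<le> ennreal (\<tau> powr \<rho>) * vol (E q)
        + (\<Sum>j. W q j)"
    proof (cases "k q")
      case 0
      thus ?thesis by (simp add: m_def t_def)
    next
      case (Suc i)
      have "(\<Sum>j. W q j)
        = (\<Sum>j\<in>{i}. W q j)"
        using Suc by (intro suminf_finite) (auto simp: W_def)
      also have "\<dots> = ennreal (m q powr \<rho>) * vol (E q)"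
        using Suc \<tau> by (simp add: W_def m_def t_def powr_mult mult_ac)
      finally show ?thesis by (simp add: add_increasing)
    qed
  qed
  also have "\<dots> = ennreal (\<tau> powr \<rho>) * (\<Sum>q\<in>S. vol (E q))
      + (\<Sum>j. \<Sum>q\<in>S. W q j)"
    by (simp add: sum.distrib sum_distrib_left suminf_sum)
  also have "(\<lambda>j. \<Sum>q\<in>S. W q j)
      = (\<lambda>j. ennreal (2 powr \<rho> * t j powr \<rho>) * (\<Sum>q\<in>Sj j. vol (E q)))"
    using S by (simp add: W_def fun_eq_iff Sj_def sum.inter_filter[symmetric] sum_distrib_left)
  also have "(\<Sum>q\<in>S. vol (E q)) \<le> vol (base :: 'a set)"
  proof -
    have "(\<Sum>q\<in>S. vol (E q)) = vol (\<Union>q\<in>S. E q)"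
      using S dj by (intro sum_emeasure) auto
    also have "\<dots> \<le> vol (base :: 'a set)"
      using Esub(2) by (intro emeasure_mono) (auto simp: base_def)
    finally show ?thesis .
  qed
  also have "(\<Sum>j. ennreal (2 powr \<rho> * t j powr \<rho>) * (\<Sum>q\<in>Sj j. vol (E q)))
      \<le> (\<Sum>j. ennreal (2 powr \<rho> * t j powr \<rho>) * (ennreal (cov TYPE('a) * 2) * \<Theta> j))"
    by (intro suminf_le mult_left_mono lev summableI) auto
  also have "\<dots> = ennreal (2 powr \<rho> * (cov TYPE('a) * 2)) * (\<Sum>j. ennreal (t j powr \<rho>) * \<Theta> j)"
    using cov_pos[where 'a='a] by (simp add: ennreal_mult mult_ac flip: ennreal_suminf_cmult)
  also have "\<dots> \<le> ennreal (2 powr \<rho> * (cov TYPE('a) * 2)) * (K * H)"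
    by (intro mult_left_mono sum\<Theta>) auto
  also have "\<dots> = ennreal (2 powr \<rho> * (cov TYPE('a) * 2) * 2 powr \<bar>\<rho> + 1\<bar>) * Bint \<rho> D \<epsilon> * H"
    using cov_pos[where 'a='a] by (simp add: K_def ennreal_mult mult_ac)
  finally have main: "(\<Sum>q\<in>S. ennreal (m q powr \<rho>) * vol (E q))
    \<le> ennreal (\<tau> powr \<rho>) * vol (base :: 'a set)
      + ennreal (2 powr \<rho> * (cov TYPE('a) * 2) * 2 powr \<bar>\<rho> + 1\<bar>) * Bint \<rho> D \<epsilon> * H"
    by (simp add: add_left_mono add_right_mono mult_left_mono)
  show ?thesis
    by (rule that[of m]) (use main star t in \<open>auto simp: m_def H_def\<close>)
qed

end

section \<open>Maximally modulated operators\<close>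

definition cutoff :: "'a set \<Rightarrow> ('a \<Rightarrow> complex) \<Rightarrow> 'a \<Rightarrow> complex" where
  "cutoff X f x = indicator X x * f x"

lemma cutoff_UNIV [simp]: "cutoff UNIV f = f" by (simp add: cutoff_def fun_eq_iff)

text \<open>Collects what sparse domination uses, so that neither linearity nor the kernel appears
  later. In \<open>exhaust\<close> the factor 2 takes the place of convergence of the truncations,
  which would need separate treatment of infinite values.\<close>

locale regular_op =
  fixes S :: "('a::euclidean_space \<Rightarrow> complex) \<Rightarrow> 'a \<Rightarrow> ennreal"
    and \<D> :: "('a \<Rightarrow> complex) set" and r \<delta> cK cw :: real
  assumes r: "1 < r" and \<delta>: "0 < \<delta>" and cK: "0 \<le> cK" and cw: "0 \<le> cw"
    and dom_meas: "\<And>f. f \<in> \<D> \<Longrightarrow> f \<in> borel_measurable lebesgue"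
    and cutoff_dom: "\<And>f X. f \<in> \<D> \<Longrightarrow> X \<in> sets lebesgue \<Longrightarrow> cutoff X f \<in> \<D>"
    and op_meas: "\<And>f. f \<in> \<D> \<Longrightarrow> power_integral r f < \<infinity> \<Longrightarrow>
      S f \<in> borel_measurable lebesgue"
    and weak: "\<And>f t. f \<in> \<D> \<Longrightarrow> power_integral r f < \<infinity> \<Longrightarrow> 0 < t \<Longrightarrow>
      vol {x. S f x > ennreal t}
        \<le> ennreal (cw / t powr r) * power_integral r f"
    and tri: "\<And>f X Y x. f \<in> \<D> \<Longrightarrow> X \<in> sets lebesgue \<Longrightarrow> Y \<in> sets lebesgue \<Longrightarrow> Y \<subseteq> X \<Longrightarrow>
      S (cutoff X f) x \<le> S (cutoff Y f) x + S (cutoff (X - Y) f) x"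
    and tri': "\<And>f X Y x. f \<in> \<D> \<Longrightarrow> X \<in> sets lebesgue \<Longrightarrow> Y \<in> sets lebesgue \<Longrightarrow> Y \<subseteq> X \<Longrightarrow>
      S (cutoff (X - Y) f) x \<le> S (cutoff X f) x + S (cutoff Y f) x"
    and reg: "\<And>f X R x x'. f \<in> \<D> \<Longrightarrow> X \<in> sets lebesgue \<Longrightarrow> 0 < R \<Longrightarrow> 2 * norm (x - x') < R \<Longrightarrow>
      (\<And>y. y \<in> X \<Longrightarrow> R \<le> norm (x - y)) \<Longrightarrow> (\<And>y. y \<in> X \<Longrightarrow> R \<le> norm (x' - y)) \<Longrightarrow>
      S (cutoff X f) x \<le> S (cutoff X f) x' + (\<integral>\<^sup>+y\<in>X. ennreal (cK * norm (x - x') powr \<delta>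
         / norm (x - y) powr (real DIM('a) + \<delta>) * norm (f y)) \<partial>lebesgue)"
    and exhaust: "\<And>f X R x. f \<in> \<D> \<Longrightarrow> (\<And>N::nat. X N \<in> sets lebesgue) \<Longrightarrow> incseq X \<Longrightarrow>
      (\<Union>N. X N) = UNIV \<Longrightarrow> 0 < R \<Longrightarrow> ball x R \<subseteq> X 0 \<Longrightarrow>
      eventually (\<lambda>N. S f x \<le> 2 * S (cutoff (X N) f) x) sequentially"

lemma ennreal_norm_le_add:
  fixes a b :: "'b::real_normed_vector"
  shows "ennreal (norm a) \<le> ennreal (norm b) + ennreal (norm (a - b))"
  by (simp add: norm_triangle_sub flip: ennreal_plus)

lemma epowr_root_le:
  assumes r: "0 < r" and t: "0 < t" and C: "0 \<le> C" and F: "F < \<infinity>"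
    and le: "ennreal t * epowr x (1 / r) \<le> ennreal C * epowr F (1 / r)"
  shows "x \<le> ennreal (C powr r / t powr r) * F"
proof -
  obtain G where G: "F = ennreal G" "0 \<le> G" using F by (metis ennreal_cases infinity_ennreal_def less_irrefl)
  have eF: "epowr F (1 / r) = ennreal (G powr (1 / r))" using G by (simp add: epowr_def)
  have "x \<noteq> \<infinity>"
  proof
    assume "x = \<infinity>"
    hence "ennreal t * epowr x (1 / r) = \<infinity>" using t by (simp add: epowr_def ennreal_mult_top)
    thus False using le eF by (simp add: top_unique ennreal_mult[symmetric] C)
  qed
  then obtain y where y: "x = ennreal y" "0 \<le> y" by (metis ennreal_cases infinity_ennreal_def)
  have "ennreal (t * y powr (1 / r)) \<le> ennreal (C * G powr (1 / r))"
    using le eF y t C by (simp add: epowr_def ennreal_mult)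
  hence "t * y powr (1 / r) \<le> C * G powr (1 / r)" using C by simp
  hence "(t * y powr (1 / r)) powr r \<le> (C * G powr (1 / r)) powr r"
    using t r by (intro powr_mono2) auto
  hence "t powr r * y \<le> C powr r * G"
    using t r C y G by (simp add: powr_mult powr_powr)
  hence "y \<le> C powr r / t powr r * G" using t by (simp add: field_simps)
  thus ?thesis using y G by (simp add: ennreal_mult[symmetric] ennreal_leI)
qed

text \<open>The modulating factors have modulus one, so the kernel estimates and the tails of the
  kernel integrals are the same for all indices and survive the supremum.\<close>

lemma max_modulated_regular:
  fixes T :: "('a::euclidean_space \<Rightarrow> complex) \<Rightarrow> 'a \<Rightarrow> complex"
  assumes cz: "calderon_zygmund \<D> T"
    and \<phi>: "\<And>\<alpha>. \<alpha> \<in> I \<Longrightarrow> \<phi> \<alpha> \<in> borel_measurable lebesgue"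
    and wk: "weak_type_upto \<D> (max_modulated I \<phi> T) r\<^sub>0 \<psi>"
    and r: "1 < r" "r \<le> r\<^sub>0"
  shows "\<exists>\<delta> cK cw. regular_op (max_modulated I \<phi> T) \<D> r \<delta> cK cw"
proof -
  let ?S = "max_modulated I \<phi> T"
  define e where "e \<alpha> y = exp (2 * of_real pi * \<i> * of_real (\<phi> \<alpha> y))" for \<alpha> and y :: 'a
  have S_eq: "?S f x = (SUP \<alpha>\<in>I. ennreal (norm (T (\<lambda>y. e \<alpha> y * f y) x)))" for f x
    by (simp add: max_modulated_def e_def)
  have ne: "norm (e \<alpha> y) = 1" for \<alpha> y
    by (simp add: e_def norm_exp_eq_Re)
  have em: "e \<alpha> \<in> borel_measurable lebesgue" if "\<alpha> \<in> I" for \<alpha>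
    unfolding e_def using \<phi>[OF that] by measurable
  have eb: "bounded (range (e \<alpha>))" for \<alpha>
    by (rule boundedI[of _ 1]) (auto simp: ne)
  have dom: "cz_domain \<D>"
    and add: "\<And>f g x. f \<in> \<D> \<Longrightarrow> g \<in> \<D> \<Longrightarrow> T (\<lambda>y. f y + g y) x = T f x + T g x"
    using cz by (auto simp: calderon_zygmund_def)
  obtain K where K: "cz_kernel K"
    and rep: "\<And>f x. f \<in> \<D> \<Longrightarrow> x \<notin> closure {y. f y \<noteq> 0} \<Longrightarrow>
         integrable lebesgue (\<lambda>y. K x y * f y) \<and> T f x = (LINT y|lebesgue. K x y * f y)"
    using cz unfolding calderon_zygmund_def by blast
  obtain c \<delta> where \<delta>: "0 < \<delta>" and c: "\<And>x x' y. norm (x - x') < norm (x - y) / 2 \<Longrightarrow>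
         norm (K x y - K x' y) + norm (K y x - K y x')
           \<le> c * norm (x - x') powr \<delta> / norm (x - y) powr (real DIM('a) + \<delta>)"
    using K unfolding cz_kernel_def by blast
  define cK where "cK = max c 0"
  have kb: "norm (K x y - K x' y) \<le> cK * norm (x - x') powr \<delta> / norm (x - y) powr (real DIM('a) + \<delta>)"
    if "norm (x - x') < norm (x - y) / 2" for x x' y
  proof -
    have "norm (K x y - K x' y) \<le> norm (K x y - K x' y) + norm (K y x - K y x')" by simp
    also have "\<dots> \<le> c * (norm (x - x') powr \<delta> / norm (x - y) powr (real DIM('a) + \<delta>))" using c[OF that] by simp
    also have "\<dots> \<le> cK * (norm (x - x') powr \<delta> / norm (x - y) powr (real DIM('a) + \<delta>))"
      by (intro mult_right_mono) (auto simp: cK_def)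
    finally show ?thesis by simp
  qed
  have Dm: "f \<in> borel_measurable lebesgue" if "f \<in> \<D>" for f
    using dom that by (auto simp: cz_domain_def)
  have mulD: "(\<lambda>x. m x * f x) \<in> \<D>" if "f \<in> \<D>" "m \<in> borel_measurable lebesgue" "bounded (range m)" for f m
    using dom that by (simp add: cz_domain_def)
  have cutD: "cutoff X f \<in> \<D>" if "f \<in> \<D>" "X \<in> sets lebesgue" for f X
    unfolding cutoff_def using that
    by (intro mulD) (auto intro!: boundedI[of _ 1] simp: indicator_def)
  have eD: "(\<lambda>y. e \<alpha> y * f y) \<in> \<D>" if "\<alpha> \<in> I" "f \<in> \<D>" for \<alpha> f
    using that em eb by (intro mulD) auto
  have split: "T (\<lambda>y. e \<alpha> y * cutoff X f y) x = T (\<lambda>y. e \<alpha> y * cutoff Y f y) x + T (\<lambda>y. e \<alpha> y * cutoff (X - Y) f y) x"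
    if "\<alpha> \<in> I" "f \<in> \<D>" "X \<in> sets lebesgue" "Y \<in> sets lebesgue" "Y \<subseteq> X" for \<alpha> f X Y x
  proof -
    have "(\<lambda>y. e \<alpha> y * cutoff X f y) = (\<lambda>y. e \<alpha> y * cutoff Y f y + e \<alpha> y * cutoff (X - Y) f y)"
      using that(5) by (auto simp: fun_eq_iff cutoff_def indicator_def)
    thus ?thesis using that by (simp add: add eD cutD)
  qed
  have T_le_S: "ennreal (norm (T (\<lambda>y. e \<alpha> y * f y) x)) \<le> ?S f x" if "\<alpha> \<in> I" for \<alpha> f x
    unfolding S_eq using that by (rule SUP_upper)
  have S_least: "?S f x \<le> b" if "\<And>\<alpha>. \<alpha> \<in> I \<Longrightarrow> ennreal (norm (T (\<lambda>y. e \<alpha> y * f y) x)) \<le> b" for f x b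
    unfolding S_eq by (rule SUP_least) (rule that)
  have off: "x \<notin> closure {y. e \<alpha> y * cutoff X f y \<noteq> 0}" if "0 < R" "\<And>y. y \<in> X \<Longrightarrow> R \<le> norm (x - y)" for x \<alpha> X f R
  proof -
    have "{y. e \<alpha> y * cutoff X f y \<noteq> 0} \<inter> ball x R = {}"
      using that(2) by (force simp: cutoff_def indicator_def dist_norm split: if_splits)
    hence "closure {y. e \<alpha> y * cutoff X f y \<noteq> 0} \<inter> ball x R = {}"
      by (simp add: open_Int_closure_eq_empty inf_commute)
    thus ?thesis using that(1) by auto
  qed
  obtain c\<^sub>0 where c\<^sub>0: "\<And>s f. 1 < s \<Longrightarrow> s \<le> r\<^sub>0 \<Longrightarrow> f \<in> \<D> \<inter> Lp s \<Longrightarrow> ?S f \<in> borel_measurable lebesgue \<and>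
       weak_Lp_norm s (?S f) \<le> ennreal (c\<^sub>0 * \<psi> s) * Lp_norm s f"
    using wk unfolding weak_type_upto_def by blast
  \<comment> \<open>The given constant may be negative; \<open>ennreal\<close> truncates it to 0
    anyway.\<close>
  define C where "C = max 0 (c\<^sub>0 * \<psi> r)"
  have "ennreal (c\<^sub>0 * \<psi> r) = ennreal C" by (auto simp: C_def max_def ennreal_neg)
  hence C: "?S f \<in> borel_measurable lebesgue" "weak_Lp_norm r (?S f) \<le> ennreal C * Lp_norm r f"
    if "f \<in> \<D>" "f \<in> Lp r" for f
    using c\<^sub>0[OF r, of f] that by auto
  have inLp: "f \<in> Lp r" if "f \<in> \<D>" "power_integral r f < \<infinity>" for f
    using that Dm[OF that(1)] by (auto simp: Lp_def Lp_norm_def epowr_def)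
  have "regular_op ?S \<D> r \<delta> cK (C powr r)"
  proof
    show "1 < r" "0 < \<delta>" "0 \<le> cK" "0 \<le> C powr r" using r \<delta> by (auto simp: cK_def)
    show "f \<in> borel_measurable lebesgue" if "f \<in> \<D>" for f by (rule Dm[OF that])
    show "cutoff X f \<in> \<D>" if "f \<in> \<D>" "X \<in> sets lebesgue" for f X by (rule cutD[OF that])
    show "?S f \<in> borel_measurable lebesgue"
      if "f \<in> \<D>" "power_integral r f < \<infinity>" for f
      using C(1) inLp that by blast
    show "vol {x. ?S f x > ennreal t}
        \<le> ennreal (C powr r / t powr r) * power_integral r f"
      if f: "f \<in> \<D>" "power_integral r f < \<infinity>" and t: "0 < t" for f t
    proof (rule epowr_root_le)
      have "ennreal t * epowr (vol {x. ?S f x > ennreal t}) (1 / r) \<le> weak_Lp_norm r (?S f)"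
        unfolding weak_Lp_norm_def using t by (intro SUP_upper) auto
      also have "\<dots> \<le> ennreal C * Lp_norm r f" using C(2) inLp f by blast
      finally show "ennreal t * epowr (vol {x. ?S f x > ennreal t}) (1 / r)
        \<le> ennreal C * epowr (power_integral r f) (1 / r)"
        by (simp add: Lp_norm_def)
    qed (use r t f in \<open>auto simp: C_def\<close>)
    fix f assume f: "f \<in> \<D>"
    {
      fix X Y :: "'a set" and x
      assume X: "X \<in> sets lebesgue" "Y \<in> sets lebesgue" "Y \<subseteq> X"
      let ?a = "\<lambda>Z \<alpha>. T (\<lambda>y. e \<alpha> y * cutoff Z f y) x"
      show "?S (cutoff X f) x \<le> ?S (cutoff Y f) x + ?S (cutoff (X - Y) f) x"
      proof (rule S_least)
        fix \<alpha> assume \<alpha>: "\<alpha> \<in> I"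
        have "norm (?a X \<alpha>) \<le> norm (?a Y \<alpha>) + norm (?a (X - Y) \<alpha>)"
          unfolding split[OF \<alpha> f X] by (rule norm_triangle_ineq)
        hence "ennreal (norm (?a X \<alpha>)) \<le> ennreal (norm (?a Y \<alpha>)) + ennreal (norm (?a (X - Y) \<alpha>))"
          by (simp flip: ennreal_plus)
        also have "\<dots> \<le> ?S (cutoff Y f) x + ?S (cutoff (X - Y) f) x" by (intro add_mono T_le_S \<alpha>)
        finally show "ennreal (norm (?a X \<alpha>)) \<le> \<dots>" .
      qed
      show "?S (cutoff (X - Y) f) x \<le> ?S (cutoff X f) x + ?S (cutoff Y f) x"
      proof (rule S_least)
        fix \<alpha> assume \<alpha>: "\<alpha> \<in> I"
        have "?a (X - Y) \<alpha> = ?a X \<alpha> - ?a Y \<alpha>" using split[OF \<alpha> f X, of x] by simp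
        hence "norm (?a (X - Y) \<alpha>) \<le> norm (?a X \<alpha>) + norm (?a Y \<alpha>)" by (metis norm_triangle_ineq4)
        hence "ennreal (norm (?a (X - Y) \<alpha>)) \<le> ennreal (norm (?a X \<alpha>)) + ennreal (norm (?a Y \<alpha>))"
          by (simp flip: ennreal_plus)
        also have "\<dots> \<le> ?S (cutoff X f) x + ?S (cutoff Y f) x" by (intro add_mono T_le_S \<alpha>)
        finally show "ennreal (norm (?a (X - Y) \<alpha>)) \<le> \<dots>" .
      qed
    }
    {
      fix X :: "'a set" and R :: real and x x'
      assume X: "X \<in> sets lebesgue" and R: "0 < R" "2 * norm (x - x') < R"
        and d: "\<And>y. y \<in> X \<Longrightarrow> R \<le> norm (x - y)" "\<And>y. y \<in> X \<Longrightarrow> R \<le> norm (x' - y)"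
      let ?b = "\<integral>\<^sup>+y\<in>X. ennreal (cK * norm (x - x') powr \<delta>
         / norm (x - y) powr (real DIM('a) + \<delta>) * norm (f y)) \<partial>lebesgue"
      show "?S (cutoff X f) x \<le> ?S (cutoff X f) x' + ?b"
      proof (rule S_least)
        fix \<alpha> assume \<alpha>: "\<alpha> \<in> I"
        let ?F = "\<lambda>y. e \<alpha> y * cutoff X f y"
        have F: "?F \<in> \<D>" using \<alpha> f X by (intro eD cutD)
        note 1 = rep[OF F off[OF R(1) d(1)]] and 2 = rep[OF F off[OF R(1) d(2)]]
        have "T ?F x - T ?F x' = (LINT y|lebesgue. K x y * ?F y - K x' y * ?F y)"
          using 1 2 by (simp add: Bochner_Integration.integral_diff)
        hence "ennreal (norm (T ?F x - T ?F x')) \<le> (\<integral>\<^sup>+y. ennreal (norm (K x y * ?F y - K x' y * ?F y)) \<partial>lebesgue)"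
          using 1 2 by (simp only:) (intro integral_norm_bound_ennreal Bochner_Integration.integrable_diff; simp)
        also have "\<dots> \<le> ?b"
        proof (intro nn_integral_mono)
          fix y
          show "ennreal (norm (K x y * ?F y - K x' y * ?F y)) \<le> ennreal (cK * norm (x - x') powr \<delta>
             / norm (x - y) powr (real DIM('a) + \<delta>) * norm (f y)) * indicator X y"
          proof (cases "y \<in> X")
            case True
            have "norm (K x y * ?F y - K x' y * ?F y) = norm (K x y - K x' y) * norm (f y)"
              using True by (simp add: cutoff_def norm_mult ne flip: left_diff_distrib)
            also have "\<dots> \<le> cK * norm (x - x') powr \<delta> / norm (x - y) powr (real DIM('a) + \<delta>) * norm (f y)"
              using R d(1)[OF True] by (intro mult_right_mono kb) auto
            finally show ?thesis using True by (simp add: ennreal_leI)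
          qed (simp add: cutoff_def)
        qed
        finally have 3: "ennreal (norm (T ?F x - T ?F x')) \<le> ?b" .
        have "ennreal (norm (T ?F x)) \<le> ennreal (norm (T ?F x')) + ennreal (norm (T ?F x - T ?F x'))"
          by (rule ennreal_norm_le_add)
        also have "\<dots> \<le> ?S (cutoff X f) x' + ?b" using 3 T_le_S[OF \<alpha>] by (rule add_mono[rotated])
        finally show "ennreal (norm (T ?F x)) \<le> ?S (cutoff X f) x' + ?b" .
      qed
    }
    {
      fix X :: "nat \<Rightarrow> 'a set" and R :: real and x
      assume X: "\<And>N. X N \<in> sets lebesgue" "incseq X" "(\<Union>N. X N) = UNIV" and R: "0 < R" "ball x R \<subseteq> X 0"
      have [measurable]: "X N \<in> sets lebesgue" for N by (rule X)
      have d: "R \<le> norm (x - y)" if "y \<in> UNIV - X N" for y N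
        using R(2) incseqD[OF X(2), of 0 N] that by (force simp: dist_norm)
      define \<epsilon> where "\<epsilon> N = (\<integral>\<^sup>+y. ennreal (norm (K x y * cutoff (UNIV - X N) f y)) \<partial>lebesgue)" for N
      have le: "?S f x \<le> ?S (cutoff (X N) f) x + \<epsilon> N" for N
      proof (rule S_least)
        fix \<alpha> assume \<alpha>: "\<alpha> \<in> I"
        let ?F = "\<lambda>y. e \<alpha> y * cutoff (UNIV - X N) f y"
        have F: "?F \<in> \<D>" using \<alpha> f X by (intro eD cutD) auto
        note 1 = rep[OF F off[OF R(1) d]]
        have "ennreal (norm (T ?F x)) \<le> (\<integral>\<^sup>+y. ennreal (norm (K x y * ?F y)) \<partial>lebesgue)"
          using 1 by (simp add: integral_norm_bound_ennreal)
        also have "\<dots> = \<epsilon> N" unfolding \<epsilon>_def by (simp add: norm_mult ne)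
        finally have 2: "ennreal (norm (T ?F x)) \<le> \<epsilon> N" .
        have "norm (T (\<lambda>y. e \<alpha> y * f y) x) \<le> norm (T (\<lambda>y. e \<alpha> y * cutoff (X N) f y) x) + norm (T ?F x)"
          using split[OF \<alpha> f, of UNIV "X N" x] X(1) by (simp add: norm_triangle_ineq)
        hence "ennreal (norm (T (\<lambda>y. e \<alpha> y * f y) x))
            \<le> ennreal (norm (T (\<lambda>y. e \<alpha> y * cutoff (X N) f y) x)) + ennreal (norm (T ?F x))"
          by (simp flip: ennreal_plus)
        also have "\<dots> \<le> ?S (cutoff (X N) f) x + \<epsilon> N" by (intro add_mono T_le_S \<alpha> 2)
        finally show "ennreal (norm (T (\<lambda>y. e \<alpha> y * f y) x)) \<le> ?S (cutoff (X N) f) x + \<epsilon> N" .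
      qed
      \<comment> \<open>The kernel representation off the support includes integrability, which
        supplies the dominating function for the tails.\<close>
      have lim: "\<epsilon> \<longlonglongrightarrow> 0" if nonempty: "I \<noteq> {}"
      proof -
        obtain \<alpha> where \<alpha>: "\<alpha> \<in> I" using nonempty by blast
        define F where "F N = (\<lambda>y. e \<alpha> y * cutoff (UNIV - X N) f y)" for N
        have FD: "F N \<in> \<D>" for N unfolding F_def using \<alpha> f X by (intro eD cutD) auto
        have int: "integrable lebesgue (\<lambda>y. K x y * F N y)" for N
          by (rule rep[OF FD, THEN conjunct1]) (unfold F_def, rule off[OF R(1) d])
        have \<epsilon>F: "\<epsilon> N = (\<integral>\<^sup>+y. ennreal (norm (K x y * F N y)) \<partial>lebesgue)" for N
          unfolding \<epsilon>_def F_def by (simp add: norm_mult ne)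
        have "(\<lambda>N. \<integral>\<^sup>+y. ennreal (norm (K x y * F N y)) \<partial>lebesgue) \<longlonglongrightarrow> (\<integral>\<^sup>+y. 0 \<partial>(lebesgue::'a measure))"
        proof (rule nn_integral_dominated_convergence[where w = "\<lambda>y. ennreal (norm (K x y * F 0 y))"])
          show "(\<lambda>y. ennreal (norm (K x y * F N y))) \<in> borel_measurable lebesgue" for N
            using borel_measurable_integrable[OF int[of N]] by measurable
          show "(\<lambda>y. ennreal (norm (K x y * F 0 y))) \<in> borel_measurable lebesgue"
            using borel_measurable_integrable[OF int[of 0]] by measurable
          show "(\<integral>\<^sup>+y. ennreal (norm (K x y * F 0 y)) \<partial>lebesgue) < \<infinity>"
            using int[of 0] by (simp add: integrable_iff_bounded)
          show "AE y in lebesgue. ennreal (norm (K x y * F N y)) \<le> ennreal (norm (K x y * F 0 y))" for N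
            using incseqD[OF X(2), of 0 N]
            by (intro AE_I2 ennreal_leI) (auto simp: F_def cutoff_def indicator_def norm_mult)
          show "AE y in lebesgue. (\<lambda>N. ennreal (norm (K x y * F N y))) \<longlonglongrightarrow> 0"
          proof (intro AE_I2)
            fix y
            obtain M where M: "y \<in> X M" using X(3) by blast
            have "eventually (\<lambda>N. ennreal (norm (K x y * F N y)) = 0) sequentially"
              using eventually_ge_at_top[of M]
              by eventually_elim (use incseqD[OF X(2)] M in \<open>auto simp: F_def cutoff_def indicator_def\<close>)
            thus "(\<lambda>N. ennreal (norm (K x y * F N y))) \<longlonglongrightarrow> 0" by (rule tendsto_eventually)
          qed
        qed auto
        thus ?thesis by (simp add: \<epsilon>F[abs_def])
      qed
      \<comment> \<open>A tail below half of \<open>S f x\<close> can be absorbed, which gives the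
        factor 2; the values 0 and infinity are treated apart.\<close>
      show "eventually (\<lambda>N. ?S f x \<le> 2 * ?S (cutoff (X N) f) x) sequentially"
      proof (cases "I = {} \<or> ?S f x = 0")
        case True
        hence "?S f x = 0" by (auto simp: S_eq bot_ennreal)
        thus ?thesis by simp
      next
        case False
        show ?thesis
        proof (cases "?S f x = \<infinity>")
          case True
          have "eventually (\<lambda>N. \<epsilon> N < 1) sequentially"
            using lim False by (intro order_tendstoD(2)[of _ 0]) auto
          thus ?thesis
          proof eventually_elim
            case (elim N)
            hence "\<epsilon> N \<noteq> \<infinity>" using less_trans[OF elim, of \<infinity>] by auto
            hence "?S (cutoff (X N) f) x = \<infinity>" using le[of N] True by (auto simp: top_unique)
            thus ?case by (simp add: ennreal_mult_top)
          qed
        next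
          case fin: False
          then obtain a where a: "?S f x = ennreal a" "0 \<le> a" by (metis ennreal_cases infinity_ennreal_def)
          have a0: "0 < a" using a False by (cases "a = 0") auto
          have "eventually (\<lambda>N. \<epsilon> N < ennreal (a / 2)) sequentially"
            using lim False a0 by (intro order_tendstoD(2)[of _ 0]) auto
          thus ?thesis
          proof eventually_elim
            case (elim N)
            have "?S f x \<le> ?S (cutoff (X N) f) x + \<epsilon> N" by (rule le)
            also have "\<dots> \<le> ?S (cutoff (X N) f) x + ennreal (a / 2)"
              using elim by (intro add_left_mono less_imp_le)
            finally have "ennreal a \<le> ennreal (1 / 2 * a) + ?S (cutoff (X N) f) x"
              unfolding a(1) by (simp add: add.commute)
            hence "ennreal a \<le> ennreal (1 / (1 - 1 / 2)) * ?S (cutoff (X N) f) x"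
              using a by (intro ennreal_absorb) auto
            thus ?case using a by simp
          qed
        qed
      qed
    }
  qed
  thus ?thesis by blast
qed

section \<open>Sparse domination\<close>

text \<open>The weak type bound holds at positive heights only; continuity from below extends it to
  the height \<open>b\<close>, which is 0 where the average of \<open>f\<close> vanishes.\<close>

lemma emeasure_gt_limit:
  assumes [measurable]: "g \<in> borel_measurable M" and b: "0 \<le> b"
    and le: "\<And>t. b < t \<Longrightarrow> emeasure M {x \<in> space M. ennreal t < g x} \<le> K"
  shows "emeasure M {x \<in> space M. ennreal b < g x} \<le> K"
proof -
  have "{x \<in> space M. ennreal b < g x} = (\<Union>n. {x \<in> space M. ennreal (b + 1 / real (Suc n)) < g x})"
  proof (intro set_eqI iffI)
    fix x assume "x \<in> {x \<in> space M. ennreal b < g x}"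
    hence x: "x \<in> space M" "ennreal b < g x" by auto
    have "(\<lambda>n. ennreal (b + 1 / real (Suc n))) \<longlonglongrightarrow> ennreal (b + 0)"
      by (intro tendsto_ennrealI tendsto_add tendsto_const LIMSEQ_Suc[OF lim_1_over_n])
    hence "eventually (\<lambda>n. ennreal (b + 1 / real (Suc n)) < g x) sequentially"
      using x by (intro order_tendstoD(2)[of _ "ennreal (b + 0)"]) auto
    thus "x \<in> (\<Union>n. {x \<in> space M. ennreal (b + 1 / real (Suc n)) < g x})"
      using x eventually_sequentially by auto
  next
    fix x assume "x \<in> (\<Union>n. {x \<in> space M. ennreal (b + 1 / real (Suc n)) < g x})"
    then obtain n where "x \<in> space M" "ennreal (b + 1 / real (Suc n)) < g x" by blast
    moreover have "ennreal b \<le> ennreal (b + 1 / real (Suc n))" by (intro ennreal_leI) simp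
    ultimately show "x \<in> {x \<in> space M. ennreal b < g x}" by (auto intro: le_less_trans)
  qed
  also have "emeasure M \<dots> = (SUP n. emeasure M {x \<in> space M. ennreal (b + 1 / real (Suc n)) < g x})"
  proof (rule SUP_emeasure_incseq[symmetric])
    have "ennreal (b + 1 / real (Suc n)) \<le> ennreal (b + 1 / real (Suc m))" if "m \<le> n" for m n
      using that by (intro ennreal_leI add_left_mono divide_left_mono) auto
    thus "incseq (\<lambda>n. {x \<in> space M. ennreal (b + 1 / real (Suc n)) < g x})"
      by (auto simp: incseq_def intro: le_less_trans)
  qed auto
  also have "\<dots> \<le> K" by (intro SUP_least le) auto
  finally show ?thesis .
qed

lemma geometric_le:
  fixes q :: real
  assumes "0 \<le> q" "q < 1" "k \<le> j"
  shows "(\<Sum>i\<in>{k..<j}. q ^ (j - i)) \<le> 1 / (1 - q)"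
proof -
  have "(\<Sum>i\<in>{k..<j}. q ^ (j - i)) = (\<Sum>m\<in>{1..j - k}. q ^ m)"
    by (rule sum.reindex_bij_witness[of _ "\<lambda>m. j - m" "\<lambda>i. j - i"]) (use assms in auto)
  also have "\<dots> \<le> (\<Sum>m. q ^ m)"
    using assms by (intro sum_le_suminf summable_geometric) auto
  also have "\<dots> = 1 / (1 - q)" using assms by (intro suminf_geometric) auto
  finally show ?thesis .
qed

text \<open>The constants are tied to the dimension and the data of the operator, hence are uniform
  in \<open>f\<close> and \<open>L\<close>. A proportion \<open>\<eta>\<close> of a cube is a
  quarter of any of its children. The choices of \<open>\<epsilon>\<close> and \<open>c2\<close> let
  each of the two kinds of bad subcubes cover at most a quarter of a cube, and \<open>c1\<close> is
  the height at which the weak type bound gives the proportion \<open>\<epsilon>\<close>, with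
  \<open>cw + 1\<close> in place of \<open>cw\<close> to keep it positive.\<close>

locale local_op = grid L + regular_op S \<D> r \<delta> cK cw
  for L :: real and S :: "('a::euclidean_space \<Rightarrow> complex) \<Rightarrow> 'a \<Rightarrow> ennreal" and \<D> and r \<delta> cK cw :: real +
  fixes f :: "'a \<Rightarrow> complex" and cv star_vol \<eta> \<epsilon> c1 c2 :: real
  assumes cv_def: "cv = cov TYPE('a)" and star_vol_def: "star_vol = (2 * kap TYPE('a)) ^ DIM('a)"
    and \<eta>_def: "\<eta> = 1 / 2 ^ (DIM('a) + 2)" and \<epsilon>_def: "\<epsilon> = \<eta> / (4 * cv)"
    and c1_def: "c1 = ((cw + 1) / \<epsilon>) powr (1 / r)" and c2_def: "c2 = 4 * cv"
    and fD: "f \<in> \<D>"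
    and fin: "\<And>k x. (\<integral>\<^sup>+y\<in>dstar k x. ennreal (norm (f y) powr r) \<partial>lebesgue) < \<infinity>"
begin

section \<open>Averages and exceptional sets\<close>

lemma f_meas [measurable]: "f \<in> borel_measurable lebesgue" by (rule dom_meas[OF fD])

text \<open>Normalised by the volume of the cube, not of its dilate.\<close>
definition avg :: "nat \<Rightarrow> 'a \<Rightarrow> real" where
  "avg k x = (enn2real (\<integral>\<^sup>+y\<in>dstar k x. ennreal (norm (f y) powr r) \<partial>lebesgue) / side k ^ DIM('a)) powr (1 / r)"

lemma avg_nonneg [simp]: "0 \<le> avg k x" by (simp add: avg_def)

lemma avg_cong: "corner k x = corner k y \<Longrightarrow> avg k x = avg k y"
  unfolding avg_def using dstar_cong by metis

lemma avg_eq: "(\<integral>\<^sup>+y\<in>dstar k x. ennreal (norm (f y) powr r) \<partial>lebesgue) = ennreal (avg k x powr r * side k ^ DIM('a))"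
proof -
  let ?I = "\<integral>\<^sup>+y\<in>dstar k x. ennreal (norm (f y) powr r) \<partial>lebesgue"
  have "avg k x powr r = enn2real ?I / side k ^ DIM('a)"
    using r by (simp add: avg_def powr_powr)
  hence "avg k x powr r * side k ^ DIM('a) = enn2real ?I" by simp
  thus ?thesis using fin[of k x] by simp
qed

lemma covering:
  assumes "g \<in> borel_measurable lebesgue"
    and "\<And>j y. (j, y) \<in> W \<Longrightarrow> vol (dcube j y) \<le> (\<integral>\<^sup>+x\<in>dstar j y. g x \<partial>lebesgue)"
  shows "vol (cover W) \<le> ennreal cv * (\<integral>\<^sup>+(x::'a). g x \<partial>lebesgue)"
  unfolding cv_def using assms by (rule dyadic_covering)

lemma cv_ge_1: "1 \<le> cv"
proof -
  have "1 \<le> 10 * (real DIM('a) * (kap TYPE('a) + 1))"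
    using kap_ge[where 'a='a] mult_mono[of 1 "real DIM('a)" 1 "kap TYPE('a) + 1"] by (simp add: Suc_leI)
  thus ?thesis unfolding cv_def cov_def by (rule one_le_power)
qed

lemma star_vol_pos: "0 < star_vol" using kap_ge[where 'a='a] by (simp add: star_vol_def)

lemma \<eta>_pos: "0 < \<eta>" and \<eta>_less_1: "\<eta> < 1"
  by (simp_all add: \<eta>_def field_simps) (use one_le_power[of "2::real" "DIM('a)"] in linarith)

lemma \<epsilon>_pos: "0 < \<epsilon>" and \<epsilon>_le: "\<epsilon> \<le> \<eta>"
  using \<eta>_pos cv_ge_1 by (auto simp: \<epsilon>_def field_simps)

lemma c1_pos: "0 < c1" using cw \<epsilon>_pos by (simp add: c1_def)
lemma c2_ge_1: "1 \<le> c2" using cv_ge_1 by (simp add: c2_def)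

definition exc :: "nat \<Rightarrow> 'a \<Rightarrow> 'a set" where
  "exc k x = {y. S (cutoff (dstar k x) f) y > ennreal (c1 * avg k x)}"

lemma cutoff_star_dom: "cutoff (dstar k x) f \<in> \<D>"
  by (intro cutoff_dom fD dstar_lebesgue)

lemma cutoff_star_int:
  "power_integral r (cutoff (dstar k x) f) = ennreal (avg k x powr r * side k ^ DIM('a))"
  unfolding avg_eq[symmetric]
  by (intro nn_integral_cong) (auto simp: cutoff_def indicator_def)

lemma op_star_meas [measurable]: "S (cutoff (dstar k x) f) \<in> borel_measurable lebesgue"
  by (rule op_meas[OF cutoff_star_dom]) (simp add: cutoff_star_int)

lemma exc_sets [measurable]: "exc k x \<in> sets lebesgue"
proof -
  have "{y \<in> space lebesgue. S (cutoff (dstar k x) f) y > ennreal (c1 * avg k x)} \<in> sets lebesgue" by measurable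
  thus ?thesis by (simp add: exc_def)
qed

lemma exc_cong: "corner k x = corner k y \<Longrightarrow> exc k x = exc k y"
  unfolding exc_def using dstar_cong avg_cong by metis

lemma emeasure_exc: "vol (exc k x) \<le> ennreal \<epsilon> * vol (dcube k x)"
proof -
  have "vol {y \<in> space lebesgue. ennreal (c1 * avg k x) < S (cutoff (dstar k x) f) y}
    \<le> ennreal (\<epsilon> * side k ^ DIM('a))"
  proof (rule emeasure_gt_limit)
    show "0 \<le> c1 * avg k x" using c1_pos by simp
    fix t assume t: "c1 * avg k x < t"
    have t0: "0 < t" using t c1_pos avg_nonneg[of k x] mult_nonneg_nonneg[of c1 "avg k x"] by linarith
    have "(c1 * avg k x) powr r \<le> t powr r"
      using t r c1_pos by (intro powr_mono2) auto
    hence "c1 powr r * avg k x powr r \<le> t powr r" using c1_pos by (simp add: powr_mult)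
    moreover have c1r: "c1 powr r = (cw + 1) / \<epsilon>" using r cw \<epsilon>_pos by (simp add: c1_def powr_powr)
    ultimately have 1: "(cw + 1) * avg k x powr r \<le> \<epsilon> * t powr r" using \<epsilon>_pos by (simp add: field_simps)
    have "cw * avg k x powr r \<le> (cw + 1) * avg k x powr r" by (simp add: algebra_simps)
    hence "cw * avg k x powr r \<le> \<epsilon> * t powr r" using 1 by linarith
    hence "cw / t powr r * avg k x powr r \<le> \<epsilon>" using t0 by (simp add: field_simps)
    hence 2: "cw / t powr r * (avg k x powr r * side k ^ DIM('a)) \<le> \<epsilon> * side k ^ DIM('a)"
      unfolding mult.assoc[symmetric] by (intro mult_right_mono) auto
    have "vol {y. ennreal t < S (cutoff (dstar k x) f) y}
      \<le> ennreal (cw / t powr r) * power_integral r (cutoff (dstar k x) f)"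
      by (intro weak cutoff_star_dom t0) (simp add: cutoff_star_int)
    also have "\<dots> = ennreal (cw / t powr r * (avg k x powr r * side k ^ DIM('a)))"
      unfolding cutoff_star_int using cw by (intro ennreal_mult[symmetric]) auto
    also have "\<dots> \<le> ennreal (\<epsilon> * side k ^ DIM('a))" using 2 by (rule ennreal_leI)
    finally show "vol {y \<in> space lebesgue. ennreal t < S (cutoff (dstar k x) f) y} \<le> \<dots>" by simp
  qed simp
  thus ?thesis using \<epsilon>_pos by (simp add: exc_def emeasure_dcube ennreal_mult)
qed

section \<open>Bad subcubes\<close>

definition dense :: "nat \<Rightarrow> nat \<Rightarrow> 'a \<Rightarrow> bool" where
  "dense k j x \<longleftrightarrow> ennreal \<eta> * vol (dcube j x) < vol (dcube j x \<inter> exc k x)"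

definition bad :: "nat \<Rightarrow> nat \<Rightarrow> 'a \<Rightarrow> bool" where
  "bad k j x \<longleftrightarrow> dense k j x \<or> c2 * avg k x powr r < avg j x powr r"

lemma bad_cong:
  assumes "k \<le> j" "corner j x = corner j y"
  shows "bad k j x = bad k j y"
proof -
  have k: "corner k x = corner k y" using corner_cong[OF assms] .
  show ?thesis
    unfolding bad_def dense_def exc_cong[OF k] avg_cong[OF k] avg_cong[OF assms(2)] dcube_cong[OF assms(2)] ..
qed

text \<open>Either reason for badness is tested in the covering lemma against a function of small
  integral: a multiple of the indicator of \<open>exc k x\<close>, or a multiple of
  \<open>|f|^r\<close> on the dilate. Each costs a quarter of the cube.\<close>

lemma emeasure_bad:
  "vol (cover {(j, y). y \<in> dcube k x \<and> k < j \<and> bad k j y})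
    \<le> ennreal (1 / 2) * vol (dcube k x)"
proof -
  let ?s = "side k ^ DIM('a)"
  define W1 where "W1 = {(j, y). y \<in> dcube k x \<and> k < j \<and> dense k j y}"
  define W2 where "W2 = {(j, y). y \<in> dcube k x \<and> k < j \<and> c2 * avg k y powr r < avg j y powr r}"
  have ck: "corner k y = corner k x" if "y \<in> dcube k x" for y using that by (simp add: dcube_def)
  have W1: "vol (cover W1) \<le> ennreal (1 / 4 * ?s)"
  proof -
    have "vol (cover W1)
      \<le> ennreal cv * (\<integral>\<^sup>+z. ennreal (1 / \<eta>) * indicator (exc k x) z \<partial>lebesgue)"
    proof (rule covering)
      show "(\<lambda>z. ennreal (1 / \<eta>) * indicator (exc k x) z) \<in> borel_measurable lebesgue" by measurable
      fix j y assume "(j, y) \<in> W1"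
      hence y: "y \<in> dcube k x" "dense k j y" by (auto simp: W1_def)
      have "ennreal \<eta> * vol (dcube j y) \<le> vol (dcube j y \<inter> exc k x)"
        using y exc_cong[OF ck[OF y(1)]] by (simp add: dense_def)
      hence "ennreal (1 / \<eta>) * (ennreal \<eta> * vol (dcube j y))
        \<le> ennreal (1 / \<eta>) * vol (dcube j y \<inter> exc k x)" by (intro mult_left_mono) auto
      moreover have "ennreal (1 / \<eta>) * ennreal \<eta> = 1" using \<eta>_pos by (simp flip: ennreal_mult)
      ultimately have "vol (dcube j y) \<le> ennreal (1 / \<eta>) * vol (dcube j y \<inter> exc k x)"
        by (simp flip: mult.assoc)
      also have "\<dots> \<le> ennreal (1 / \<eta>) * vol (exc k x \<inter> dstar j y)"
        using dcube_subset_dstar by (intro mult_left_mono emeasure_mono) auto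
      also have "\<dots> = (\<integral>\<^sup>+z. ennreal (1 / \<eta>) * indicator (exc k x \<inter> dstar j y) z \<partial>lebesgue)"
        by (subst nn_integral_cmult_indicator) auto
      also have "\<dots> = (\<integral>\<^sup>+z\<in>dstar j y. (ennreal (1 / \<eta>) * indicator (exc k x) z) \<partial>lebesgue)"
        by (intro nn_integral_cong) (auto simp: indicator_def)
      finally show "vol (dcube j y)
        \<le> (\<integral>\<^sup>+z\<in>dstar j y. (ennreal (1 / \<eta>) * indicator (exc k x) z) \<partial>lebesgue)" .
    qed
    also have "(\<integral>\<^sup>+z. ennreal (1 / \<eta>) * indicator (exc k x) z \<partial>lebesgue) = ennreal (1 / \<eta>) * vol (exc k x)"
      by (subst nn_integral_cmult_indicator) auto
    also have "ennreal cv * (ennreal (1 / \<eta>) * vol (exc k x))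
      \<le> ennreal cv * (ennreal (1 / \<eta>) * (ennreal \<epsilon> * vol (dcube k x)))"
      by (intro mult_left_mono emeasure_exc) auto
    also have "\<dots> = ennreal (cv * (1 / \<eta> * (\<epsilon> * ?s)))"
      using \<eta>_pos \<epsilon>_pos cv_ge_1 by (simp add: emeasure_dcube flip: ennreal_mult)
    also have "cv * (1 / \<eta> * (\<epsilon> * ?s)) = 1 / 4 * ?s"
      using \<eta>_pos cv_ge_1 by (simp add: \<epsilon>_def)
    finally show ?thesis .
  qed
  have W2: "vol (cover W2) \<le> ennreal (1 / 4 * ?s)"
  \<comment> \<open>A vanishing average excludes any jump on subcubes; otherwise the test function
    can be normalised by it.\<close>
  proof (cases "avg k x = 0")
    case True
    have "W2 = {}"
    proof (rule ccontr)
      assume "W2 \<noteq> {}"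
      then obtain j y where jy': "y \<in> dcube k x" "k < j" "c2 * avg k y powr r < avg j y powr r"
        by (auto simp: W2_def)
      have jy: "y \<in> dcube k x" "k < j" "0 < avg j y powr r"
        using jy' True unfolding avg_cong[OF ck[OF jy'(1)]] by auto
      have "ennreal (avg j y powr r * side j ^ DIM('a)) \<le> (\<integral>\<^sup>+z\<in>dstar k x. ennreal (norm (f z) powr r) \<partial>lebesgue)"
        unfolding avg_eq[symmetric] dstar_cong[OF ck[OF jy(1)], symmetric]
        using dstar_mono[of k j y] jy(2) by (intro nn_integral_mono) (auto simp: indicator_def)
      also have "\<dots> = 0" unfolding avg_eq using True r by simp
      finally show False using jy(3) by (simp add: mult_le_0_iff)
    qed
    thus ?thesis by simp
  next
    case False
    hence a: "0 < avg k x" using avg_nonneg[of k x] by linarith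
    define c where "c = 1 / (c2 * avg k x powr r)"
    have c: "0 < c" using a c2_ge_1 by (simp add: c_def)
    have "vol (cover W2)
      \<le> ennreal cv * (\<integral>\<^sup>+z. ennreal c * (ennreal (norm (f z) powr r) * indicator (dstar k x) z) \<partial>lebesgue)"
    proof (rule covering)
      show "(\<lambda>z. ennreal c * (ennreal (norm (f z) powr r) * indicator (dstar k x) z)) \<in> borel_measurable lebesgue"
        by measurable
      fix j y assume "(j, y) \<in> W2"
      hence y': "y \<in> dcube k x" "k < j" "c2 * avg k y powr r < avg j y powr r"
        by (auto simp: W2_def)
      have y: "y \<in> dcube k x" "k < j" "c2 * avg k x powr r < avg j y powr r"
        using y' unfolding avg_cong[OF ck[OF y'(1)]] by auto
      have "1 \<le> c * avg j y powr r" using y(3) a c2_ge_1 by (simp add: c_def field_simps)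
      hence "1 * side j ^ DIM('a) \<le> c * avg j y powr r * side j ^ DIM('a)"
        by (intro mult_right_mono) auto
      hence "vol (dcube j y) \<le> ennreal (c * (avg j y powr r * side j ^ DIM('a)))"
        unfolding emeasure_dcube by (intro ennreal_leI) (simp add: mult.assoc)
      also have "\<dots> = ennreal c * (\<integral>\<^sup>+z\<in>dstar j y. ennreal (norm (f z) powr r) \<partial>lebesgue)"
        unfolding avg_eq using c by (intro ennreal_mult) auto
      also have "\<dots> = (\<integral>\<^sup>+z. ennreal c * (ennreal (norm (f z) powr r) * indicator (dstar j y) z) \<partial>lebesgue)"
        by (rule nn_integral_cmult[symmetric]) measurable
      also have "\<dots> \<le> (\<integral>\<^sup>+z\<in>dstar j y. (ennreal c * (ennreal (norm (f z) powr r) * indicator (dstar k x) z)) \<partial>lebesgue)"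
        using dstar_mono[of k j y] y(2) dstar_cong[OF ck[OF y(1)]]
        by (intro nn_integral_mono) (auto simp: indicator_def)
      finally show "vol (dcube j y) \<le> \<dots>" .
    qed
    also have "(\<integral>\<^sup>+z. ennreal c * (ennreal (norm (f z) powr r) * indicator (dstar k x) z) \<partial>lebesgue)
        = ennreal c * (\<integral>\<^sup>+z\<in>dstar k x. ennreal (norm (f z) powr r) \<partial>lebesgue)"
      by (rule nn_integral_cmult) measurable
    also have "ennreal cv * \<dots> = ennreal (cv * (c * (avg k x powr r * ?s)))"
      unfolding avg_eq using c cv_ge_1 by (simp add: ennreal_mult)
    also have "cv * (c * (avg k x powr r * ?s)) = 1 / 4 * ?s"
      using a cv_ge_1 by (simp add: c_def c2_def)
    finally show ?thesis .
  qed
  have "vol (cover {(j, y). y \<in> dcube k x \<and> k < j \<and> bad k j y})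
    \<le> vol (cover W1 \<union> cover W2)"
    by (intro emeasure_mono sets.Un sets_UN_dcube) (auto simp: W1_def W2_def bad_def)
  also have "\<dots> \<le> vol (cover W1) + vol (cover W2)"
    by (intro emeasure_subadditive sets_UN_dcube)
  also have "\<dots> \<le> ennreal (1 / 4 * ?s) + ennreal (1 / 4 * ?s)" by (intro add_mono W1 W2)
  also have "\<dots> = ennreal (1 / 4 * ?s + 1 / 4 * ?s)" by (intro ennreal_plus[symmetric]) auto
  also have "1 / 4 * ?s + 1 / 4 * ?s = 1 / 2 * ?s" by simp
  also have "ennreal (1 / 2 * ?s) = ennreal (1 / 2) * vol (dcube k x)"
    unfolding emeasure_dcube by (intro ennreal_mult) auto
  finally show ?thesis .
qed

text \<open>Instead of Hoelder's inequality: \<open>a \<le> l + l powr (1 - r) * a powr r\<close> for \<open>l > 0\<close>.\<close>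
lemma star_L1_le:
  "(\<integral>\<^sup>+y\<in>dstar k x. ennreal (norm (f y)) \<partial>lebesgue) \<le> ennreal ((star_vol + 1) * side k ^ DIM('a) * avg k x)"
proof (cases "avg k x = 0")
  case True
  have "(\<integral>\<^sup>+y. ennreal (norm (f y) powr r) * indicator (dstar k x) y \<partial>lebesgue) = 0"
    unfolding avg_eq using True r by simp
  hence "AE y in lebesgue. ennreal (norm (f y) powr r) * indicator (dstar k x) y = 0"
    by (subst (asm) nn_integral_0_iff_AE) measurable
  hence "AE y in lebesgue. ennreal (norm (f y)) * indicator (dstar k x) y = 0"
    by eventually_elim (auto simp: indicator_def split: if_splits)
  hence "(\<integral>\<^sup>+y. ennreal (norm (f y)) * indicator (dstar k x) y \<partial>lebesgue) = 0"
    by (subst nn_integral_0_iff_AE) measurable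
  thus ?thesis by simp
next
  case False
  define l where "l = avg k x"
  have l: "0 < l" using False avg_nonneg[of k x] unfolding l_def by linarith
  have pt: "a \<le> l + l powr (1 - r) * a powr r" if a: "0 \<le> a" for a
  proof (cases "a \<le> l")
    case False
    have "a = a powr (1 - r) * a powr r" using False l by (simp flip: powr_add)
    also have "\<dots> \<le> l powr (1 - r) * a powr r"
      using False l r by (intro mult_right_mono powr_mono2') auto
    finally show ?thesis using l by linarith
  qed (simp add: add_increasing2)
  have "(\<integral>\<^sup>+y\<in>dstar k x. ennreal (norm (f y)) \<partial>lebesgue)
    \<le> (\<integral>\<^sup>+y. ennreal l * indicator (dstar k x) y
        + ennreal (l powr (1 - r)) * (ennreal (norm (f y) powr r) * indicator (dstar k x) y) \<partial>lebesgue)"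
  proof (intro nn_integral_mono)
    fix y
    have "ennreal (norm (f y)) \<le> ennreal (l + l powr (1 - r) * norm (f y) powr r)" by (intro ennreal_leI pt) simp
    also have "\<dots> = ennreal l + ennreal (l powr (1 - r)) * ennreal (norm (f y) powr r)"
      using l by (simp add: ennreal_mult)
    finally show "ennreal (norm (f y)) * indicator (dstar k x) y \<le> ennreal l * indicator (dstar k x) y
        + ennreal (l powr (1 - r)) * (ennreal (norm (f y) powr r) * indicator (dstar k x) y)"
      by (auto simp: indicator_def)
  qed
  also have "\<dots> = ennreal l * vol (dstar k x)
        + ennreal (l powr (1 - r)) * (\<integral>\<^sup>+y\<in>dstar k x. ennreal (norm (f y) powr r) \<partial>lebesgue)"
    by (subst nn_integral_add, measurable, subst nn_integral_cmult_indicator, measurable, subst nn_integral_cmult, measurable)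
  also have "\<dots> = ennreal (l * (star_vol * side k ^ DIM('a)) + l powr (1 - r) * (l powr r * side k ^ DIM('a)))"
    unfolding avg_eq emeasure_dstar l_def[symmetric] star_vol_def[symmetric] using l star_vol_pos
    by (simp add: ennreal_mult)
  also have "l * (star_vol * side k ^ DIM('a)) + l powr (1 - r) * (l powr r * side k ^ DIM('a))
      = l * (star_vol * side k ^ DIM('a)) + (l powr (1 - r) * l powr r) * side k ^ DIM('a)" by simp
  also have "l powr (1 - r) * l powr r = l" using l by (simp flip: powr_add)
  also have "l * (star_vol * side k ^ DIM('a)) + l * side k ^ DIM('a) = (star_vol + 1) * side k ^ DIM('a) * avg k x"
    by (simp add: l_def algebra_simps)
  finally show ?thesis .
qed

text \<open>The region splits into annuli between consecutive dilates. On the annulus of level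
  \<open>i\<close> the distance to \<open>y\<close> is at least \<open>2 * DIM('a) * side i\<close>,
  while \<open>x\<close> and \<open>x'\<close> are within \<open>DIM('a) * side j\<close> of each
  other, so smoothness gains \<open>(side j / side i) powr \<delta>\<close>, which is geometric in
  \<open>j - i\<close>.\<close>

lemma osc_le:
  assumes kj: "k \<le> j" and x: "x \<in> dcube j z" "x' \<in> dcube j z"
  shows "(\<integral>\<^sup>+y\<in>dstar k z - dstar j z. ennreal (cK * norm (x - x') powr \<delta>
      / norm (x - y) powr (real DIM('a) + \<delta>) * norm (f y)) \<partial>lebesgue)
    \<le> ennreal (\<Sum>i\<in>{k..<j}. cK * (star_vol + 1) * (2 powr (- \<delta>)) ^ (j - i) * avg i z)"
proof -
  define n where "n = real DIM('a)"
  have n: "1 \<le> n" by (simp add: n_def Suc_leI)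
  define b where "b i = cK * ((2 powr (- \<delta>)) ^ (j - i) / side i ^ DIM('a))" for i
  have b: "0 \<le> b i" for i using cK by (simp add: b_def)
  have annulus: "\<exists>i\<in>{k..<j}. y \<in> dstar i z - dstar (Suc i) z" if "y \<in> dstar k z - dstar j z" for y
    using kj that
  proof (induction j rule: dec_induct)
    case (step m)
    show ?case
    proof (cases "y \<in> dstar m z")
      case True
      thus ?thesis using step by (intro bexI[of _ m]) auto
    next
      case False
      then obtain i where "i \<in> {k..<m}" "y \<in> dstar i z - dstar (Suc i) z" using step by auto
      thus ?thesis by (intro bexI[of _ i]) auto
    qed
  qed simp
  have xx: "norm (x - x') \<le> n * side j" unfolding n_def by (rule dist_dcube[OF x])
  have pt: "cK * norm (x - x') powr \<delta> / norm (x - y) powr (n + \<delta>) \<le> b i"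
    if i: "i \<in> {k..<j}" and y: "y \<notin> dstar (Suc i) z" for i y
  proof -
    have "x \<in> dcube (Suc i) z" using x(1) dcube_mono[of "Suc i" j z] i by auto
    \<comment> \<open>The point \<open>y\<close> is known to escape only the dilate of half the
      size, which turns the factor 4 into 2.\<close>
    from dist_not_dstar[OF this y] have d: "2 * n * side i \<le> norm (x - y)" by (simp add: n_def side_Suc mult_ac)
    have p: "0 < 2 * n * side i" using n by simp
    have "norm (x - x') powr \<delta> / norm (x - y) powr (n + \<delta>) \<le> (n * side j) powr \<delta> / (2 * n * side i) powr (n + \<delta>)"
      using xx d p n \<delta> by (intro frac_le powr_mono2) auto
    also have "\<dots> = (n * side j) powr \<delta> / ((2 * n * side i) powr n * (2 * n * side i) powr \<delta>)"
      by (simp add: powr_add)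
    also have "\<dots> = ((n * side j) / (2 * n * side i)) powr \<delta> / (2 * n * side i) powr n"
    proof -
      have "((n * side j) / (2 * n * side i)) powr \<delta> = (n * side j) powr \<delta> / (2 * n * side i) powr \<delta>"
        by (rule powr_divide)
      thus ?thesis by (simp only: divide_divide_eq_left mult.commute)
    qed
    also have "\<dots> \<le> (side j / side i) powr \<delta> / side i powr n"
    proof (rule frac_le)
      have "n * side j / (2 * n * side i) = side j / (2 * side i)" using n by simp
      also have "\<dots> \<le> side j / side i" by (intro divide_left_mono) auto
      finally show "(n * side j / (2 * n * side i)) powr \<delta> \<le> (side j / side i) powr \<delta>"
        using n \<delta> by (intro powr_mono2) auto
      have "side i \<le> 2 * n * side i" using n by simp
      thus "side i powr n \<le> (2 * n * side i) powr n" using n by (intro powr_mono2) auto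
    qed auto
    also have "side i powr n = side i ^ DIM('a)" unfolding n_def by (rule powr_realpow) simp
    also have "side j / side i = 2 powr - real (j - i)"
    proof -
      have "side i = 2 ^ (j - i) * side j" using side_add[of i "j - i"] i by simp
      thus ?thesis by (simp add: powr_minus powr_realpow divide_inverse)
    qed
    also have "(2 powr - real (j - i)) powr \<delta> = (2 powr (- \<delta>)) ^ (j - i)"
      by (simp add: powr_powr powr_realpow[symmetric] mult.commute)
    finally have "cK * (norm (x - x') powr \<delta> / norm (x - y) powr (n + \<delta>)) \<le> b i"
      unfolding b_def using cK by (intro mult_left_mono) auto
    thus ?thesis by simp
  qed
  have "(\<integral>\<^sup>+y\<in>dstar k z - dstar j z. ennreal (cK * norm (x - x') powr \<delta>
      / norm (x - y) powr (real DIM('a) + \<delta>) * norm (f y)) \<partial>lebesgue)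
    \<le> (\<integral>\<^sup>+y. (\<Sum>i\<in>{k..<j}. ennreal (b i) * (ennreal (norm (f y)) * indicator (dstar i z) y)) \<partial>lebesgue)"
  proof (intro nn_integral_mono)
    fix y
    show "ennreal (cK * norm (x - x') powr \<delta> / norm (x - y) powr (real DIM('a) + \<delta>) * norm (f y))
        * indicator (dstar k z - dstar j z) y
      \<le> (\<Sum>i\<in>{k..<j}. ennreal (b i) * (ennreal (norm (f y)) * indicator (dstar i z) y))"
    proof (cases "y \<in> dstar k z - dstar j z")
      case True
      then obtain i where i: "i \<in> {k..<j}" "y \<in> dstar i z - dstar (Suc i) z" using annulus by blast
      have "ennreal (cK * norm (x - x') powr \<delta> / norm (x - y) powr (real DIM('a) + \<delta>) * norm (f y))
        \<le> ennreal (b i * norm (f y))"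
        using pt[OF i(1)] i(2) unfolding n_def by (intro ennreal_leI mult_right_mono) auto
      also have "\<dots> = ennreal (b i) * (ennreal (norm (f y)) * indicator (dstar i z) y)"
        using i b by (simp add: ennreal_mult)
      also have "\<dots> \<le> (\<Sum>i\<in>{k..<j}. ennreal (b i) * (ennreal (norm (f y)) * indicator (dstar i z) y))"
        using i(1) by (intro member_le_sum) auto
      finally show ?thesis using True by simp
    qed simp
  qed
  also have "\<dots> = (\<Sum>i\<in>{k..<j}. ennreal (b i) * (\<integral>\<^sup>+y\<in>dstar i z. ennreal (norm (f y)) \<partial>lebesgue))"
    by (subst nn_integral_sum, measurable) (intro sum.cong refl nn_integral_cmult, measurable)
  also have "\<dots> \<le> (\<Sum>i\<in>{k..<j}. ennreal (b i) * ennreal ((star_vol + 1) * side i ^ DIM('a) * avg i z))"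
    by (intro sum_mono mult_left_mono star_L1_le) auto
  also have "\<dots> = (\<Sum>i\<in>{k..<j}. ennreal (cK * (star_vol + 1) * (2 powr (- \<delta>)) ^ (j - i) * avg i z))"
  proof (intro sum.cong refl)
    fix i
    have "ennreal (b i) * ennreal ((star_vol + 1) * side i ^ DIM('a) * avg i z)
        = ennreal (b i * ((star_vol + 1) * side i ^ DIM('a) * avg i z))"
      using b star_vol_pos by (intro ennreal_mult[symmetric]) auto
    also have "b i * ((star_vol + 1) * side i ^ DIM('a) * avg i z) = cK * (star_vol + 1) * (2 powr (- \<delta>)) ^ (j - i) * avg i z"
      by (simp add: b_def)
    finally show "ennreal (b i) * ennreal ((star_vol + 1) * side i ^ DIM('a) * avg i z)
        = ennreal (cK * (star_vol + 1) * (2 powr (- \<delta>)) ^ (j - i) * avg i z)" .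
  qed
  also have "\<dots> = ennreal (\<Sum>i\<in>{k..<j}. cK * (star_vol + 1) * (2 powr (- \<delta>)) ^ (j - i) * avg i z)"
    using cK star_vol_pos by (intro sum_ennreal) auto
  finally show ?thesis .
qed

text \<open>One summand for each error in \<open>op_step\<close>: the operator on the large dilate
  at the comparison point, that on the small dilate, and the geometric series of
  oscillations.\<close>

definition cs :: real where
  "cs = c1 + c1 * (2 ^ DIM('a) * c2) powr (1 / r) + cK * (star_vol + 1) * c2 powr (1 / r) / (1 - 2 powr (- \<delta>))"

lemma \<delta>_geom: "0 \<le> (2::real) powr (- \<delta>)" "(2::real) powr (- \<delta>) < 1"
  using powr_less_cancel_iff[of 2 "- \<delta>" 0] \<delta> by auto

lemma c1_le_cs: "c1 \<le> cs" and cs_pos: "0 < cs"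
proof -
  have "0 \<le> c1 * (2 ^ DIM('a) * c2) powr (1 / r)"
      "0 \<le> cK * (star_vol + 1) * c2 powr (1 / r) / (1 - 2 powr (- \<delta>))"
    using c1_pos cK star_vol_pos \<delta>_geom by auto
  thus "c1 \<le> cs" unfolding cs_def by linarith
  thus "0 < cs" using c1_pos by linarith
qed

lemma emeasure_dcube_Suc: "vol (dcube k (x::'a)) = 2 ^ DIM('a) * vol (dcube (Suc k) x)"
proof -
  have "side k ^ DIM('a) = 2 ^ DIM('a) * side (Suc k) ^ DIM('a)"
    by (simp add: side_Suc flip: power_mult_distrib)
  hence "ennreal (side k ^ DIM('a)) = ennreal (2 ^ DIM('a)) * ennreal (side (Suc k) ^ DIM('a))"
    by (simp flip: ennreal_mult)
  thus ?thesis by (simp add: emeasure_dcube ennreal_power[symmetric])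
qed

text \<open>The point \<open>x'\<close> at which the operator is compared lies outside both exceptional sets; it exists because
  the parent of \<open>dcube j x\<close> is not bad.\<close>
lemma op_step:
  assumes kj: "k < j" and nb: "\<And>i. k < i \<Longrightarrow> i < j \<Longrightarrow> \<not> bad k i x"
  shows "S (cutoff (dstar k x) f) x \<le> S (cutoff (dstar j x) f) x + ennreal (cs * avg k x)"
proof -
  obtain m where m: "j = Suc m" using kj by (cases j) auto
  have km: "k \<le> m" using kj m by simp
  let ?s = "side j ^ DIM('a)"
  have avg_le: "avg i x powr r \<le> c2 * avg k x powr r" if i: "k \<le> i" "i < j" for i
  proof (cases "i = k")
    case True
    thus ?thesis using mult_right_mono[OF c2_ge_1, of "avg k x powr r"] by simp
  next
    case False
    hence "\<not> bad k i x" using i by (intro nb) auto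
    thus ?thesis by (simp add: bad_def)
  qed
  have avg_root: "a \<le> c powr (1 / r) * avg k x" if "a powr r \<le> c * avg k x powr r" "0 \<le> a" "0 \<le> c" for a c
  proof -
    have "(a powr r) powr (1 / r) \<le> (c * avg k x powr r) powr (1 / r)"
      using that r by (intro powr_mono2) auto
    thus ?thesis using that r by (simp add: powr_powr powr_mult)
  qed
  have avg_le': "avg i x \<le> c2 powr (1 / r) * avg k x" if "k \<le> i" "i < j" for i
    using avg_le[OF that] c2_ge_1 by (intro avg_root) auto
  \<comment> \<open>The cube of level \<open>j\<close> may itself be bad, so its average is bounded
    through its parent, at the cost \<open>2 ^ DIM('a)\<close> of the smaller volume.\<close>
  have avg_j: "avg j x \<le> (2 ^ DIM('a) * c2) powr (1 / r) * avg k x"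
  proof (rule avg_root)
    have "ennreal (avg j x powr r * ?s) \<le> ennreal (avg m x powr r * side m ^ DIM('a))"
      unfolding avg_eq[symmetric] using dstar_mono[of m j x] m
      by (intro nn_integral_mono) (auto simp: indicator_def)
    hence "avg j x powr r * ?s \<le> avg m x powr r * side m ^ DIM('a)" by simp
    also have "side m ^ DIM('a) = 2 ^ DIM('a) * ?s" by (simp add: m side_Suc flip: power_mult_distrib)
    finally have "avg j x powr r * ?s \<le> (2 ^ DIM('a) * avg m x powr r) * ?s" by (simp add: mult_ac)
    hence "avg j x powr r \<le> 2 ^ DIM('a) * avg m x powr r" by (rule mult_right_le_imp_le) simp
    also have "\<dots> \<le> 2 ^ DIM('a) * (c2 * avg k x powr r)"
      using avg_le[of m] km m by (intro mult_left_mono) auto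
    finally show "avg j x powr r \<le> 2 ^ DIM('a) * c2 * avg k x powr r" by (simp add: mult_ac)
  qed (use c2_ge_1 in auto)
  \<comment> \<open>This is where the value of \<open>\<eta>\<close> comes from: a proportion
    \<open>\<eta>\<close> of the parent is a quarter of the child.\<close>
  have q: "ennreal \<eta> * (2 ^ DIM('a) * vol (dcube j x)) = ennreal (1 / 4 * ?s)"
  proof -
    have "ennreal \<eta> * (ennreal (2 ^ DIM('a)) * ennreal ?s) = ennreal (\<eta> * (2 ^ DIM('a) * ?s))"
      using \<eta>_pos by (simp flip: ennreal_mult)
    also have "\<eta> * (2 ^ DIM('a) * ?s) = 1 / 4 * ?s" by (simp add: \<eta>_def power_add)
    finally show ?thesis by (simp add: emeasure_dcube ennreal_power[symmetric])
  qed
  have E1: "vol (dcube j x \<inter> exc k x) \<le> ennreal (1 / 4 * ?s)"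
  proof -
    have "vol (dcube j x \<inter> exc k x) \<le> vol (dcube m x \<inter> exc k x)"
      using dcube_mono[of m j x] m by (intro emeasure_mono) auto
    also have "\<dots> \<le> ennreal \<eta> * vol (dcube m x)"
    \<comment> \<open>The assumption concerns only levels strictly between \<open>k\<close> and
      \<open>j\<close>; at \<open>m = k\<close> the weak type bound takes its place.\<close>
    proof (cases "m = k")
      case True
      have "vol (dcube m x \<inter> exc k x) \<le> vol (exc k x)"
        by (intro emeasure_mono) auto
      also have "\<dots> \<le> ennreal \<epsilon> * vol (dcube k x)" by (rule emeasure_exc)
      also have "\<dots> \<le> ennreal \<eta> * vol (dcube k x)"
        using \<epsilon>_le by (intro mult_right_mono ennreal_leI) auto
      finally show ?thesis using True by simp
    next
      case False
      hence "\<not> bad k m x" using km m by (intro nb) auto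
      thus ?thesis by (simp add: bad_def dense_def not_less)
    qed
    also have "\<dots> = ennreal (1 / 4 * ?s)" using q by (simp add: emeasure_dcube_Suc[of m] m)
    finally show ?thesis .
  qed
  have E2: "vol (exc j x) \<le> ennreal (1 / 4 * ?s)"
  proof -
    have "\<eta> \<le> 1 / 4" using one_le_power[of "2::real" "DIM('a)"] by (simp add: \<eta>_def power_add field_simps del: one_le_power)
    hence "\<epsilon> \<le> 1 / 4" using \<epsilon>_le by linarith
    have "vol (exc j x) \<le> ennreal \<epsilon> * vol (dcube j x)" by (rule emeasure_exc)
    also have "\<dots> \<le> ennreal (1 / 4) * vol (dcube j x)"
      using \<open>\<epsilon> \<le> 1 / 4\<close> by (intro mult_right_mono ennreal_leI) auto
    also have "\<dots> = ennreal (1 / 4 * ?s)" unfolding emeasure_dcube by (intro ennreal_mult[symmetric]) auto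
    finally show ?thesis .
  qed
  \<comment> \<open>Two sets that each take at most a quarter cannot fill the cube.\<close>
  have "\<exists>x'\<in>dcube j x. x' \<notin> exc k x \<and> x' \<notin> exc j x"
  proof (rule ccontr)
    assume "\<not> ?thesis"
    hence "vol (dcube j x) \<le> vol ((dcube j x \<inter> exc k x) \<union> exc j x)"
      by (intro emeasure_mono) auto
    also have "\<dots> \<le> vol (dcube j x \<inter> exc k x) + vol (exc j x)"
      by (intro emeasure_subadditive) auto
    also have "\<dots> \<le> ennreal (1 / 4 * ?s) + ennreal (1 / 4 * ?s)" by (intro add_mono E1 E2)
    also have "\<dots> = ennreal (1 / 4 * ?s + 1 / 4 * ?s)" by (intro ennreal_plus[symmetric]) auto
    finally have "?s \<le> 1 / 4 * ?s + 1 / 4 * ?s" by (simp add: emeasure_dcube)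
    moreover have "0 < ?s" by simp
    ultimately show False by linarith
  qed
  then obtain x' where x': "x' \<in> dcube j x" "x' \<notin> exc k x" "x' \<notin> exc j x" by blast
  define osc where "osc = (\<Sum>i\<in>{k..<j}. cK * (star_vol + 1) * (2 powr (- \<delta>)) ^ (j - i) * avg i x)"
  have osc0: "0 \<le> osc" unfolding osc_def using cK star_vol_pos by (intro sum_nonneg) auto
  have osc: "osc \<le> cK * (star_vol + 1) * c2 powr (1 / r) / (1 - 2 powr (- \<delta>)) * avg k x"
  proof -
    have "osc \<le> (\<Sum>i\<in>{k..<j}. cK * (star_vol + 1) * (2 powr (- \<delta>)) ^ (j - i) * (c2 powr (1 / r) * avg k x))"
      unfolding osc_def using cK star_vol_pos avg_le' by (intro sum_mono mult_left_mono) auto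
    also have "\<dots> = cK * (star_vol + 1) * (c2 powr (1 / r) * avg k x) * (\<Sum>i\<in>{k..<j}. (2 powr (- \<delta>)) ^ (j - i))"
      by (simp add: sum_distrib_left mult_ac)
    also have "\<dots> \<le> cK * (star_vol + 1) * (c2 powr (1 / r) * avg k x) * (1 / (1 - 2 powr (- \<delta>)))"
      using cK star_vol_pos \<delta>_geom kj by (intro mult_left_mono geometric_le) auto
    finally show ?thesis by simp
  qed
  have n: "1 \<le> real DIM('a)" by (simp add: Suc_leI)
  have "S (cutoff (dstar k x - dstar j x) f) x \<le> S (cutoff (dstar k x - dstar j x) f) x'
      + (\<integral>\<^sup>+y\<in>dstar k x - dstar j x. ennreal (cK * norm (x - x') powr \<delta>
         / norm (x - y) powr (real DIM('a) + \<delta>) * norm (f y)) \<partial>lebesgue)"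
  proof (rule reg[OF fD, of _ "4 * real DIM('a) * side j"])
    have "norm (x - x') \<le> real DIM('a) * side j" using x' by (intro dist_dcube) auto
    moreover have "0 < real DIM('a) * side j" using n by (intro mult_pos_pos) auto
    ultimately show "2 * norm (x - x') < 4 * real DIM('a) * side j" by linarith
    show "4 * real DIM('a) * side j \<le> norm (x - y)" "4 * real DIM('a) * side j \<le> norm (x' - y)"
      if "y \<in> dstar k x - dstar j x" for y
      using that x' by (auto intro!: dist_not_dstar[where z=x])
  qed (use n in auto)
  also have "\<dots> \<le> S (cutoff (dstar k x - dstar j x) f) x' + ennreal osc"
    unfolding osc_def using x' kj by (intro add_left_mono osc_le) auto
  also have "S (cutoff (dstar k x - dstar j x) f) x' \<le> S (cutoff (dstar k x) f) x' + S (cutoff (dstar j x) f) x'"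
    using dstar_mono[of k j x] kj by (intro tri' fD) auto
  also have "S (cutoff (dstar k x) f) x' \<le> ennreal (c1 * avg k x)" using x' by (simp add: exc_def not_less)
  also have "S (cutoff (dstar j x) f) x' \<le> ennreal (c1 * avg j x)" using x' by (simp add: exc_def not_less)
  also have "ennreal (c1 * avg k x) + ennreal (c1 * avg j x) + ennreal osc
      = ennreal (c1 * avg k x + c1 * avg j x + osc)"
    using osc0 c1_pos by simp
  also have "\<dots> \<le> ennreal (cs * avg k x)"
  proof (intro ennreal_leI)
    have "c1 * avg j x \<le> c1 * ((2 ^ DIM('a) * c2) powr (1 / r) * avg k x)"
      using avg_j c1_pos by (intro mult_left_mono) auto
    thus "c1 * avg k x + c1 * avg j x + osc \<le> cs * avg k x"
      using osc by (simp add: cs_def algebra_simps)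
  qed
  finally have far: "S (cutoff (dstar k x - dstar j x) f) x \<le> ennreal (cs * avg k x)"
    by (simp add: add_mono)
  have "S (cutoff (dstar k x) f) x \<le> S (cutoff (dstar j x) f) x + S (cutoff (dstar k x - dstar j x) f) x"
    using dstar_mono[of k j x] kj by (intro tri fD) auto
  also have "\<dots> \<le> S (cutoff (dstar j x) f) x + ennreal (cs * avg k x)"
    using far by (intro add_left_mono)
  finally show ?thesis .
qed

text \<open>\<open>stop j x\<close> is the level of the smallest stopping cube that contains \<open>dcube j x\<close>.\<close>
primrec stop :: "nat \<Rightarrow> 'a \<Rightarrow> nat" where
  "stop 0 x = 0"
| "stop (Suc j) x = (if bad (stop j x) (Suc j) x then Suc j else stop j x)"

abbreviation sel :: "nat \<Rightarrow> 'a \<Rightarrow> bool" where "sel k x \<equiv> stop k x = k"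

section \<open>The chain of stopping cubes at a point\<close>

lemma stop_le: "stop j x \<le> j"
  by (induction j) (auto simp: le_Suc_eq)

lemma stop_cong: "corner j x = corner j y \<Longrightarrow> stop j x = stop j y"
proof (induction j)
  case (Suc j)
  hence "stop j x = stop j y" using corner_Suc_cong by blast
  thus ?case using bad_cong[of "stop j x" "Suc j" x y] Suc.prems stop_le[of j x] by auto
qed simp

lemma not_bad_between: "stop j x < i \<Longrightarrow> i \<le> j \<Longrightarrow> \<not> bad (stop j x) i x"
proof (induction j)
  case (Suc j)
  show ?case
  proof (cases "bad (stop j x) (Suc j) x")
    case False
    thus ?thesis using Suc by (cases "i = Suc j") auto
  qed (use Suc in auto)
qed simp

lemma not_sel_between: "stop j x < i \<Longrightarrow> i \<le> j \<Longrightarrow> \<not> sel i x"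
proof (induction j)
  case (Suc j)
  show ?case
  proof (cases "bad (stop j x) (Suc j) x")
    case False
    hence e: "stop (Suc j) x = stop j x" by simp
    show ?thesis
    proof (cases "i = Suc j")
      case True
      thus ?thesis using e stop_le[of j x] by simp
    qed (use Suc e in auto)
  qed (use Suc in auto)
qed simp

lemma sel_stop: "sel (stop j x) x"
  by (induction j) auto

text \<open>Iterates \<open>op_step\<close> along the stopping cubes that contain \<open>x\<close>.
  The sum omits the current one, whose operator term is still to be estimated.\<close>

lemma op_le_sum:
  "S (cutoff (dstar 0 x) f) x \<le> S (cutoff (dstar (stop j x) x) f) x + ennreal (cs * (\<Sum>k | k < stop j x \<and> sel k x. avg k x))"
proof (induction j)
  case (Suc j)
  show ?case
  proof (cases "bad (stop j x) (Suc j) x")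
    case True
    let ?k = "stop j x"
    have lt: "?k < Suc j" using stop_le[of j x] by simp
    have set: "{k. k < Suc j \<and> sel k x} = insert ?k {k. k < ?k \<and> sel k x}"
    proof (intro set_eqI iffI)
      fix k assume "k \<in> {k. k < Suc j \<and> sel k x}"
      thus "k \<in> insert ?k {k. k < ?k \<and> sel k x}" using not_sel_between[of j x k] by (cases k ?k rule: linorder_cases) auto
    next
      fix k assume "k \<in> insert ?k {k. k < ?k \<and> sel k x}"
      thus "k \<in> {k. k < Suc j \<and> sel k x}" using lt sel_stop by auto
    qed
    let ?s = "\<Sum>k | k < ?k \<and> sel k x. avg k x"
    have s0: "0 \<le> ?s" by (intro sum_nonneg) auto
    have "S (cutoff (dstar 0 x) f) x \<le> S (cutoff (dstar ?k x) f) x + ennreal (cs * ?s)" by (rule Suc)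
    also have "S (cutoff (dstar ?k x) f) x \<le> S (cutoff (dstar (Suc j) x) f) x + ennreal (cs * avg ?k x)"
      using lt not_bad_between[of j x] by (intro op_step) auto
    also have "S (cutoff (dstar (Suc j) x) f) x + ennreal (cs * avg ?k x) + ennreal (cs * ?s)
        = S (cutoff (dstar (Suc j) x) f) x + (ennreal (cs * avg ?k x) + ennreal (cs * ?s))" by (rule add.assoc)
    also have "ennreal (cs * avg ?k x) + ennreal (cs * ?s) = ennreal (cs * (\<Sum>k | k < Suc j \<and> sel k x. avg k x))"
      unfolding set using cs_pos s0 by (subst sum.insert) (auto simp: distrib_left)
    finally show ?thesis using True by (simp add: add_right_mono)
  qed (use Suc in auto)
qed simp


section \<open>The sparse family\<close>

definition fam :: "nat \<Rightarrow> (nat \<times> 'a) set" where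
  "fam N = {(k, c). k < N \<and> c \<in> corner k ` base \<and> sel k c}"

text \<open>For a stopping cube this is the part that no later stopping cube covers, the major
  subset of sparse families. All levels \<open>j\<close> are considered, so it does not depend on
  the truncation level \<open>N\<close>.\<close>

definition core :: "nat \<times> 'a \<Rightarrow> 'a set" where
  "core q = {y \<in> Q1 q. \<forall>j\<ge>fst q. stop j y = fst q}"

text \<open>Corners as indices make every cube occur once, and the truncation leaves finitely many
  levels. So \<open>Fsum\<close> is bounded, which later permits absorption.\<close>

lemma finite_fam: "finite (fam N)"
proof (rule finite_subset)
  show "fam N \<subseteq> (SIGMA k:{..<N}. corner k ` base)" by (auto simp: fam_def)
qed (intro finite_SigmaI finite_corners, simp)

lemma fam_corner: "q \<in> fam N \<Longrightarrow> corner (fst q) (snd q) = snd q"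
  by (auto simp: fam_def)

lemma fam_base: "q \<in> fam N \<Longrightarrow> Q1 q \<subseteq> base"
proof -
  assume "q \<in> fam N"
  then obtain z where "z \<in> base" "snd q = corner (fst q) z" by (auto simp: fam_def)
  thus ?thesis using dcube_subset_base[of z "fst q"] dcube_cong[of "fst q" "corner (fst q) z" z] by simp
qed

lemma stop_sets: "{y. stop j y = k} \<in> sets lebesgue"
proof -
  have "{y. stop j y = k} = (\<Union>(i, y)\<in>{(i, y). i = j \<and> stop j y = k}. dcube i y)"
  proof (intro set_eqI iffI)
    fix x assume "x \<in> (\<Union>(i, y)\<in>{(i, y). i = j \<and> stop j y = k}. dcube i y)"
    then obtain y where "stop j y = k" "corner j x = corner j y" by (auto simp: dcube_def)
    thus "x \<in> {y. stop j y = k}" using stop_cong[of j x y] by simp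
  next
    fix x assume "x \<in> {y. stop j y = k}"
    hence "(j, x) \<in> {(i, y). i = j \<and> stop j y = k}" by simp
    thus "x \<in> (\<Union>(i, y)\<in>{(i, y). i = j \<and> stop j y = k}. dcube i y)"
      using dcube_self by blast
  qed
  thus ?thesis by (simp only: sets_UN_dcube)
qed

lemma core_sets [measurable]: "core q \<in> sets lebesgue"
proof -
  have "core q = Q1 q \<inter> (\<Inter>j\<in>{fst q..}. {y. stop j y = fst q})" by (auto simp: core_def)
  thus ?thesis using stop_sets by (auto intro!: sets.Int sets.countable_INT'')
qed

lemma core_subset: "core q \<subseteq> Q1 q" by (auto simp: core_def)

text \<open>At a point of both cores the stopping level is eventually constant, so the two cubes
  have the same level and hence the same corner.\<close>

lemma core_disjoint: "disjoint_family_on core (fam N)"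
  unfolding disjoint_family_on_def
proof (intro ballI impI)
  fix q q' assume q: "q \<in> fam N" "q' \<in> fam N" "q \<noteq> q'"
  show "core q \<inter> core q' = {}"
  proof (rule ccontr)
    assume "core q \<inter> core q' \<noteq> {}"
    then obtain y where y: "y \<in> core q" "y \<in> core q'" by blast
    have "stop (max (fst q) (fst q')) y = fst q" "stop (max (fst q) (fst q')) y = fst q'"
      using y unfolding core_def by (blast intro: max.cobounded1 max.cobounded2)+
    hence k: "fst q = fst q'" by metis
    have "corner (fst q) y = snd q" "corner (fst q') y = snd q'"
      using y fam_corner[OF q(1)] fam_corner[OF q(2)] by (auto simp: core_def dcube_def)
    hence "q = q'" using k by (simp add: prod_eq_iff)
    thus False using q by simp
  qed
qed

text \<open>The stopping level of a point changes only when a bad subcube is met, so what the core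
  misses lies in bad subcubes. These take at most half of the cube by
  \<open>emeasure_bad\<close>.\<close>

lemma emeasure_core: "q \<in> fam N \<Longrightarrow> vol (Q1 q) \<le> 2 * vol (core q)"
proof -
  assume q: "q \<in> fam N"
  define k c where "k = fst q" and "c = snd q"
  let ?W = "\<Union>(j, y)\<in>{(j, y). y \<in> dcube k c \<and> k < j \<and> bad k j y}. dcube j y"
  have sel: "sel k c" using q by (auto simp: fam_def k_def c_def)
  have "dcube k c \<subseteq> core q \<union> ?W"
  proof
    fix y assume y: "y \<in> dcube k c"
    hence sy: "stop k y = k" using sel stop_cong[of k y c] by (simp add: dcube_def)
    show "y \<in> core q \<union> ?W"
    proof (rule ccontr)
      assume *: "y \<notin> core q \<union> ?W"
      have "stop j y = k" if "k \<le> j" for j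
        using that
      proof (induction j rule: dec_induct)
        case (step j)
        have "\<not> bad k (Suc j) y"
        proof
          assume "bad k (Suc j) y"
          hence "(Suc j, y) \<in> {(j, y). y \<in> dcube k c \<and> k < j \<and> bad k j y}" using y step by simp
          hence "y \<in> ?W" using dcube_self by blast
          thus False using * by simp
        qed
        thus ?case using step by simp
      qed (rule sy)
      hence "y \<in> core q" using y by (simp add: core_def k_def c_def)
      thus False using * by simp
    qed
  qed
  hence "vol (dcube k c) \<le> vol (core q \<union> ?W)"
    by (intro emeasure_mono sets.Un core_sets sets_UN_dcube)
  also have "\<dots> \<le> vol (core q) + vol ?W"
    by (intro emeasure_subadditive core_sets sets_UN_dcube)
  also have "\<dots> \<le> vol (core q) + ennreal (1 / 2) * vol (dcube k c)"
    by (intro add_left_mono emeasure_bad)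
  also have "ennreal (1 / 2) * vol (dcube k c) = ennreal (side k ^ DIM('a) / 2)"
    unfolding emeasure_dcube by (subst ennreal_mult[symmetric]) auto
  finally have "ennreal (side k ^ DIM('a)) \<le> ennreal (1 / 2 * side k ^ DIM('a)) + vol (core q)"
    by (simp add: emeasure_dcube add.commute)
  hence "ennreal (side k ^ DIM('a)) \<le> ennreal (1 / (1 - 1 / 2)) * vol (core q)"
    by (intro ennreal_absorb) auto
  thus ?thesis by (simp add: emeasure_dcube k_def c_def)
qed

lemma emeasure_base_finite: "vol (base :: 'a set) < \<infinity>"
  by (simp add: base_def emeasure_dcube)

lemma base_sets [measurable]: "(base :: 'a set) \<in> sets lebesgue"
  by (simp add: base_def)

lemma sum_fam_le: "(\<Sum>q\<in>fam N. vol (Q1 q)) \<le> 2 * vol (base :: 'a set)"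
proof -
  have "(\<Sum>q\<in>fam N. vol (Q1 q)) \<le> (\<Sum>q\<in>fam N. 2 * vol (core q))"
    by (intro sum_mono emeasure_core)
  also have "\<dots> = 2 * vol (\<Union>q\<in>fam N. core q)"
    unfolding sum_distrib_left[symmetric]
    using finite_fam core_disjoint by (subst sum_emeasure) auto
  also have "\<dots> \<le> 2 * vol (base :: 'a set)"
    using core_subset fam_base by (intro mult_left_mono emeasure_mono) (auto, blast)
  finally show ?thesis .
qed

lemma sum_fam_eq:
  fixes g :: "nat \<times> 'a \<Rightarrow> 'b::comm_monoid_add"
  assumes x: "x \<in> base"
  shows "(\<Sum>q\<in>fam N. if x \<in> Q1 q then g q else 0) = (\<Sum>k | k < N \<and> sel k x. g (k, corner k x))"
proof -
  have "{q \<in> fam N. x \<in> Q1 q} = (\<lambda>k. (k, corner k x)) ` {k. k < N \<and> sel k x}"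
  proof (intro set_eqI iffI)
    fix q assume q: "q \<in> {q \<in> fam N. x \<in> Q1 q}"
    hence "corner (fst q) x = snd q" using fam_corner[of q N] by (auto simp: dcube_def)
    moreover have "sel (fst q) x" using q stop_cong[of "fst q" x "snd q"] by (auto simp: fam_def dcube_def)
    ultimately show "q \<in> (\<lambda>k. (k, corner k x)) ` {k. k < N \<and> sel k x}"
      using q by (intro image_eqI[of _ _ "fst q"]) (auto simp: fam_def prod_eq_iff)
  next
    fix q assume "q \<in> (\<lambda>k. (k, corner k x)) ` {k. k < N \<and> sel k x}"
    then obtain k where k: "k < N" "sel k x" "q = (k, corner k x)" by blast
    have "stop k (corner k x) = stop k x" by (rule stop_cong) simp
    thus "q \<in> {q \<in> fam N. x \<in> Q1 q}" using k x by (auto simp: fam_def dcube_def)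
  qed
  hence "(\<Sum>q\<in>fam N. if x \<in> Q1 q then g q else 0)
      = (\<Sum>q\<in>(\<lambda>k. (k, corner k x)) ` {k. k < N \<and> sel k x}. g q)"
    using finite_fam by (simp flip: sum.inter_filter)
  also have "\<dots> = (\<Sum>k | k < N \<and> sel k x. g (k, corner k x))"
    by (subst sum.reindex) (auto simp: inj_on_def)
  finally show ?thesis .
qed

text \<open>Borel-Cantelli: sparsity bounds the sum over \<open>k\<close> of the measures of the
  sets where \<open>k\<close> is a stopping level by \<open>2 * vol base\<close>.\<close>

lemma AE_finite_sel: "AE x in lebesgue. x \<in> base \<longrightarrow> finite {k. sel k x}"
proof -
  define A where "A k = {x \<in> base. sel k x}" for k
  have Am [measurable]: "A k \<in> sets lebesgue" for k
  proof -
    have "A k = base \<inter> {x. stop k x = k}" by (auto simp: A_def)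
    thus ?thesis using stop_sets by auto
  qed
  have Afin: "vol (A k) < \<infinity>" for k
    by (rule le_less_trans[OF emeasure_mono emeasure_base_finite]) (auto simp: A_def)
  have sum: "(\<Sum>k<N. vol (A k)) \<le> 2 * vol (base :: 'a set)" for N
  proof -
    have "(\<Sum>k<N. vol (A k)) = (\<Sum>k<N. (\<integral>\<^sup>+x. indicator (A k) x \<partial>lebesgue))" by simp
    also have "\<dots> = (\<integral>\<^sup>+x. (\<Sum>k<N. indicator (A k) x) \<partial>lebesgue)"
      by (rule nn_integral_sum[symmetric]) auto
    also have "\<dots> \<le> (\<integral>\<^sup>+x. (\<Sum>q\<in>fam N. indicator (Q1 q) x) \<partial>lebesgue)"
    proof (intro nn_integral_mono)
      fix x
      show "(\<Sum>k<N. indicator (A k) x) \<le> (\<Sum>q\<in>fam N. indicator (Q1 q) x :: ennreal)"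
      proof (cases "x \<in> base")
        case True
        have "(\<Sum>k<N. indicator (A k) x) = (\<Sum>k<N. if sel k x then 1 else 0 :: ennreal)"
          using True by (intro sum.cong) (auto simp: A_def indicator_def)
        also have "\<dots> = (\<Sum>k | k < N \<and> sel k x. 1)"
          by (subst sum.inter_filter[symmetric]) auto
        also have "\<dots> = (\<Sum>q\<in>fam N. if x \<in> Q1 q then 1 else 0)"
          by (rule sum_fam_eq[OF True, symmetric])
        also have "\<dots> = (\<Sum>q\<in>fam N. indicator (Q1 q) x)"
          by (intro sum.cong) (auto simp: indicator_def)
        finally show ?thesis by simp
      qed (simp add: A_def)
    qed
    also have "\<dots> = (\<Sum>q\<in>fam N. vol (Q1 q))"
      by (subst nn_integral_sum) auto
    also have "\<dots> \<le> 2 * vol (base :: 'a set)" by (rule sum_fam_le)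
    finally show ?thesis .
  qed
  have "summable (\<lambda>k. measure lebesgue (A k))"
  proof (rule summableI_nonneg_bounded)
    fix N
    have "ennreal (\<Sum>k<N. measure lebesgue (A k)) = (\<Sum>k<N. vol (A k))"
    proof -
      have "ennreal (measure lebesgue (A k)) = vol (A k)" for k
        using Afin[of k] by (intro emeasure_eq_ennreal_measure[symmetric]) (metis less_irrefl infinity_ennreal_def)
      thus ?thesis by (simp only: sum_ennreal[symmetric] measure_nonneg)
    qed
    also have "\<dots> \<le> 2 * vol (base :: 'a set)" by (rule sum)
    also have "\<dots> = ennreal (2 * measure lebesgue (base :: 'a set))"
      using emeasure_base_finite by (simp add: ennreal_mult emeasure_eq_ennreal_measure less_top)
    finally show "(\<Sum>k<N. measure lebesgue (A k)) \<le> 2 * measure lebesgue (base :: 'a set)" by simp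
  qed simp
  from borel_cantelli_AE1[OF Am Afin this] show ?thesis
  proof eventually_elim
    case (elim x)
    show ?case
    proof
      assume x: "x \<in> base"
      obtain N where "\<And>n. N \<le> n \<Longrightarrow> x \<notin> A n" using elim by (auto simp: eventually_sequentially)
      hence "{k. sel k x} \<subseteq> {..<N}" using x by (force simp: A_def not_less[symmetric])
      thus "finite {k. sel k x}" by (rule finite_subset) simp
    qed
  qed
qed

text \<open>The null set must serve all cubes at once, which is possible as \<open>base\<close>
  contains finitely many cubes of each of countably many levels.\<close>

lemma AE_dense: "AE x in lebesgue. \<forall>k. x \<in> base \<longrightarrow> x \<in> exc k x \<longrightarrow> (\<exists>j>k. dense k j x)"
proof -
  have "AE x in lebesgue. \<forall>c\<in>corner k ` base. x \<in> exc k c \<longrightarrow>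
      (\<exists>j>k. ennreal \<eta> * vol (dcube j x) < vol (dcube j x \<inter> exc k c))" for k
    using \<eta>_pos \<eta>_less_1 by (intro AE_finite_allI finite_corners dyadic_density) auto
  hence "AE x in lebesgue. \<forall>k. \<forall>c\<in>corner k ` base. x \<in> exc k c \<longrightarrow>
      (\<exists>j>k. ennreal \<eta> * vol (dcube j x) < vol (dcube j x \<inter> exc k c))"
    by (simp only: AE_all_countable) blast
  thus ?thesis
  proof eventually_elim
    case (elim x)
    show ?case
    proof (intro allI impI)
      fix k assume x: "x \<in> base" "x \<in> exc k x"
      have "exc k (corner k x) = exc k x" by (rule exc_cong) simp
      thus "\<exists>j>k. dense k j x" using elim[rule_format, of "corner k x" k] x by (simp add: dense_def)
    qed
  qed
qed

definition Fsum :: "nat \<Rightarrow> 'a \<Rightarrow> real" where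
  "Fsum N x = (\<Sum>q\<in>fam N. avg (fst q) (snd q) * indicator (Q1 q) x)"

lemma Fsum_eq: "x \<in> base \<Longrightarrow> Fsum N x = (\<Sum>k | k < N \<and> sel k x. avg k x)"
proof -
  assume x: "x \<in> base"
  have "Fsum N x = (\<Sum>q\<in>fam N. if x \<in> Q1 q then avg (fst q) (snd q) else 0)"
    unfolding Fsum_def by (intro sum.cong) (auto simp: indicator_def)
  also have "\<dots> = (\<Sum>k | k < N \<and> sel k x. avg k (corner k x))"
    using sum_fam_eq[OF x, where g = "\<lambda>q. avg (fst q) (snd q)" and N = N] by simp
  also have "\<dots> = (\<Sum>k | k < N \<and> sel k x. avg k x)" by (intro sum.cong refl avg_cong) simp
  finally show ?thesis .
qed

text \<open>Almost every point has a last stopping level \<open>m\<close>. No cube around the point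
  is dense after it, so the point lies outside \<open>exc m x\<close>, and the remaining operator
  term is at most \<open>c1 * avg m x\<close>. The truncation level depends on the point.\<close>

lemma sparse_domination:
  "AE x in lebesgue. x \<in> base \<longrightarrow> (\<exists>N. S (cutoff (dstar 0 0) f) x \<le> ennreal (cs * Fsum N x))"
  using AE_finite_sel AE_dense
proof eventually_elim
  case (elim x)
  show ?case
  proof
    assume x: "x \<in> base"
    hence star: "dstar 0 x = dstar 0 0" by (intro dstar_cong) (simp add: base_def dcube_def)
    have fin: "finite {k. sel k x}" using elim x by blast
    define m where "m = Max {k. sel k x}"
    have ne: "{k. sel k x} \<noteq> {}" using stop.simps(1)[of x] by blast
    have m: "sel m x" using Max_in[OF fin ne] by (simp add: m_def)
    have stop: "stop j x = m" if j: "m \<le> j" for j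
    proof -
      have "stop j x \<le> m" unfolding m_def using sel_stop[of j x] fin by (intro Max_ge) auto
      moreover have "\<not> stop j x < m" using not_sel_between[of j x m] m j by blast
      ultimately show ?thesis by simp
    qed
    have "\<not> dense m j x" if "m < j" for j
      using not_bad_between[of j x j] stop[of j] that by (auto simp: bad_def)
    hence "x \<notin> exc m x" using elim x by blast
    hence *: "S (cutoff (dstar m x) f) x \<le> ennreal (c1 * avg m x)" by (simp add: exc_def not_less)
    let ?s = "\<Sum>k | k < m \<and> sel k x. avg k x"
    have s0: "0 \<le> ?s" by (intro sum_nonneg) auto
    \<comment> \<open>The family keeps levels strictly below its bound, so \<open>Suc m\<close> is
      required to count the last stopping cube.\<close>
    have set: "{k. k < Suc m \<and> sel k x} = insert m {k. k < m \<and> sel k x}" using m by auto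
    have "S (cutoff (dstar 0 x) f) x \<le> S (cutoff (dstar m x) f) x + ennreal (cs * ?s)"
      using op_le_sum[of x m] m by simp
    also have "\<dots> \<le> ennreal (cs * avg m x) + ennreal (cs * ?s)"
      using c1_le_cs by (intro add_right_mono order.trans[OF *] ennreal_leI mult_right_mono) auto
    also have "\<dots> = ennreal (cs * Fsum (Suc m) x)"
      unfolding Fsum_eq[OF x] set using cs_pos s0 by (subst sum.insert) (auto simp: distrib_left)
    finally show "\<exists>N. S (cutoff (dstar 0 0) f) x \<le> ennreal (cs * Fsum N x)" unfolding star by blast
  qed
qed

end

section \<open>The bump estimate\<close>

text \<open>Only the values of \<open>A\<close> on the half-line are controlled; composing with
  \<open>max 0\<close> extends them continuously.\<close>

lemma young_measurable:
  assumes A: "young A" and [measurable]: "g \<in> borel_measurable M" and g0: "\<And>x. 0 \<le> g x"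
  shows "(\<lambda>x. A (g x)) \<in> borel_measurable M"
proof -
  have "continuous_on UNIV (\<lambda>t::real. A (max 0 t))"
  proof (rule continuous_on_compose2[where g = A and f = "max 0"])
    show "continuous_on {0..} A" using A by (simp add: young_def)
    show "continuous_on UNIV (max (0::real))" by (intro continuous_intros)
  qed auto
  hence [measurable]: "(\<lambda>t::real. A (max 0 t)) \<in> borel_measurable borel"
    by (rule borel_measurable_continuous_onI)
  have "(\<lambda>x. A (max 0 (g x))) \<in> borel_measurable M"
    by (rule measurable_compose[where g = "\<lambda>t. A (max 0 t)"]) measurable
  moreover have "(\<lambda>x. A (max 0 (g x))) = (\<lambda>x. A (g x))" using g0 by (simp add: max_def)
  ultimately show ?thesis by simp
qed

text \<open>Young's inequality at the normalised arguments, integrated. For \<open>c\<close> the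
  volume of \<open>Q\<close> this is the generalised Hoelder inequality with factor 2, stated for
  admissible constants instead of norms.\<close>

lemma orlicz_holder:
  assumes A: "young A" and [measurable]: "w \<in> borel_measurable M" "g \<in> borel_measurable M" "Q \<in> sets M"
    and w0: "\<And>x. 0 \<le> w x" and g0: "\<And>x. 0 \<le> g x" and l: "0 < l" and m: "0 < m"
    and wl: "(\<integral>\<^sup>+x\<in>Q. ennreal (A (w x / l)) \<partial>M) \<le> c"
    and gm: "(\<integral>\<^sup>+x\<in>Q. complementary A (g x / m) \<partial>M) \<le> c"
  shows "(\<integral>\<^sup>+x\<in>Q. ennreal (g x * w x) \<partial>M) \<le> ennreal (l * m) * (2 * c)"
proof -
  have [measurable]: "(\<lambda>x. A (w x / l)) \<in> borel_measurable M"
    by (rule young_measurable[OF A, where g = "\<lambda>x. w x / l"]) (measurable, simp add: w0 l less_imp_le)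
  have [measurable]: "(\<lambda>x. complementary A (g x / m)) \<in> borel_measurable M"
    by (rule measurable_compose[OF _ mono_borel_measurable_ennreal[OF mono_complementary]]) simp
  have "(\<integral>\<^sup>+x\<in>Q. ennreal (g x * w x) \<partial>M)
    \<le> (\<integral>\<^sup>+x. ennreal (l * m) * (ennreal (A (w x / l)) * indicator Q x + complementary A (g x / m) * indicator Q x) \<partial>M)"
  proof (intro nn_integral_mono)
    fix x
    have "ennreal (g x * w x) = ennreal (l * m) * ennreal (w x / l * (g x / m))"
      using l m w0 g0 by (simp flip: ennreal_mult)
    also have "\<dots> \<le> ennreal (l * m) * (ennreal (A (w x / l)) + complementary A (g x / m))"
      using l m w0 g0 by (intro mult_left_mono young_ineq A) auto
    finally show "ennreal (g x * w x) * indicator Q x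
      \<le> ennreal (l * m) * (ennreal (A (w x / l)) * indicator Q x + complementary A (g x / m) * indicator Q x)"
      by (auto simp: indicator_def)
  qed
  also have "\<dots> = ennreal (l * m) * ((\<integral>\<^sup>+x\<in>Q. ennreal (A (w x / l)) \<partial>M) + (\<integral>\<^sup>+x\<in>Q. complementary A (g x / m) \<partial>M))"
    by (subst nn_integral_cmult, measurable, subst nn_integral_add, measurable)
  also have "\<dots> \<le> ennreal (l * m) * (c + c)" by (intro mult_left_mono add_mono wl gm) auto
  finally show ?thesis by (simp add: mult_2)
qed

text \<open>Inserts \<open>v y powr (r / p) * v y powr (- r / p)\<close>, which is 1 where
  \<open>v\<close> is positive, so that the bump on \<open>v\<close> controls the second
  factor.\<close>

lemma power_integral_le_orlicz:
  fixes f :: "'a \<Rightarrow> complex" and v :: "'a \<Rightarrow> real"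
  assumes B: "young B" and [measurable]: "f \<in> borel_measurable M" "v \<in> borel_measurable M" "Q \<in> sets M"
    and v0: "AE x in M. 0 < v x" and l: "0 < l" and m: "0 < m"
    and vl: "(\<integral>\<^sup>+y\<in>Q. ennreal (B (\<bar>v y powr (- r / p)\<bar> / l)) \<partial>M) \<le> c"
    and fm: "(\<integral>\<^sup>+y\<in>Q. complementary B (norm (f y) powr r * v y powr (r / p) / m) \<partial>M) \<le> c"
  shows "(\<integral>\<^sup>+y\<in>Q. ennreal (norm (f y) powr r) \<partial>M) \<le> ennreal (l * m) * (2 * c)"
proof -
  have "(\<integral>\<^sup>+y\<in>Q. ennreal (norm (f y) powr r) \<partial>M)
      = (\<integral>\<^sup>+y\<in>Q. ennreal ((norm (f y) powr r * v y powr (r / p)) * v y powr (- r / p)) \<partial>M)"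
  proof (rule nn_integral_cong_AE)
    show "AE y in M. ennreal (norm (f y) powr r) * indicator Q y
      = ennreal ((norm (f y) powr r * v y powr (r / p)) * v y powr (- r / p)) * indicator Q y"
      using v0
    proof eventually_elim
      case (elim y)
      have "v y powr (r / p) * v y powr (- r / p) = v y powr (r / p + - r / p)" by (simp only: powr_add)
      also have "\<dots> = 1" using elim by simp
      finally show ?case by (simp add: mult.assoc)
    qed
  qed
  also have "\<dots> \<le> ennreal (l * m) * (2 * c)"
    by (rule orlicz_holder[OF B]) (use l m vl fm in auto)
  finally show ?thesis .
qed

lemma conjugate_exponent:
  fixes p p' :: real
  assumes p: "1 < p" and q: "1 / p + 1 / p' = 1"
  shows "p' = p / (p - 1)"
proof -
  have p': "p' \<noteq> 0" using p q by auto
  hence "p' + p = p * p'" using p q by (simp add: add_divide_eq_iff divide_add_eq_iff mult.commute)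
  hence "p' * (p - 1) = p" by (simp add: algebra_simps)
  thus ?thesis using p by (simp add: eq_divide_eq)
qed

text \<open>Young's product inequality without the factors \<open>1 / p\<close> and
  \<open>1 / p'\<close>; it then follows from comparing \<open>b\<close> with
  \<open>a powr (p - 1)\<close>.\<close>

lemma mult_le_powr_add:
  fixes a b :: real
  assumes a: "0 \<le> a" and b: "0 \<le> b" and p: "1 < p" and q: "1 / p + 1 / p' = 1"
  shows "a * b \<le> a powr p + b powr p'"
proof -
  have p': "p' = p / (p - 1)" by (rule conjugate_exponent[OF p q])
  show ?thesis
  proof (cases "b \<le> a powr (p - 1)")
    case True
    have "a * b \<le> a * a powr (p - 1)" using True a by (intro mult_left_mono)
    also have "\<dots> = a powr p" using a powr_add[of a 1 "p - 1"] by simp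
    finally show ?thesis by (simp add: add_increasing2)
  next
    case False
    hence b0: "0 < b" using powr_ge_zero[of a "p - 1"] by linarith
    have "(a powr (p - 1)) powr (1 / (p - 1)) \<le> b powr (1 / (p - 1))"
      using False p by (intro powr_mono2) auto
    hence "a \<le> b powr (1 / (p - 1))" using a p by (simp add: powr_powr)
    hence "a * b \<le> b powr (1 / (p - 1)) * b powr 1" using b by (simp add: mult_right_mono)
    also have "\<dots> = b powr (1 / (p - 1) + 1)" by (simp only: powr_add)
    also have "1 / (p - 1) + 1 = p'" using p p' by (simp add: field_simps)
    finally show ?thesis by (simp add: add_increasing)
  qed
qed

definition carleson_const :: "real \<Rightarrow> real \<Rightarrow> real \<Rightarrow> real" where
  "carleson_const cv \<rho> J = 2 powr \<rho> * (cv * 2) * 2 powr \<bar>\<rho> + 1\<bar> * J"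

text \<open>Linear in \<open>V\<close>, so the value at \<open>V = 1\<close> yields a constant
  independent of \<open>f\<close>. The power of \<open>2 * K\<^sub>0 * K\<^sub>2 + 1\<close> is the
  price of the absorption.\<close>

definition bump_const :: "real \<Rightarrow> real \<Rightarrow> real \<Rightarrow> real \<Rightarrow> real \<Rightarrow> real \<Rightarrow> real" where
  "bump_const p p' K\<^sub>0 K\<^sub>1 K\<^sub>2 V = 2 * K\<^sub>0 * K\<^sub>1 * (2 * K\<^sub>0 * K\<^sub>2 + 1) powr (p / p') * V"

section \<open>The weighted bound for sparse sums\<close>

context local_op
begin

lemma Fsum_nonneg: "0 \<le> Fsum N x"
  unfolding Fsum_def by (intro sum_nonneg) auto

lemma Fsum_measurable [measurable]: "Fsum N \<in> borel_measurable lebesgue"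
  unfolding Fsum_def by measurable

lemma avg_le_orlicz:
  assumes B: "young B" and v [measurable]: "v \<in> borel_measurable lebesgue" and v0: "AE x in lebesgue. 0 < v x"
    and l: "0 < l" and m: "0 < m"
    and vl: "lux B (dstar k x) (\<lambda>y. v y powr (- r / p)) l"
    and fm: "(\<integral>\<^sup>+y\<in>dstar k x. complementary B (norm (f y) powr r * v y powr (r / p) / m) \<partial>lebesgue)
      \<le> vol (dstar k x)"
  shows "avg k x \<le> (2 * star_vol * (l * m)) powr (1 / r)"
proof -
  have "(\<integral>\<^sup>+y\<in>dstar k x. ennreal (norm (f y) powr r) \<partial>lebesgue)
      \<le> ennreal (l * m) * (2 * vol (dstar k x))"
    using assms by (intro power_integral_le_orlicz) auto
  also have "\<dots> = ennreal (l * m) * (ennreal 2 * ennreal (star_vol * side k ^ DIM('a)))"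
    by (simp add: emeasure_dstar star_vol_def)
  also have "\<dots> = ennreal (2 * star_vol * (l * m) * side k ^ DIM('a))"
    using l m star_vol_pos by (simp add: ennreal_mult[symmetric] mult_ac del: ennreal_numeral)
  finally have "ennreal (avg k x powr r * side k ^ DIM('a)) \<le> \<dots>" unfolding avg_eq .
  hence "avg k x powr r * side k ^ DIM('a) \<le> 2 * star_vol * (l * m) * side k ^ DIM('a)"
    using l m star_vol_pos by (subst (asm) ennreal_le_iff) auto
  hence "avg k x powr r \<le> 2 * star_vol * (l * m)" by (rule mult_right_le_imp_le) simp
  hence "(avg k x powr r) powr (1 / r) \<le> (2 * star_vol * (l * m)) powr (1 / r)"
    using r by (intro powr_mono2) auto
  thus ?thesis using r by (simp add: powr_powr)
qed

lemma vol_core: "vol (core q) = ennreal (measure lebesgue (core q))"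
proof (rule emeasure_eq_ennreal_measure)
  have "vol (core q) \<le> vol (Q1 q)" using core_subset by (intro emeasure_mono) auto
  thus "vol (core q) \<noteq> top" by (auto simp: emeasure_dcube top_unique)
qed

lemma carleson_fam:
  fixes h :: "'a \<Rightarrow> real"
  assumes \<xi>: "0 < \<xi>" "complementary A \<xi> \<le> ennreal (1 / 2)" "Bint \<rho> (complementary A) \<xi> = ennreal J" "0 \<le> J"
    and h: "h \<in> borel_measurable lebesgue" "\<And>x. 0 \<le> h x"
    and H: "(\<integral>\<^sup>+x. ennreal (h x powr \<rho>) \<partial>lebesgue) = ennreal H" "0 \<le> H" and \<tau>: "0 < \<tau>" and \<rho>: "0 < \<rho>"
  obtains m where "\<And>q. q \<in> fam N \<Longrightarrow> 0 < m q"
    "\<And>q. q \<in> fam N \<Longrightarrow> (\<integral>\<^sup>+x\<in>Q2 q. complementary A (h x / m q) \<partial>lebesgue) \<le> vol (Q2 q)"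
    "(\<Sum>q\<in>fam N. m q powr \<rho> * measure lebesgue (core q))
      \<le> \<tau> powr \<rho> * measure lebesgue (base :: 'a set) + carleson_const cv \<rho> J * H"
proof -
  have sub: "core q \<subseteq> base" if "q \<in> fam N" for q using core_subset fam_base[OF that] by blast
  obtain m where m: "\<And>q. q \<in> fam N \<Longrightarrow> 0 < m q"
    "\<And>q. q \<in> fam N \<Longrightarrow> (\<integral>\<^sup>+x\<in>Q2 q. complementary A (h x / m q) \<partial>lebesgue) \<le> vol (Q2 q)"
    "(\<Sum>q\<in>fam N. ennreal (m q powr \<rho>) * vol (core q))
      \<le> ennreal (\<tau> powr \<rho>) * vol (base :: 'a set)
        + ennreal (2 powr \<rho> * (cov TYPE('a) * 2) * 2 powr \<bar>\<rho> + 1\<bar>) * Bint \<rho> (complementary A) \<xi>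
          * (\<integral>\<^sup>+x. ennreal (h x powr \<rho>) \<partial>lebesgue)"
    by (rule carleson[where h = h and E = core and S = "fam N" and \<tau> = \<tau> and \<rho> = \<rho>
          and D = "complementary A" and \<epsilon> = \<xi>])
       (use mono_complementary \<xi> h H finite_fam core_subset sub core_disjoint \<tau> \<rho> in auto)
  have b: "vol (base :: 'a set) = ennreal (measure lebesgue (base :: 'a set))"
    using emeasure_base_finite by (intro emeasure_eq_ennreal_measure) (metis less_irrefl infinity_ennreal_def)
  have K: "0 \<le> carleson_const cv \<rho> J" using \<xi>(4) cv_ge_1 by (simp add: carleson_const_def)
  have "ennreal (\<Sum>q\<in>fam N. m q powr \<rho> * measure lebesgue (core q))
      = (\<Sum>q\<in>fam N. ennreal (m q powr \<rho>) * vol (core q))"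
    unfolding vol_core by (simp add: ennreal_mult flip: sum_ennreal)
  also note m(3)
  also have "ennreal (\<tau> powr \<rho>) * vol (base :: 'a set)
        + ennreal (2 powr \<rho> * (cov TYPE('a) * 2) * 2 powr \<bar>\<rho> + 1\<bar>) * Bint \<rho> (complementary A) \<xi>
          * (\<integral>\<^sup>+x. ennreal (h x powr \<rho>) \<partial>lebesgue)
      = ennreal (\<tau> powr \<rho> * measure lebesgue (base :: 'a set) + carleson_const cv \<rho> J * H)"
    unfolding b H(1) \<xi>(3) carleson_const_def cv_def[symmetric]
    using \<xi>(4) H(2) cv_ge_1 by (simp add: ennreal_mult)
  finally have "(\<Sum>q\<in>fam N. m q powr \<rho> * measure lebesgue (core q))
      \<le> \<tau> powr \<rho> * measure lebesgue (base :: 'a set) + carleson_const cv \<rho> J * H"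
    using K H(2) by (subst (asm) ennreal_le_iff) auto
  thus ?thesis using that m by blast
qed

text \<open>The constant involves neither \<open>N\<close> nor the size of \<open>base\<close>: the
  volume of \<open>base\<close> occurs only next to powers of \<open>\<tau>\<close>, which is sent
  to zero.\<close>

lemma Fsum_bound:
  fixes u v :: "'a \<Rightarrow> real"
  assumes p: "1 < p" "1 / p + 1 / p' = 1"
    and A: "young A" and B: "young B"
    and \<epsilon>A: "0 < \<epsilon>A" "complementary A \<epsilon>A \<le> ennreal (1 / 2)" "Bint p' (complementary A) \<epsilon>A = ennreal JA" "0 \<le> JA"
    and \<epsilon>B: "0 < \<epsilon>B" "complementary B \<epsilon>B \<le> ennreal (1 / 2)" "Bint (p / r) (complementary B) \<epsilon>B = ennreal JB" "0 \<le> JB"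
    and u [measurable]: "u \<in> borel_measurable lebesgue" and u0: "\<And>x. 0 \<le> u x"
    and uint: "(\<integral>\<^sup>+x\<in>base. ennreal (u x) \<partial>lebesgue) < \<infinity>"
    and v [measurable]: "v \<in> borel_measurable lebesgue" and v0: "AE x in lebesgue. 0 < v x" "\<And>x. 0 \<le> v x"
    and bump: "\<And>k x. bumped A B u v p r U (dstar k x)"
    and V: "(\<integral>\<^sup>+x. ennreal (norm (f x) powr p * v x) \<partial>lebesgue) = ennreal V" "0 \<le> V"
    and K0: "K\<^sub>0 = 2 * (2 * star_vol) * (2 * star_vol) powr (1 / r) * U"
    and K1: "K\<^sub>1 = carleson_const cv (p / r) JB" and K2: "K\<^sub>2 = carleson_const cv p' JA"
  shows "(\<integral>\<^sup>+x\<in>base. ennreal (Fsum N x powr p * u x) \<partial>lebesgue) \<le> ennreal (bump_const p p' K\<^sub>0 K\<^sub>1 K\<^sub>2 V)"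
proof -
  have p'p: "p' = p / (p - 1)" using p by (rule conjugate_exponent)
  have p': "0 < p'" using p by (simp add: p'p)
  have pp: "(p - 1) * p' = p" using p by (simp add: p'p)
  have U: "0 \<le> U"
  proof -
    obtain lA lB where "0 < lA" "0 < lB" "lA * lB powr (1 / r) \<le> U" using bump[of 0 0] by blast
    thus ?thesis by (smt (verit) mult_nonneg_nonneg powr_ge_zero)
  qed
  have K: "0 \<le> K\<^sub>0" "0 \<le> K\<^sub>1" "0 \<le> K\<^sub>2"
    unfolding K0 K1 K2 carleson_const_def using U star_vol_pos cv_ge_1 \<epsilon>A \<epsilon>B by auto
  let ?F = "Fsum N"
  \<comment> \<open>A crude pointwise bound, used to make \<open>X\<close> finite so that a multiple
    of it can be subtracted at the end.\<close>
  define M where "M = (\<Sum>q\<in>fam N. avg (fst q) (snd q))"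
  have FM: "?F x \<le> M" for x
    unfolding Fsum_def M_def by (intro sum_mono) (auto simp: indicator_def)
  define X where "X = enn2real (\<integral>\<^sup>+x\<in>base. ennreal (?F x powr p * u x) \<partial>lebesgue)"
  have "(\<integral>\<^sup>+x\<in>base. ennreal (?F x powr p * u x) \<partial>lebesgue)
      \<le> (\<integral>\<^sup>+x. ennreal (M powr p) * (ennreal (u x) * indicator base x) \<partial>lebesgue)"
  proof (intro nn_integral_mono)
    fix x
    have "ennreal (?F x powr p * u x) \<le> ennreal (M powr p * u x)"
      using FM u0 Fsum_nonneg p by (intro ennreal_leI mult_right_mono powr_mono2) auto
    thus "ennreal (?F x powr p * u x) * indicator base x \<le> ennreal (M powr p) * (ennreal (u x) * indicator base x)"
      using u0 by (auto simp: indicator_def ennreal_mult)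
  qed
  also have "\<dots> < \<infinity>" using uint by (subst nn_integral_cmult) (auto simp: ennreal_mult_less_top)
  finally have X: "(\<integral>\<^sup>+x\<in>base. ennreal (?F x powr p * u x) \<partial>lebesgue) = ennreal X"
    unfolding X_def by simp
  have X0: "0 \<le> X" by (simp add: X_def)
  \<comment> \<open>Chosen so that on \<open>base\<close> its power \<open>p'\<close> is
    \<open>?F x powr p * u x\<close>, whence its Carleson sum returns \<open>X\<close>, and so that
    \<open>g x * u x powr (1 / p)\<close> is \<open>?F x powr (p - 1) * u x\<close>.\<close>
  define g where "g x = indicator base x * (?F x powr (p - 1) * u x powr (1 / p'))" for x
  have g [measurable]: "g \<in> borel_measurable lebesgue" unfolding g_def by measurable
  have g0: "0 \<le> g x" for x by (simp add: g_def)
  have gp: "(\<integral>\<^sup>+x. ennreal (g x powr p') \<partial>lebesgue) = ennreal X"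
    unfolding X[symmetric]
  proof (intro nn_integral_cong)
    fix x
    have "(?F x powr (p - 1) * u x powr (1 / p')) powr p' = ?F x powr p * u x"
      using p' u0 pp by (simp add: powr_mult powr_powr)
    thus "ennreal (g x powr p') = ennreal (?F x powr p * u x) * indicator base x"
      using p' by (simp add: g_def indicator_def)
  qed
  define h where "h x = norm (f x) powr r * v x powr (r / p)" for x
  have h [measurable]: "h \<in> borel_measurable lebesgue" unfolding h_def by measurable
  have h0: "0 \<le> h x" for x by (simp add: h_def)
  have hp: "(\<integral>\<^sup>+x. ennreal (h x powr (p / r)) \<partial>lebesgue) = ennreal V"
    unfolding V(1)[symmetric] using r p v0(2)
    by (intro nn_integral_cong) (simp add: h_def powr_mult powr_powr)
  define e where "e q = measure lebesgue (core q)" for q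
  have e: "vol (core q) = ennreal (e q)" for q unfolding e_def by (rule vol_core)
  have e0: "0 \<le> e q" for q by (simp add: e_def)
  define b where "b = measure lebesgue (base :: 'a set)"
  \<comment> \<open>The weight in Young's product inequality, small enough to make the coefficient
    \<open>K\<^sub>0 * K\<^sub>2 * \<theta> powr p'\<close> of \<open>X\<close> at most 1/2.\<close>
  define \<theta> where "\<theta> = (1 / (2 * K\<^sub>0 * K\<^sub>2 + 1)) powr (1 / p')"
  have kk: "0 < 2 * K\<^sub>0 * K\<^sub>2 + 1" using K by (intro add_nonneg_pos) auto
  have \<theta>: "0 < \<theta>" using kk by (simp add: \<theta>_def)
  have \<theta>p': "\<theta> powr p' = 1 / (2 * K\<^sub>0 * K\<^sub>2 + 1)" using kk p' by (simp add: \<theta>_def powr_powr)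
  have \<theta>p: "(1 / \<theta>) powr p = (2 * K\<^sub>0 * K\<^sub>2 + 1) powr (p / p')"
    using kk by (simp add: \<theta>_def powr_powr powr_divide)
  have main: "X \<le> K\<^sub>0 * ((1 / \<theta>) powr p * (\<tau> powr (p / r) * b + K\<^sub>1 * V) + \<theta> powr p' * (\<tau> powr p' * b + K\<^sub>2 * X))"
    if \<tau>: "0 < \<tau>" for \<tau>
  proof -
    obtain m1 where m1: "\<And>q. q \<in> fam N \<Longrightarrow> 0 < m1 q"
      "\<And>q. q \<in> fam N \<Longrightarrow> (\<integral>\<^sup>+x\<in>Q2 q. complementary B (h x / m1 q) \<partial>lebesgue) \<le> vol (Q2 q)"
      and S1: "(\<Sum>q\<in>fam N. m1 q powr (p / r) * e q) \<le> \<tau> powr (p / r) * b + K\<^sub>1 * V"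
      unfolding e_def b_def K1 by (rule carleson_fam[where N = N, OF \<epsilon>B h h0 hp V(2) \<tau>]) (use p r in auto)
    obtain m2 where m2: "\<And>q. q \<in> fam N \<Longrightarrow> 0 < m2 q"
      "\<And>q. q \<in> fam N \<Longrightarrow> (\<integral>\<^sup>+x\<in>Q2 q. complementary A (g x / m2 q) \<partial>lebesgue) \<le> vol (Q2 q)"
      and S2: "(\<Sum>q\<in>fam N. m2 q powr p' * e q) \<le> \<tau> powr p' * b + K\<^sub>2 * X"
      unfolding e_def b_def K2 by (rule carleson_fam[where N = N, OF \<epsilon>A g g0 gp X0 \<tau> p']) (use p' in auto)
    \<comment> \<open>The average brings in \<open>lB powr (1 / r)\<close> and the integral
      \<open>lA\<close>, whose product is at most \<open>U\<close>; sparsity then replaces the cube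
      by twice its core.\<close>
    have each: "ennreal (avg (fst q) (snd q)) * (\<integral>\<^sup>+x\<in>Q1 q. ennreal (g x * u x powr (1 / p)) \<partial>lebesgue)
        \<le> ennreal (K\<^sub>0 * (m1 q powr (1 / r) * m2 q) * e q)" if q: "q \<in> fam N" for q
    proof -
      define s where "s = side (fst q) ^ DIM('a)"
      have s: "0 < s" by (simp add: s_def)
      obtain lA lB where l: "0 < lA" "0 < lB" "lA * lB powr (1 / r) \<le> U"
        and lA: "lux A (Q2 q) (\<lambda>y. u y powr (1 / p)) lA"
        and lB: "lux B (Q2 q) (\<lambda>y. v y powr (- r / p)) lB"
        using bump[of "fst q" "snd q"] by blast
      have m: "0 < m1 q" "0 < m2 q" using m1(1) m2(1) q by auto
      have "avg (fst q) (snd q) \<le> (2 * star_vol * (lB * m1 q)) powr (1 / r)"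
        by (rule avg_le_orlicz[OF B v v0(1) l(2) m(1) lB]) (use m1(2)[OF q] in \<open>simp add: h_def\<close>)
      also have "\<dots> = (2 * star_vol) powr (1 / r) * lB powr (1 / r) * m1 q powr (1 / r)"
        using star_vol_pos l m by (simp add: powr_mult)
      finally have av: "avg (fst q) (snd q) \<le> (2 * star_vol) powr (1 / r) * lB powr (1 / r) * m1 q powr (1 / r)" .
      have "(\<integral>\<^sup>+x\<in>Q1 q. ennreal (g x * u x powr (1 / p)) \<partial>lebesgue)
          \<le> (\<integral>\<^sup>+x\<in>Q2 q. ennreal (g x * u x powr (1 / p)) \<partial>lebesgue)"
        using dcube_subset_dstar by (intro nn_integral_mono) (auto simp: indicator_def)
      also have "\<dots> \<le> ennreal (lA * m2 q) * (2 * vol (Q2 q))"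
        by (rule orlicz_holder[OF A]) (use l m lA m2(2)[OF q] g0 in auto)
      also have "\<dots> = ennreal (lA * m2 q) * (ennreal 2 * ennreal (star_vol * s))"
        by (simp add: emeasure_dstar star_vol_def s_def)
      also have "\<dots> = ennreal (lA * m2 q * (2 * (star_vol * s)))"
        using l m star_vol_pos s by (simp add: ennreal_mult[symmetric] mult_ac del: ennreal_numeral)
      finally have "ennreal (avg (fst q) (snd q)) * (\<integral>\<^sup>+x\<in>Q1 q. ennreal (g x * u x powr (1 / p)) \<partial>lebesgue)
          \<le> ennreal ((2 * star_vol) powr (1 / r) * lB powr (1 / r) * m1 q powr (1 / r)) * ennreal (lA * m2 q * (2 * (star_vol * s)))"
        using av by (intro mult_mono ennreal_leI) auto
      also have "\<dots> = ennreal ((2 * star_vol) powr (1 / r) * lB powr (1 / r) * m1 q powr (1 / r) * (lA * m2 q * (2 * (star_vol * s))))"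
        using l m star_vol_pos s by (intro ennreal_mult[symmetric]) auto
      also have "(2 * star_vol) powr (1 / r) * lB powr (1 / r) * m1 q powr (1 / r) * (lA * m2 q * (2 * (star_vol * s)))
          = (lA * lB powr (1 / r)) * ((2 * star_vol) powr (1 / r) * (2 * star_vol) * (m1 q powr (1 / r) * m2 q) * s)"
        by (simp add: mult_ac)
      also have "ennreal \<dots> \<le> ennreal (U * ((2 * star_vol) powr (1 / r) * (2 * star_vol) * (m1 q powr (1 / r) * m2 q) * s))"
        using l m star_vol_pos s by (intro ennreal_leI mult_right_mono) auto
      also have "\<dots> \<le> ennreal (K\<^sub>0 * (m1 q powr (1 / r) * m2 q) * e q)"
      proof (intro ennreal_leI)
        have "ennreal s \<le> ennreal 2 * ennreal (e q)"
          using emeasure_core[OF q] by (simp add: emeasure_dcube s_def e)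
        hence "s \<le> 2 * e q" using e0[of q] by (simp flip: ennreal_mult add: ennreal_le_iff del: ennreal_numeral)
        hence "U * ((2 * star_vol) powr (1 / r) * (2 * star_vol) * (m1 q powr (1 / r) * m2 q) * s)
          \<le> U * ((2 * star_vol) powr (1 / r) * (2 * star_vol) * (m1 q powr (1 / r) * m2 q) * (2 * e q))"
          using U star_vol_pos m by (intro mult_left_mono) auto
        also have "\<dots> = K\<^sub>0 * (m1 q powr (1 / r) * m2 q) * e q" by (simp add: K0 mult_ac)
        finally show "U * ((2 * star_vol) powr (1 / r) * (2 * star_vol) * (m1 q powr (1 / r) * m2 q) * s)
          \<le> K\<^sub>0 * (m1 q powr (1 / r) * m2 q) * e q" .
      qed
      finally show ?thesis .
    qed
    have "ennreal X = (\<integral>\<^sup>+x. (\<Sum>q\<in>fam N. ennreal (avg (fst q) (snd q))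
        * (ennreal (g x * u x powr (1 / p)) * indicator (Q1 q) x)) \<partial>lebesgue)"
      unfolding X[symmetric]
    proof (intro nn_integral_cong)
      fix x
      have Fp: "?F x powr p = ?F x * ?F x powr (p - 1)" using Fsum_nonneg[of N x] powr_add[of "?F x" 1 "p - 1"] by simp
      have up: "u x = u x powr (1 / p') * u x powr (1 / p)"
        using u0[of x] p(2) powr_add[of "u x" "1 / p'" "1 / p"] by (simp add: add.commute)
      have "?F x powr p * u x = ?F x * ((?F x powr (p - 1) * u x powr (1 / p')) * u x powr (1 / p))"
        by (subst up, simp only: Fp mult_ac)
      hence "ennreal (?F x powr p * u x) * indicator base x = ennreal (?F x * (g x * u x powr (1 / p)))"
        by (auto simp: g_def indicator_def)
      also have "\<dots> = ennreal (\<Sum>q\<in>fam N. avg (fst q) (snd q) * (g x * u x powr (1 / p) * indicator (Q1 q) x))"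
        unfolding Fsum_def sum_distrib_right by (simp only: mult_ac)
      also have "\<dots> = (\<Sum>q\<in>fam N. ennreal (avg (fst q) (snd q) * (g x * u x powr (1 / p) * indicator (Q1 q) x)))"
        using g0[of x] by (intro sum_ennreal[symmetric]) auto
      also have "\<dots> = (\<Sum>q\<in>fam N. ennreal (avg (fst q) (snd q))
        * (ennreal (g x * u x powr (1 / p)) * indicator (Q1 q) x))"
        using g0[of x] by (intro sum.cong refl) (auto simp: ennreal_mult indicator_def)
      finally show "ennreal (?F x powr p * u x) * indicator base x = \<dots>" .
    qed
    also have "\<dots> = (\<Sum>q\<in>fam N. ennreal (avg (fst q) (snd q))
        * (\<integral>\<^sup>+x\<in>Q1 q. ennreal (g x * u x powr (1 / p)) \<partial>lebesgue))"
      by (subst nn_integral_sum, measurable) (intro sum.cong refl nn_integral_cmult, measurable)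
    also have "\<dots> \<le> (\<Sum>q\<in>fam N. ennreal (K\<^sub>0 * (m1 q powr (1 / r) * m2 q) * e q))"
      by (intro sum_mono each)
    also have "\<dots> = ennreal (\<Sum>q\<in>fam N. K\<^sub>0 * (m1 q powr (1 / r) * m2 q) * e q)"
      using K e0 m2(1) by (intro sum_ennreal mult_nonneg_nonneg) (auto simp: less_imp_le)
    finally have "X \<le> (\<Sum>q\<in>fam N. K\<^sub>0 * (m1 q powr (1 / r) * m2 q) * e q)"
      using K e0 m2(1) by (subst (asm) ennreal_le_iff) (auto intro!: sum_nonneg mult_nonneg_nonneg simp: less_imp_le)
    also have "\<dots> \<le> (\<Sum>q\<in>fam N. K\<^sub>0 * ((1 / \<theta>) powr p * m1 q powr (p / r) + \<theta> powr p' * m2 q powr p') * e q)"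
    proof (intro sum_mono mult_right_mono mult_left_mono)
      fix q assume q: "q \<in> fam N"
      have m: "0 < m1 q" "0 < m2 q" using m1(1) m2(1) q by auto
      have "m1 q powr (1 / r) * m2 q = (1 / \<theta> * m1 q powr (1 / r)) * (\<theta> * m2 q)" using \<theta> by simp
      also have "\<dots> \<le> (1 / \<theta> * m1 q powr (1 / r)) powr p + (\<theta> * m2 q) powr p'"
        using \<theta> m p by (intro mult_le_powr_add) auto
      also have "(1 / \<theta> * m1 q powr (1 / r)) powr p = (1 / \<theta>) powr p * m1 q powr (p / r)"
        using \<theta> m by (subst powr_mult) (auto simp: powr_powr)
      also have "(\<theta> * m2 q) powr p' = \<theta> powr p' * m2 q powr p'" using \<theta> m by (intro powr_mult)
      finally show "m1 q powr (1 / r) * m2 q \<le> (1 / \<theta>) powr p * m1 q powr (p / r) + \<theta> powr p' * m2 q powr p'" .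
    qed (use K e0 in auto)
    also have "\<dots> = K\<^sub>0 * ((1 / \<theta>) powr p * (\<Sum>q\<in>fam N. m1 q powr (p / r) * e q) + \<theta> powr p' * (\<Sum>q\<in>fam N. m2 q powr p' * e q))"
      by (simp add: sum_distrib_left sum.distrib[symmetric] algebra_simps)
    also have "\<dots> \<le> K\<^sub>0 * ((1 / \<theta>) powr p * (\<tau> powr (p / r) * b + K\<^sub>1 * V) + \<theta> powr p' * (\<tau> powr p' * b + K\<^sub>2 * X))"
      using K by (intro mult_left_mono add_mono S1 S2) auto
    finally show ?thesis .
  qed
  \<comment> \<open>The heights \<open>m1\<close> and \<open>m2\<close> depend on
    \<open>\<tau>\<close>, but \<open>main\<close> no longer mentions them, so
    \<open>\<tau> = 1 / Suc n\<close> may tend to zero.\<close>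
  have "X \<le> K\<^sub>0 * ((1 / \<theta>) powr p * (0 * b + K\<^sub>1 * V) + \<theta> powr p' * (0 * b + K\<^sub>2 * X))"
  proof (rule LIMSEQ_le_const)
    have z: "(\<lambda>n. (1 / real (Suc n)) powr c) \<longlonglongrightarrow> 0" if "0 < c" for c
    proof (rule tendsto_zero_powrI)
      show "(\<lambda>n. 1 / real (Suc n)) \<longlonglongrightarrow> 0" by (rule LIMSEQ_Suc[OF lim_1_over_n])
    qed (use that in auto)
    show "(\<lambda>n. K\<^sub>0 * ((1 / \<theta>) powr p * ((1 / real (Suc n)) powr (p / r) * b + K\<^sub>1 * V)
        + \<theta> powr p' * ((1 / real (Suc n)) powr p' * b + K\<^sub>2 * X)))
      \<longlonglongrightarrow> K\<^sub>0 * ((1 / \<theta>) powr p * (0 * b + K\<^sub>1 * V) + \<theta> powr p' * (0 * b + K\<^sub>2 * X))"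
      using p p' r by (intro tendsto_intros z) auto
    show "\<exists>n0. \<forall>n\<ge>n0. X \<le> K\<^sub>0 * ((1 / \<theta>) powr p * ((1 / real (Suc n)) powr (p / r) * b + K\<^sub>1 * V)
        + \<theta> powr p' * ((1 / real (Suc n)) powr p' * b + K\<^sub>2 * X))"
      by (intro exI[of _ 0] allI impI main) simp
  qed
  hence "X \<le> K\<^sub>0 * K\<^sub>1 * (1 / \<theta>) powr p * V + (K\<^sub>0 * K\<^sub>2 * \<theta> powr p') * X" by (simp add: algebra_simps)
  moreover have "(K\<^sub>0 * K\<^sub>2 * \<theta> powr p') * X \<le> 1 / 2 * X"
    unfolding \<theta>p' using kk by (intro mult_right_mono X0) (simp add: field_simps)
  ultimately have "X \<le> 2 * K\<^sub>0 * K\<^sub>1 * (1 / \<theta>) powr p * V" by linarith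
  hence "X \<le> bump_const p p' K\<^sub>0 K\<^sub>1 K\<^sub>2 V" unfolding \<theta>p bump_const_def .
  thus ?thesis unfolding X by (rule ennreal_leI)
qed

lemma Fsum_mono: "incseq (\<lambda>N. Fsum N x)"
proof (rule incseq_SucI)
  fix N
  show "Fsum N x \<le> Fsum (Suc N) x"
    unfolding Fsum_def by (intro sum_mono2 finite_fam) (auto simp: fam_def)
qed

end

section \<open>Powers of extended numbers and the bound on one cube\<close>

lemma epowr_ennreal: "0 \<le> x \<Longrightarrow> epowr (ennreal x) p = ennreal (x powr p)"
  by (simp add: epowr_def)

lemma epowr_mono: "x \<le> y \<Longrightarrow> 0 \<le> p \<Longrightarrow> epowr x p \<le> epowr y p"
  by (auto simp: epowr_def top_unique intro!: ennreal_leI powr_mono2 enn2real_mono) (simp add: less_top)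

lemma epowr_measurable [measurable]:
  assumes [measurable]: "g \<in> borel_measurable M"
  shows "(\<lambda>x. epowr (g x) p) \<in> borel_measurable M"
  unfolding epowr_def by measurable

context local_op
begin

text \<open>The truncation level in \<open>sparse_domination\<close> varies with the point; monotone
  convergence absorbs this into a supremum over \<open>N\<close>.\<close>

lemma local_bound:
  fixes u :: "'a \<Rightarrow> real"
  assumes p: "0 < p" and [measurable]: "u \<in> borel_measurable lebesgue" and u0: "\<And>x. 0 \<le> u x"
    and F: "\<And>N. (\<integral>\<^sup>+x\<in>base. ennreal (Fsum N x powr p * u x) \<partial>lebesgue) \<le> K"
  shows "(\<integral>\<^sup>+x\<in>base. (epowr (S (cutoff (dstar 0 0) f) x) p * ennreal (u x)) \<partial>lebesgue) \<le> ennreal (cs powr p) * K"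
proof -
  let ?G = "\<lambda>N x. ennreal (cs powr p) * (ennreal (Fsum N x powr p * u x) * indicator base x)"
  have "(\<integral>\<^sup>+x\<in>base. (epowr (S (cutoff (dstar 0 0) f) x) p * ennreal (u x)) \<partial>lebesgue)
      \<le> (\<integral>\<^sup>+x. (SUP N. ?G N x) \<partial>lebesgue)"
  proof (rule nn_integral_mono_AE)
    show "AE x in lebesgue. epowr (S (cutoff (dstar 0 0) f) x) p * ennreal (u x) * indicator base x \<le> (SUP N. ?G N x)"
      using sparse_domination
    proof eventually_elim
      case (elim x)
      show ?case
      proof (cases "x \<in> base")
        case True
        then obtain N where N: "S (cutoff (dstar 0 0) f) x \<le> ennreal (cs * Fsum N x)" using elim by blast
        have "epowr (S (cutoff (dstar 0 0) f) x) p \<le> epowr (ennreal (cs * Fsum N x)) p"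
          using p by (intro epowr_mono N) simp
        also have "\<dots> = ennreal (cs powr p) * ennreal (Fsum N x powr p)"
          using cs_pos Fsum_nonneg[of N x] by (subst epowr_ennreal) (auto simp: powr_mult ennreal_mult)
        finally have "epowr (S (cutoff (dstar 0 0) f) x) p * ennreal (u x) * indicator base x
            \<le> ennreal (cs powr p) * ennreal (Fsum N x powr p) * ennreal (u x) * indicator base x"
          by (intro mult_right_mono) auto
        also have "\<dots> = ?G N x" using u0 by (simp add: ennreal_mult mult.assoc)
        also have "\<dots> \<le> (SUP N. ?G N x)" by (intro SUP_upper) auto
        finally show ?thesis .
      qed simp
    qed
  qed
  also have "\<dots> = (SUP N. \<integral>\<^sup>+x. ?G N x \<partial>lebesgue)"
  proof (rule nn_integral_monotone_convergence_SUP)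
    show "incseq ?G"
      using Fsum_mono Fsum_nonneg p u0
      by (auto simp: incseq_def le_fun_def intro!: mult_left_mono mult_right_mono ennreal_leI powr_mono2)
  qed measurable
  also have "\<dots> \<le> ennreal (cs powr p) * K"
    by (intro SUP_least) (subst nn_integral_cmult, measurable, intro mult_left_mono F, simp)
  finally show ?thesis .
qed

end

section \<open>The two-weight inequality\<close>

text \<open>Local integrability makes the restrictions to balls measurable, and these converge
  pointwise.\<close>

lemma weight_measurable:
  fixes w :: "'a::euclidean_space \<Rightarrow> real"
  assumes "weight w"
  shows "w \<in> borel_measurable lebesgue"
proof (rule borel_measurable_LIMSEQ_real)
  show "(\<lambda>n. indicator (cball 0 (real n)) x * w x) \<longlonglongrightarrow> w x" for x
  proof (rule tendsto_eventually)
    obtain n0 where "norm x \<le> real n0" using real_arch_simple by blast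
    thus "eventually (\<lambda>n. indicator (cball 0 (real n)) x * w x = w x) sequentially"
      unfolding eventually_sequentially by (intro exI[of _ n0]) (auto simp: indicator_def)
  qed
  fix n
  have "w absolutely_integrable_on cball 0 (real n)" using assms by (simp add: weight_def)
  hence "integrable lebesgue (\<lambda>x. indicator (cball 0 (real n)) x *\<^sub>R w x)" by (simp add: set_integrable_def)
  thus "(\<lambda>x. indicator (cball 0 (real n)) x * w x) \<in> borel_measurable lebesgue" by simp
qed

lemma weight_integral_finite:
  fixes w :: "'a::euclidean_space \<Rightarrow> real"
  assumes w: "weight w" and X: "bounded X"
  shows "(\<integral>\<^sup>+x\<in>X. ennreal (w x) \<partial>lebesgue) < \<infinity>"
proof -
  obtain R where "\<forall>x\<in>X. norm x \<le> R" using X by (auto simp: bounded_iff)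
  hence R: "X \<subseteq> cball 0 R" by auto
  have "w absolutely_integrable_on cball 0 R" using w by (simp add: weight_def)
  hence "integrable lebesgue (\<lambda>x. indicator (cball 0 R) x *\<^sub>R w x)" by (simp add: set_integrable_def)
  hence "(\<integral>\<^sup>+x. ennreal (norm (indicator (cball 0 R) x *\<^sub>R w x)) \<partial>lebesgue) < \<infinity>"
    by (simp add: integrable_iff_bounded)
  moreover have "(\<integral>\<^sup>+x\<in>X. ennreal (w x) \<partial>lebesgue) \<le> (\<integral>\<^sup>+x. ennreal (norm (indicator (cball 0 R) x *\<^sub>R w x)) \<partial>lebesgue)"
    using R w by (intro nn_integral_mono) (auto simp: indicator_def weight_def)
  ultimately show ?thesis by (rule le_less_trans[rotated])
qed

section \<open>From Luxemburg norms to admissible constants\<close>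

lemma emeasure_cube:
  assumes "Q \<in> (cubes :: 'a::euclidean_space set set)"
  shows "Q \<in> sets lebesgue" "vol Q \<noteq> 0" "vol Q \<noteq> \<infinity>"
proof -
  obtain a :: 'a and l where Q: "Q = cbox a (a + l *\<^sub>R One)" "0 < l" using assms by (auto simp: cubes_def)
  have "vol Q = ennreal (l ^ DIM('a))"
    using Q by (simp add: emeasure_lborel_cbox_eq inner_add_left)
  thus "vol Q \<noteq> 0" "vol Q \<noteq> \<infinity>" using Q by auto
  show "Q \<in> sets lebesgue" using Q by simp
qed

lemma ennreal_divide_le_1:
  fixes x y :: ennreal
  assumes "x / y \<le> 1" "y \<noteq> 0" "y \<noteq> \<infinity>"
  shows "x \<le> y"
proof -
  have "y / y = 1" using assms(2,3) by (intro ennreal_divide_self) (auto simp: top.not_eq_extremum)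
  hence "x = x / y * y" by (simp add: ennreal_divide_times)
  also have "\<dots> \<le> 1 * y" by (intro mult_right_mono assms) simp
  finally show ?thesis by simp
qed

lemma orlicz_norm_lessD:
  assumes "orlicz_norm A Q g < x" and Q: "Q \<in> cubes"
  obtains l where "0 < l" "ennreal l < x"
    "(\<integral>\<^sup>+y\<in>Q. ennreal (A (\<bar>g y\<bar> / l)) \<partial>lebesgue) \<le> vol Q"
proof -
  obtain y where "y < x" and "y \<in> {ennreal l | l. 0 < l \<and>
     (\<integral>\<^sup>+y\<in>Q. ennreal (A (\<bar>g y\<bar> / l)) \<partial>lebesgue) / vol Q \<le> 1}"
    using assms(1) unfolding orlicz_norm_def Inf_less_iff by blast
  then obtain l where l: "ennreal l < x" "0 < l"
    "(\<integral>\<^sup>+y\<in>Q. ennreal (A (\<bar>g y\<bar> / l)) \<partial>lebesgue) / vol Q \<le> 1" by blast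
  show ?thesis using l ennreal_divide_le_1 emeasure_cube[OF Q] by (intro that[of l]) auto
qed

text \<open>Since \<open>0 * \<infinity> = 0\<close> in \<open>ennreal\<close>, a finite product
  bounds both norms only if neither vanishes. Here \<open>g\<close> is bounded below on a set of
  positive measure and \<open>A\<close> tends to infinity, so a small \<open>l\<close> cannot be
  admissible.\<close>

lemma orlicz_norm_pos:
  fixes g :: "'a::euclidean_space \<Rightarrow> real"
  assumes A: "young A" and [measurable]: "g \<in> borel_measurable lebesgue"
    and pos: "AE x in lebesgue. 0 < \<bar>g x\<bar>" and Q: "Q \<in> cubes"
  shows "orlicz_norm A Q g \<noteq> 0"
proof
  assume 0: "orlicz_norm A Q g = 0"
  note [measurable] = emeasure_cube(1)[OF Q]
  define E where "E n = {x \<in> Q. 1 / real (Suc n) < \<bar>g x\<bar>}" for n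
  have E [measurable]: "E n \<in> sets lebesgue" for n
  proof -
    have "{x \<in> space lebesgue. 1 / real (Suc n) < \<bar>g x\<bar>} \<in> sets lebesgue" by measurable
    moreover have "E n = Q \<inter> {x \<in> space lebesgue. 1 / real (Suc n) < \<bar>g x\<bar>}" by (auto simp: E_def)
    ultimately show ?thesis by (simp add: sets.Int emeasure_cube(1)[OF Q])
  qed
  have "\<exists>n. vol (E n) \<noteq> 0"
  proof (rule ccontr)
    assume "\<nexists>n. vol (E n) \<noteq> 0"
    hence "(\<Union>n. E n) \<in> null_sets lebesgue" by (intro null_sets_UN) (auto simp: null_sets_def)
    hence "AE x in lebesgue. x \<notin> (\<Union>n. E n)" by (rule AE_not_in)
    hence "AE x in lebesgue. x \<notin> Q"
      using pos
    proof eventually_elim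
      case (elim x)
      obtain n where "1 / real (Suc n) < \<bar>g x\<bar>" using elim(2) nat_approx_posE by metis
      thus ?case using elim(1) by (auto simp: E_def)
    qed
    hence "Q \<in> null_sets lebesgue" using AE_iff_null_sets[OF emeasure_cube(1)[OF Q]] by simp
    thus False using emeasure_cube(2)[OF Q] by auto
  qed
  then obtain n where n: "vol (E n) \<noteq> 0" by blast
  obtain q where q: "vol Q = ennreal q" "0 \<le> q"
    using emeasure_cube(3)[OF Q] by (metis ennreal_cases infinity_ennreal_def)
  have "vol (E n) \<le> vol Q" by (intro emeasure_mono) (auto simp: E_def)
  hence "vol (E n) \<noteq> \<infinity>" using emeasure_cube(3)[OF Q] by (auto simp: top_unique)
  then obtain e where e: "vol (E n) = ennreal e" "0 \<le> e" by (metis ennreal_cases infinity_ennreal_def)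
  have e0: "0 < e" using n e by (cases "e = 0") auto
  \<comment> \<open>Where \<open>A\<close> exceeds \<open>q / e + 1\<close>, the integral over
    \<open>E n\<close> alone is at least \<open>q + e\<close>, more than the volume of
    \<open>Q\<close>.\<close>
  have "eventually (\<lambda>t. q / e + 1 \<le> A t) at_top"
    using A by (auto simp: young_def filterlim_at_top)
  then obtain t0 where t0: "\<And>t. t0 \<le> t \<Longrightarrow> q / e + 1 \<le> A t" by (auto simp: eventually_at_top_linorder)
  define \<tau> where "\<tau> = 1 / real (Suc n)"
  define t1 where "t1 = max t0 1"
  have "orlicz_norm A Q g < ennreal (\<tau> / t1)" unfolding 0 by (simp add: \<tau>_def t1_def)
  then obtain l where l: "0 < l" "ennreal l < ennreal (\<tau> / t1)"
    "(\<integral>\<^sup>+y\<in>Q. ennreal (A (\<bar>g y\<bar> / l)) \<partial>lebesgue) \<le> vol Q"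
    by (rule orlicz_norm_lessD[OF _ Q])
  have lt: "l < \<tau> / t1" using l(1,2) by (simp add: ennreal_less_iff)
  have "0 < t1" by (simp add: t1_def)
  hence t1l: "t1 \<le> \<tau> / l" using lt l(1) by (simp add: field_simps)
  have "ennreal ((q / e + 1) * e) = (\<integral>\<^sup>+y. ennreal (q / e + 1) * indicator (E n) y \<partial>lebesgue)"
    using e q by (subst nn_integral_cmult_indicator) (auto simp: ennreal_mult')
  also have "\<dots> \<le> (\<integral>\<^sup>+y\<in>Q. ennreal (A (\<bar>g y\<bar> / l)) \<partial>lebesgue)"
  proof (intro nn_integral_mono)
    fix y
    show "ennreal (q / e + 1) * indicator (E n) y \<le> ennreal (A (\<bar>g y\<bar> / l)) * indicator Q y"
    proof (cases "y \<in> E n")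
      case True
      hence "\<tau> / l \<le> \<bar>g y\<bar> / l" using l(1) by (intro divide_right_mono) (auto simp: E_def \<tau>_def)
      hence "q / e + 1 \<le> A (\<bar>g y\<bar> / l)" using t1l by (intro t0) (auto simp: t1_def)
      thus ?thesis using True by (auto simp: E_def intro!: ennreal_leI)
    qed simp
  qed
  also have "\<dots> \<le> ennreal q" using l(3) q by simp
  finally have "(q / e + 1) * e \<le> q" using q by simp
  thus False using e0 by (simp add: distrib_right)
qed

text \<open>Twice a positive finite norm lies strictly above the infimum, hence above an admissible
  constant; the two doublings account for the factor \<open>2 * 2 powr (1 / r)\<close>.\<close>

lemma bump_norms:
  fixes u v :: "'a::euclidean_space \<Rightarrow> real"
  assumes A: "young A" and B: "young B" and r: "0 < r" and u: "positive_weight u" and v: "positive_weight v"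
    and W: "(SUP Q\<in>cubes. orlicz_norm A Q (\<lambda>x. u x powr (1 / p)) *
            epowr (orlicz_norm B Q (\<lambda>x. v x powr (- r / p))) (1 / r)) < \<infinity>"
  obtains U where "\<And>Q. Q \<in> (cubes :: 'a set set) \<Longrightarrow> bumped A B u v p r U Q"
proof -
  have [measurable]: "u \<in> borel_measurable lebesgue" "v \<in> borel_measurable lebesgue"
    using u v by (auto simp: positive_weight_def weight_measurable)
  have pos: "AE x in lebesgue. 0 < u x" "AE x in lebesgue. 0 < v x"
    using u v by (auto simp: positive_weight_def)
  define \<Phi> where "\<Phi> Q = orlicz_norm A Q (\<lambda>x. u x powr (1 / p)) *
            epowr (orlicz_norm B Q (\<lambda>x. v x powr (- r / p))) (1 / r)" for Q :: "'a set"
  have W: "(SUP Q\<in>cubes. \<Phi> Q) < \<infinity>" unfolding \<Phi>_def by (rule W)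
  define W' where "W' = enn2real (SUP Q\<in>cubes. \<Phi> Q)"
  have W'0: "0 \<le> W'" by (simp add: W'_def)
  have W': "orlicz_norm A Q (\<lambda>x. u x powr (1 / p)) * epowr (orlicz_norm B Q (\<lambda>x. v x powr (- r / p))) (1 / r) \<le> ennreal W'"
    if "Q \<in> cubes" for Q :: "'a set"
  proof -
    have "\<Phi> Q \<le> (SUP Q\<in>cubes. \<Phi> Q)" by (rule SUP_upper[OF that])
    also have "\<dots> = ennreal W'" unfolding W'_def using W by simp
    finally show ?thesis by (simp add: \<Phi>_def)
  qed
  show ?thesis
  proof (rule that[of "2 * 2 powr (1 / r) * W'"])
    fix Q :: "'a set" assume Q: "Q \<in> cubes"
    let ?NA = "orlicz_norm A Q (\<lambda>x. u x powr (1 / p))" and ?NB = "orlicz_norm B Q (\<lambda>x. v x powr (- r / p))"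
    have NA0: "?NA \<noteq> 0"
    proof (rule orlicz_norm_pos[OF A _ _ Q])
      show "AE x in lebesgue. 0 < \<bar>u x powr (1 / p)\<bar>" using pos(1) by eventually_elim simp
    qed measurable
    have NB0: "?NB \<noteq> 0"
    proof (rule orlicz_norm_pos[OF B _ _ Q])
      show "AE x in lebesgue. 0 < \<bar>v x powr (- r / p)\<bar>" using pos(2) by eventually_elim simp
    qed measurable
    have eB0: "epowr ?NB (1 / r) \<noteq> 0"
    proof (cases "?NB = \<infinity>")
      case False
      then obtain z where z: "?NB = ennreal z" "0 \<le> z" by (metis ennreal_cases infinity_ennreal_def)
      thus ?thesis using NB0 by (cases "z = 0") (auto simp: epowr_ennreal)
    qed (simp add: epowr_def)
    have "?NA * epowr ?NB (1 / r) \<noteq> \<infinity>" using W'[OF Q] by (auto simp: top_unique)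
    hence "?NA \<noteq> \<infinity>" "epowr ?NB (1 / r) \<noteq> \<infinity>" using NA0 eB0 by (auto simp: ennreal_mult_eq_top_iff)
    hence fin: "?NA \<noteq> \<infinity>" "?NB \<noteq> \<infinity>" by (auto simp: epowr_def)
    obtain a where a: "?NA = ennreal a" "0 \<le> a" using fin(1) by (metis ennreal_cases infinity_ennreal_def)
    obtain b where b: "?NB = ennreal b" "0 \<le> b" using fin(2) by (metis ennreal_cases infinity_ennreal_def)
    have a0: "0 < a" "0 < b" using a b NA0 NB0 by (auto simp: less_le)
    have "?NA < ennreal (2 * a)" using a a0 by (simp add: ennreal_less_iff)
    then obtain lA where lA: "0 < lA" "ennreal lA < ennreal (2 * a)"
      "lux A Q (\<lambda>y. u y powr (1 / p)) lA"
      by (rule orlicz_norm_lessD[OF _ Q])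
    have "?NB < ennreal (2 * b)" using b a0 by (simp add: ennreal_less_iff)
    then obtain lB where lB: "0 < lB" "ennreal lB < ennreal (2 * b)"
      "lux B Q (\<lambda>y. v y powr (- r / p)) lB"
      by (rule orlicz_norm_lessD[OF _ Q])
    have l: "lA \<le> 2 * a" "lB \<le> 2 * b" using lA(1,2) lB(1,2) by (auto simp: ennreal_less_iff)
    have "ennreal (a * b powr (1 / r)) \<le> ennreal W'"
      using W'[OF Q] a b by (simp add: epowr_ennreal ennreal_mult)
    hence ab: "a * b powr (1 / r) \<le> W'" using W'0 by simp
    have "lA * lB powr (1 / r) \<le> (2 * a) * (2 * b) powr (1 / r)"
      using l lA(1) lB(1) r by (intro mult_mono powr_mono2) auto
    also have "\<dots> = 2 * 2 powr (1 / r) * (a * b powr (1 / r))" using a0 by (simp add: powr_mult)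
    also have "\<dots> \<le> 2 * 2 powr (1 / r) * W'" using ab by (intro mult_left_mono) auto
    finally show "bumped A B u v p r (2 * 2 powr (1 / r) * W') Q"
      using lA lB by blast
  qed
qed

lemma B_cond_constants:
  assumes A: "young A" and B: "B_cond \<rho> (complementary A)"
  obtains \<epsilon> J where "0 < \<epsilon>" "complementary A \<epsilon> \<le> ennreal (1 / 2)" "Bint \<rho> (complementary A) \<epsilon> = ennreal J" "0 \<le> J"
proof -
  obtain \<epsilon> where e: "0 < \<epsilon>" "complementary A \<epsilon> \<le> ennreal (1 / 2)"
    using complementary_small[OF A B_cond_finite(1)[OF mono_complementary B]] by blast
  have "Bint \<rho> (complementary A) \<epsilon> < \<infinity>" by (rule B_cond_Bint[OF mono_complementary B e(1)])
  hence "Bint \<rho> (complementary A) \<epsilon> = ennreal (enn2real (Bint \<rho> (complementary A) \<epsilon>))" by simp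
  thus ?thesis using that e by (metis enn2real_nonneg)
qed

section \<open>Local integrability of the function\<close>

context grid
begin

text \<open>Membership in the domain gives no local \<open>L^r\<close> bound; the weighted
  \<open>L^p\<close> norm and the bump on \<open>v\<close> do.\<close>

lemma local_power_integrable:
  fixes f :: "'a::euclidean_space \<Rightarrow> complex" and v :: "'a \<Rightarrow> real"
  assumes B: "young B" and p: "0 < r" "r < p"
    and \<epsilon>: "0 < \<epsilon>" "complementary B \<epsilon> \<le> ennreal (1 / 2)" "Bint (p / r) (complementary B) \<epsilon> < \<infinity>"
    and f [measurable]: "f \<in> borel_measurable lebesgue" and v [measurable]: "v \<in> borel_measurable lebesgue"
    and v0: "AE x in lebesgue. 0 < v x" "\<And>x. 0 \<le> v x"
    and V: "(\<integral>\<^sup>+x. ennreal (norm (f x) powr p * v x) \<partial>lebesgue) < \<infinity>"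
    and l: "0 < l" "lux B (dstar k x) (\<lambda>y. v y powr (- r / p)) l"
  shows "(\<integral>\<^sup>+y\<in>dstar k x. ennreal (norm (f y) powr r) \<partial>lebesgue) < \<infinity>"
proof -
  define h where "h x = norm (f x) powr r * v x powr (r / p)" for x
  have h [measurable]: "h \<in> borel_measurable lebesgue" unfolding h_def by measurable
  have hp: "(\<integral>\<^sup>+x. ennreal (h x powr (p / r)) \<partial>lebesgue) < \<infinity>"
  proof -
    have "(\<integral>\<^sup>+x. ennreal (h x powr (p / r)) \<partial>lebesgue) = (\<integral>\<^sup>+x. ennreal (norm (f x) powr p * v x) \<partial>lebesgue)"
      using p v0(2) by (intro nn_integral_cong) (simp add: h_def powr_mult powr_powr)
    thus ?thesis using V by simp
  qed
  \<comment> \<open>A single cube with empty \<open>E\<close>: all that is wanted from the embedding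
    is an admissible height for \<open>h\<close>.\<close>
  obtain m where m: "\<And>q. q \<in> {(k, x)} \<Longrightarrow> 0 < m q"
      "\<And>q. q \<in> {(k, x)} \<Longrightarrow> (\<integral>\<^sup>+y\<in>Q2 q. complementary B (h y / m q) \<partial>lebesgue)
          \<le> vol (Q2 q)"
    by (rule carleson[where h = h and E = "\<lambda>_. {}" and S = "{(k, x)}" and \<tau> = 1 and \<rho> = "p / r"
          and D = "complementary B" and \<epsilon> = \<epsilon>])
       (use mono_complementary \<epsilon> hp p in \<open>auto simp: h_def disjoint_family_on_def\<close>)
  have "(\<integral>\<^sup>+y\<in>dstar k x. ennreal (norm (f y) powr r) \<partial>lebesgue)
      \<le> ennreal (l * m (k, x)) * (2 * vol (dstar k x))"
    by (rule power_integral_le_orlicz[OF B f v dstar_lebesgue v0(1) l(1) _ l(2)]) (use m in \<open>auto simp: h_def\<close>)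
  also have "\<dots> < \<infinity>"
    unfolding emeasure_dstar by (simp add: ennreal_mult_less_top)
  finally show ?thesis .
qed

lemma dstar_0: "dstar 0 (0::'a::euclidean_space) = {y. \<forall>i\<in>Basis. \<bar>y \<bullet> i + L\<bar> \<le> 2 * kap TYPE('a) * L}"
proof -
  have c: "corner 0 (0::'a) \<bullet> i = - L" if "i \<in> Basis" for i
    using that L_pos by (simp add: corner_inner side_def)
  thus ?thesis by (auto simp: dstar_iff side_def mult_ac)
qed

lemma base_bounded: "bounded (base :: 'a::euclidean_space set)"
proof (rule bounded_subset)
  show "base \<subseteq> cball (0::'a) (real DIM('a) * ((kap TYPE('a) + 1) * side 0))"
    using dcube_subset_dstar[of 0 "0::'a"] dstar_subset_cball[OF dcube_self, of 0 "0::'a"] by (auto simp: base_def)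
qed simp

end

lemma epowr_2_mult: "epowr (2 * y) p \<le> ennreal (2 powr p) * epowr y p"
proof (cases y)
  case (real z)
  have e: "2 * y = ennreal (2 * z)" using real by (simp add: ennreal_mult)
  have "epowr (2 * y) p = ennreal ((2 * z) powr p)" unfolding e using real by (intro epowr_ennreal) simp
  also have "\<dots> = ennreal (2 powr p) * epowr y p" using real by (simp add: epowr_ennreal powr_mult ennreal_mult)
  finally show ?thesis by simp
next
  case top
  thus ?thesis by (simp add: epowr_def ennreal_mult_top)
qed

theorem theorem7p1:
  fixes T :: "('a::euclidean_space \<Rightarrow> complex) \<Rightarrow> 'a \<Rightarrow> complex"
    and \<D> :: "('a \<Rightarrow> complex) set"
    and I :: "'i set" and \<phi> :: "'i \<Rightarrow> 'a \<Rightarrow> real"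
    and \<psi> A B :: "real \<Rightarrow> real" and r\<^sub>0 p p' r :: real
    and u v :: "'a \<Rightarrow> real"
  assumes "calderon_zygmund \<D> T"
    and "\<And>\<alpha>. \<alpha> \<in> I \<Longrightarrow> \<phi> \<alpha> \<in> borel_measurable lebesgue"
    and "1 < r\<^sub>0"
    and "weak_type_upto \<D> (max_modulated I \<phi> T) r\<^sub>0 \<psi>"
    and "1 < p" and "1 / p + 1 / p' = 1"
    and "young A" and "doubling A" and "young B" and "doubling B"
    and "1 < r" and "r < min r\<^sub>0 p"
    and "B_cond p' (complementary A)"
    and "B_cond (p / r) (complementary B)"
    and "positive_weight u" and "positive_weight v"
    and "(SUP Q\<in>cubes. orlicz_norm A Q (\<lambda>x. u x powr (1 / p)) *
            epowr (orlicz_norm B Q (\<lambda>x. v x powr (- r / p))) (1 / r)) < \<infinity>"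
  shows "\<exists>C\<ge>0. \<forall>f\<in>\<D>.
           (\<integral>\<^sup>+x. epowr (max_modulated I \<phi> T f x) p * ennreal (u x) \<partial>lebesgue)
             \<le> ennreal C * (\<integral>\<^sup>+x. ennreal (norm (f x) powr p * v x) \<partial>lebesgue)"
proof -
  let ?S = "max_modulated I \<phi> T"
  have p: "1 < p" "1 / p + 1 / p' = 1" and r: "1 < r" "r < p" "r \<le> r\<^sub>0" using assms by auto
  note A = \<open>young A\<close> and B = \<open>young B\<close>
  have u: "weight u" "\<And>x. 0 \<le> u x" and v: "weight v" "\<And>x. 0 \<le> v x" "AE x in lebesgue. 0 < v x"
    using assms(15,16) by (auto simp: positive_weight_def weight_def)
  note [measurable] = weight_measurable[OF u(1)] weight_measurable[OF v(1)]
  obtain \<delta> cK cw where reg: "regular_op ?S \<D> r \<delta> cK cw"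
    using max_modulated_regular[OF assms(1,2,4) r(1,3)] by blast
  obtain \<epsilon>A JA where \<epsilon>A: "0 < \<epsilon>A" "complementary A \<epsilon>A \<le> ennreal (1 / 2)"
      "Bint p' (complementary A) \<epsilon>A = ennreal JA" "0 \<le> JA"
    by (rule B_cond_constants[OF A assms(13)])
  obtain \<epsilon>B JB where \<epsilon>B: "0 < \<epsilon>B" "complementary B \<epsilon>B \<le> ennreal (1 / 2)"
      "Bint (p / r) (complementary B) \<epsilon>B = ennreal JB" "0 \<le> JB"
    by (rule B_cond_constants[OF B assms(14)])
  obtain U where U: "\<And>Q. Q \<in> (cubes :: 'a set set) \<Longrightarrow> bumped A B u v p r U Q"
    using bump_norms[OF A B _ assms(15,16,17)] r by auto
  define cv where "cv = cov TYPE('a)"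
  define sv where "sv = (2 * kap TYPE('a)) ^ DIM('a)"
  define \<eta> :: real where "\<eta> = 1 / 2 ^ (DIM('a) + 2)"
  define \<epsilon> where "\<epsilon> = \<eta> / (4 * cv)"
  define c1 where "c1 = ((cw + 1) / \<epsilon>) powr (1 / r)"
  define c2 where "c2 = 4 * cv"
  define cs where "cs = local_op.cs TYPE('a) r \<delta> cK sv c1 c2"
  define K\<^sub>0 where "K\<^sub>0 = 2 * (2 * sv) * (2 * sv) powr (1 / r) * U"
  define K\<^sub>1 where "K\<^sub>1 = carleson_const cv (p / r) JB"
  define K\<^sub>2 where "K\<^sub>2 = carleson_const cv p' JA"
  \<comment> \<open>The choice of \<open>U\<close> comes without a sign, so nonnegativity is
    enforced here.\<close>
  define Cb where "Cb = max 0 (bump_const p p' K\<^sub>0 K\<^sub>1 K\<^sub>2 1)"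
  \<comment> \<open>The factor \<open>2 powr p\<close> stems from \<open>exhaust\<close>. The
    summand 1 makes \<open>C\<close> positive, so the right-hand side is infinite whenever the
    weighted norm of \<open>f\<close> is.\<close>
  define C where "C = 2 powr p * (cs powr p * Cb) + 1"
  have Cb: "0 \<le> Cb" by (simp add: Cb_def)
  have C: "1 \<le> C" using Cb by (simp add: C_def)
  show ?thesis
  proof (intro exI[of _ C] conjI ballI)
    show "0 \<le> C" using C by simp
    fix f assume f: "f \<in> \<D>"
    let ?V = "\<integral>\<^sup>+x. ennreal (norm (f x) powr p * v x) \<partial>lebesgue"
    show "(\<integral>\<^sup>+x. epowr (?S f x) p * ennreal (u x) \<partial>lebesgue) \<le> ennreal C * ?V"
    proof (cases "?V = \<infinity>")
      case True
      hence "ennreal C * ?V = \<infinity>" using C by (simp add: ennreal_mult_top)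
      thus ?thesis by simp
    next
      case False
      then obtain V where V: "?V = ennreal V" "0 \<le> V" by (metis ennreal_cases infinity_ennreal_def)
      have fm [measurable]: "f \<in> borel_measurable lebesgue" by (rule regular_op.dom_meas[OF reg f])
      have loc: "local_op L ?S \<D> r \<delta> cK cw f cv sv \<eta> \<epsilon> c1 c2" if L: "0 < L" for L
      proof -
        interpret G: grid L by unfold_locales (rule L)
        have "(\<integral>\<^sup>+y\<in>G.dstar k x. ennreal (norm (f y) powr r) \<partial>lebesgue) < \<infinity>" for k and x :: 'a
        proof -
          obtain lB where lB: "0 < lB"
              "(\<integral>\<^sup>+y\<in>G.dstar k x. ennreal (B (\<bar>v y powr (- r / p)\<bar> / lB)) \<partial>lebesgue) \<le> vol (G.dstar k x)"
            using U[OF G.dstar_cubes[of k x]] by blast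
          show ?thesis
            by (rule G.local_power_integrable[OF B _ r(2) \<epsilon>B(1,2) _ fm _ v(3,2) _ lB]) (use r \<epsilon>B V in auto)
        qed
        thus ?thesis
          unfolding local_op_def local_op_axioms_def
          using G.grid_axioms reg f by (simp add: cv_def sv_def \<eta>_def \<epsilon>_def c1_def c2_def)
      qed
      have local: "(\<integral>\<^sup>+x\<in>grid.base L. (epowr (?S (cutoff (grid.dstar L 0 0) f) x) p * ennreal (u x)) \<partial>lebesgue)
          \<le> ennreal (cs powr p * Cb) * ennreal V" if L: "0 < L" for L
      proof -
        interpret P: local_op L ?S \<D> r \<delta> cK cw f cv sv \<eta> \<epsilon> c1 c2 by (rule loc[OF L])
        have F: "(\<integral>\<^sup>+x\<in>P.base. ennreal (P.Fsum N x powr p * u x) \<partial>lebesgue) \<le> ennreal (bump_const p p' K\<^sub>0 K\<^sub>1 K\<^sub>2 V)" for N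
          by (rule P.Fsum_bound[OF p A B \<epsilon>A \<epsilon>B _ u(2) weight_integral_finite[OF u(1) P.base_bounded] _ v(3,2)
                U[OF P.dstar_cubes] V K\<^sub>0_def K\<^sub>1_def K\<^sub>2_def]) auto
        have "(\<integral>\<^sup>+x\<in>P.base. (epowr (?S (cutoff (P.dstar 0 0) f) x) p * ennreal (u x)) \<partial>lebesgue)
            \<le> ennreal (cs powr p) * ennreal (bump_const p p' K\<^sub>0 K\<^sub>1 K\<^sub>2 V)"
          unfolding cs_def using p by (intro P.local_bound F u(2)) auto
        also have "\<dots> \<le> ennreal (cs powr p) * ennreal (Cb * V)"
        proof (intro mult_left_mono ennreal_leI)
          have "bump_const p p' K\<^sub>0 K\<^sub>1 K\<^sub>2 V = bump_const p p' K\<^sub>0 K\<^sub>1 K\<^sub>2 1 * V" by (simp add: bump_const_def)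
          also have "\<dots> \<le> Cb * V" using V by (intro mult_right_mono) (auto simp: Cb_def)
          finally show "bump_const p p' K\<^sub>0 K\<^sub>1 K\<^sub>2 V \<le> Cb * V" .
        qed simp
        also have "\<dots> = ennreal (cs powr p * Cb) * ennreal V" using V Cb by (simp add: ennreal_mult mult.assoc)
        finally show ?thesis .
      qed
      define L where "L N = real N + 1" for N :: nat
      have L: "0 < L N" for N by (simp add: L_def)
      have gr: "grid (L N)" for N by unfold_locales (rule L)
      define X where "X N = (grid.dstar (L N) 0 0 :: 'a set)" for N
      define Z where "Z N = (grid.base (L N) :: 'a set)" for N
      have XD: "X N = {y. \<forall>i\<in>Basis. \<bar>y \<bullet> i + L N\<bar> \<le> 2 * kap TYPE('a) * L N}" for N
        unfolding X_def by (rule grid.dstar_0[OF gr])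
      have ZD: "Z N = {y. \<forall>i\<in>Basis. - L N \<le> y \<bullet> i \<and> y \<bullet> i < L N}" for N
        unfolding Z_def by (rule grid.base_eq[OF gr])
      have Xm [measurable]: "X N \<in> sets lebesgue" for N unfolding X_def by (rule grid.dstar_lebesgue[OF gr])
      have Zm [measurable]: "Z N \<in> sets lebesgue" for N unfolding Z_def grid.base_def[OF gr] by (rule grid.dcube_lebesgue[OF gr])
      \<comment> \<open>The dilates are centred at the lower corner of the base cube, which moves
        with \<open>N\<close>; they are nested because their radius grows faster than the centre
        moves.\<close>
      have Xmono: "X M \<subseteq> X N" if MN: "M \<le> N" for M N
      proof
        fix y assume y: "y \<in> X M"
        have "\<bar>y \<bullet> i + L N\<bar> \<le> 2 * kap TYPE('a) * L N" if "i \<in> Basis" for i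
        proof -
          have d: "0 \<le> L N - L M" using MN by (simp add: L_def)
          have "\<bar>y \<bullet> i + L M\<bar> \<le> 2 * kap TYPE('a) * L M" using y that by (simp add: XD)
          moreover have "L N - L M \<le> 2 * kap TYPE('a) * (L N - L M)"
            using mult_right_mono[OF _ d, of 1 "2 * kap TYPE('a)"] kap_ge[where 'a='a] by simp
          ultimately show ?thesis using d by (simp add: right_diff_distrib)
        qed
        thus "y \<in> X N" by (simp add: XD)
      qed
      have inside: "ball 0 (L N) \<subseteq> X N" for N
      proof
        fix y :: 'a assume "y \<in> ball 0 (L N)"
        hence y: "norm y < L N" by simp
        have "\<bar>y \<bullet> i + L N\<bar> \<le> 2 * kap TYPE('a) * L N" if "i \<in> Basis" for i
        proof -
          have "\<bar>y \<bullet> i\<bar> < L N" using Basis_le_norm[OF that, of y] y by linarith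
          moreover have "2 * L N \<le> 2 * kap TYPE('a) * L N"
            using kap_ge[where 'a='a] L[of N] by (intro mult_right_mono) auto
          ultimately show ?thesis by linarith
        qed
        thus "y \<in> X N" by (simp add: XD)
      qed
      \<comment> \<open>The truncated operators need not be monotone in \<open>N\<close>, and
        measurability is known for them only; so Fatou's lemma is applied to
        \<open>G\<close>.\<close>
      define G where "G N x = ennreal (2 powr p) * (epowr (?S (cutoff (X N) f) x) p * ennreal (u x) * indicator (Z N) x)" for N x
      have ev: "eventually (\<lambda>N. epowr (?S f x) p * ennreal (u x) \<le> G N x) sequentially" for x
      proof -
        \<comment> \<open>Shifting the sequence by \<open>N0\<close> puts the unit ball around
          \<open>x\<close> inside its first set, as \<open>exhaust\<close> demands.\<close>
        obtain N0 where N0: "norm x + 1 < real N0" using reals_Archimedean2 by blast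
        have "eventually (\<lambda>N. ?S f x \<le> 2 * ?S (cutoff (X (N + N0)) f) x) sequentially"
        proof (rule regular_op.exhaust[OF reg f, where R = 1])
          show "incseq (\<lambda>N. X (N + N0))" using Xmono by (auto simp: incseq_def)
          show "(\<Union>N. X (N + N0)) = UNIV"
          proof (intro equalityI subsetI)
            fix y :: 'a
            obtain N where "norm y < real N" using reals_Archimedean2 by blast
            hence "y \<in> ball 0 (L (N + N0))" by (simp add: L_def)
            thus "y \<in> (\<Union>N. X (N + N0))" using inside by blast
          qed simp
          have "ball x 1 \<subseteq> ball 0 (L N0)"
          proof
            fix y assume "y \<in> ball x 1"
            hence "norm (y - x) < 1" by (simp add: dist_norm norm_minus_commute)
            hence "norm y < norm x + 1" using norm_triangle_sub[of y x] by linarith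
            thus "y \<in> ball 0 (L N0)" using N0 by (simp add: L_def)
          qed
          thus "ball x 1 \<subseteq> X (0 + N0)" using inside[of N0] by simp
        qed (use Xm in auto)
        hence 1: "eventually (\<lambda>N. ?S f x \<le> 2 * ?S (cutoff (X N) f) x) sequentially"
          by (rule eventually_sequentially_seg[THEN iffD1])
        have "eventually (\<lambda>N. x \<in> Z N) sequentially"
          using eventually_ge_at_top[of N0]
        proof eventually_elim
          case (elim N)
          have "norm x < L N" using N0 elim by (simp add: L_def)
          hence "\<bar>x \<bullet> i\<bar> < L N" if "i \<in> Basis" for i using Basis_le_norm[OF that, of x] by linarith
          thus ?case by (force simp: ZD)
        qed
        with 1 show ?thesis
        proof eventually_elim
          case (elim N)
          have "epowr (?S f x) p \<le> epowr (2 * ?S (cutoff (X N) f) x) p" using p by (intro epowr_mono elim) simp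
          also have "\<dots> \<le> ennreal (2 powr p) * epowr (?S (cutoff (X N) f) x) p" by (rule epowr_2_mult)
          finally have "epowr (?S f x) p * ennreal (u x) \<le> ennreal (2 powr p) * epowr (?S (cutoff (X N) f) x) p * ennreal (u x)"
            by (intro mult_right_mono) auto
          thus ?case using elim by (simp add: G_def mult.assoc)
        qed
      qed
      have Sm [measurable]: "?S (cutoff (X N) f) \<in> borel_measurable lebesgue" for N
        unfolding X_def by (rule local_op.op_star_meas[OF loc[OF L]])
      have Gm [measurable]: "G N \<in> borel_measurable lebesgue" for N unfolding G_def by measurable
      have "(\<integral>\<^sup>+x. epowr (?S f x) p * ennreal (u x) \<partial>lebesgue) \<le> (\<integral>\<^sup>+x. liminf (\<lambda>N. G N x) \<partial>lebesgue)"
        by (intro nn_integral_mono Liminf_bounded ev)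
      also have "\<dots> \<le> liminf (\<lambda>N. \<integral>\<^sup>+x. G N x \<partial>lebesgue)"
        by (rule nn_integral_liminf) (rule Gm)
      also have "\<dots> \<le> limsup (\<lambda>N. \<integral>\<^sup>+x. G N x \<partial>lebesgue)" by (rule Liminf_le_Limsup) simp
      also have "\<dots> \<le> ennreal (2 powr p) * (ennreal (cs powr p * Cb) * ennreal V)"
      proof (intro Limsup_bounded always_eventually allI)
        fix N
        have "(\<integral>\<^sup>+x. G N x \<partial>lebesgue)
            = ennreal (2 powr p) * (\<integral>\<^sup>+x. epowr (?S (cutoff (X N) f) x) p * ennreal (u x) * indicator (Z N) x \<partial>lebesgue)"
          unfolding G_def by (rule nn_integral_cmult) measurable
        also have "\<dots> \<le> ennreal (2 powr p) * (ennreal (cs powr p * Cb) * ennreal V)"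
          unfolding X_def Z_def by (intro mult_left_mono local L) simp
        finally show "(\<integral>\<^sup>+x. G N x \<partial>lebesgue) \<le> \<dots>" .
      qed
      also have "\<dots> = ennreal (2 powr p * (cs powr p * Cb)) * ennreal V"
        using Cb by (simp add: ennreal_mult mult.assoc)
      also have "\<dots> \<le> ennreal C * ennreal V" by (intro mult_right_mono ennreal_leI) (auto simp: C_def)
      finally show ?thesis using V by simp
    qed
  qed
qed

end
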